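(* Consider a twin-leader-follower network under the standing assumptions described in the context, in which every follower runs the orientation estimator described in the context. For each follower $k\in\{3,\dots,n\}$, the desired equilibrium point $(\hat{\mathbf R}_k=\mathbf R_k,\ \tilde\Omega_k=\mathbf 0)$ of the system $$\dot{\hat{\mathbf R}}_k=\hat{\mathbf R}_k(\omega_k^k-\tilde\Omega_k)^\wedge,\qquad \dot{\tilde\Omega}_k=-k_\omega\tilde\Omega_k+\mathbf e_k+\mathbf h_k(t)$$ is almost globally asymptotically stable.
   Context: Notation. For $\omega\in\mathbb R^3$, $\omega^\wedge$ is the skew-symmetric matrix with $\omega^\wedge v=\omega\times v$ for all $v\in\mathbb R^3$. Setting. A network of agents in $\mathbb R^3$; agent $i$ has a fixed position $\mathbf p_i\in\mathbb R^3$ and a true orientation $\mathbf R_i(t)\in SO(3)$ satisfying $\dot{\mathbf R}_i=\mathbf R_i(\omega_i^i)^\wedge$, where the body angular velocity $\omega_i^i(t)$ (known to agent $i$) and its derivative are bounded, $\|\omega_i^i\|\le\bar\omega_i$. The leader agents (at least two, labelled $1,2$, and possibly redundant leaders $1',2',\dots$) know their true poses, so $\hat{\mathbf R}_j=\mathbf R_j$ for every leader $j$; the followers are $3,4,\dots,n$. Each follower $i$ has a neighbor set $\mathcal N_i$ of at least two agents, all preceding $i$ in the order $1,2,1',2',\dots,3,4,\dots,n$. No two agents are collocated, and each follower has at least one pair of neighbors with which it is not collinear. Follower $i$ measures $\mathbf b_{ij}^i$ for $j\in\mathcal N_i$, and each neighbor $j\in\mathcal N_i$ measures $\mathbf b_{ji}^j$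 and transmits $\hat{\mathbf R}_j\mathbf b_{ji}^j$ to $i$. Directions. $\mathbf b_{ij}=(\mathbf p_j-\mathbf p_i)/\|\mathbf p_j-\mathbf p_i\|=-\mathbf b_{ji}$, $\mathbf b_{ij}^i=\mathbf R_i^\top\mathbf b_{ij}$, $\mathbf b_{ij}^j=\mathbf R_j^\top\mathbf b_{ij}=-\mathbf b_{ji}^j$. Put $\hat{\mathbf g}_{ij}=\hat{\mathbf R}_j\mathbf b_{ij}^j$. Convention: if $\mathcal N_i=\{j,l\}$ has two elements, a third index $*$ is added to it in all sums below, with $\mathbf b_{i*}=(\mathbf b_{ij}\times\mathbf b_{il})/\|\mathbf b_{ij}\times\mathbf b_{il}\|$, $\mathbf b_{i*}^i=\mathbf R_i^\top\mathbf b_{i*}$ and $\hat{\mathbf g}_{i*}=(\hat{\mathbf g}_{ij}\times\hat{\mathbf g}_{il})/\|\mathbf b_{ij}\times\mathbf b_{il}\|$. Gains $k_{ij}>0$ are given and $\mathbf K_i=\sum_{j\in\mathcal N_i}k_{ij}\mathbf b_{ij}\mathbf b_{ij}^\top$; it is assumed that the directions $\{\mathbf b_{ij}\}_{j\in\mathcal N_i}$ are non-coplanar, so $\mathbf K_i$ is positive definite, and that the gains are chosen so that $\mathbf K_i$ has distinct eigenvalues. Estimator. Each follower $i$ runs $\dot{\hat{\mathbf R}}_i=\hat{\mathbf R}_i(\omega_i^i-\tilde\Omega_i)^\wedge$, $\dot{\tilde\Omega}_i=-k_\omega\tilde\Omega_i+\sum_{j\in\mathcal N_i}k_{ij}(\hat{\mathbf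 R}_i^\top\hat{\mathbf g}_{ij}\times\mathbf b_{ij}^i)$, with $k_\omega>0$ and arbitrary initial values in $SO(3)\times\mathbb R^3$. This equals $\dot{\tilde\Omega}_i=-k_\omega\tilde\Omega_i+\mathbf e_i+\mathbf h_i$ with $\mathbf e_i=\sum_{j\in\mathcal N_i}k_{ij}(\hat{\mathbf R}_i^\top\mathbf b_{ij}\times\mathbf b_{ij}^i)$ and $\mathbf h_i=\sum_{j\in\mathcal N_i}k_{ij}\big(\hat{\mathbf R}_i^\top(\hat{\mathbf g}_{ij}-\mathbf b_{ij})\times\mathbf b_{ij}^i\big)$; for actual neighbors $j$, $\hat{\mathbf g}_{ij}-\mathbf b_{ij}=(\hat{\mathbf R}_j-\mathbf R_j)\mathbf b_{ij}^j$. "Almost globally asymptotically stable" means stable (in the error variables $\tilde{\mathbf Q}_i=\hat{\mathbf R}_i\mathbf R_i^\top$, $\tilde\Omega_i$ of the cascade of followers $3,\dots,k$) with $\hat{\mathbf R}_k\mathbf R_k^\top\to\mathbf I_3$, $\tilde\Omega_k\to\mathbf 0$ as $t\to\infty$ for all initial conditions of these followers outside a set of measure zero. *)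

theory Defs
  imports "HOL-Analysis.Analysis"
begin

unbundle cross3_syntax

section \<open>Rotations\<close>

definition hat :: "real^3 \<Rightarrow> real^3^3" where
  "hat w = matrix (\<lambda>v. w \<times> v)"

lemma hat_mult_vec: "hat w *v v = w \<times> v"
proof -
  have "linear (\<lambda>v. w \<times> v)"
    by (rule linearI) (simp_all add: cross_add_right cross_mult_right)
  then show ?thesis
    unfolding hat_def by simp
qed

text \<open>The Cayley transform \<open>(I - hat x)\<inverse> (I + hat x)\<close> in closed form: the rotation of the unit
  quaternion proportional to \<open>(1, x)\<close>. It is a diffeomorphism from \<open>\<real>\<^sup>3\<close> onto the rotations by an
  angle other than \<open>\<pi>\<close>, so the maps \<open>x \<mapsto> P ** cayley x\<close>, for \<open>P\<close> a rotation, are the inverse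
  charts of an atlas of \<open>SO(3)\<close>.\<close>

definition cayley :: "real^3 \<Rightarrow> real^3^3" where
  "cayley x = mat 1 + (2 / (1 + (norm x)\<^sup>2)) *\<^sub>R (hat x + hat x ** hat x)"

text \<open>Measure zero in the manifold \<open>(SO(3) \<times> \<real>\<^sup>3)\<^sup>I\<close>: Lebesgue null in every product chart.\<close>

definition null_states :: "nat set \<Rightarrow> (nat \<Rightarrow> (real^3^3) * (real^3)) set \<Rightarrow> bool" where
  "null_states I Z \<longleftrightarrow>
     (\<forall>P. (\<forall>i\<in>I. rotation_matrix (P i)) \<longrightarrow>
        (AE y in (\<Pi>\<^sub>M i\<in>I. (lborel :: ((real^3) * (real^3)) measure)).
           (\<lambda>i\<in>I. (P i ** cayley (fst (y i)), snd (y i))) \<notin> Z))"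

definition eigenvalues :: "real^3^3 \<Rightarrow> real set" where
  "eigenvalues A = {c. \<exists>v. v \<noteq> 0 \<and> A *v v = c *\<^sub>R v}"


section \<open>Networks\<close>

text \<open>\<open>Agent 1\<close>, \<open>Agent 2\<close> are the two leaders, \<open>Agent 3, \<dots>, Agent n\<close> the followers, and
  \<open>Redundant 1, Redundant 2, \<dots>\<close> the redundant leaders \<open>1', 2', \<dots>\<close>.\<close>

datatype agent = Agent nat | Redundant nat

text \<open>Neighbor sets and gains are indexed by the number of the follower. The extra index \<open>*\<close> that
  is added to a two-element neighbor set is \<open>None\<close>; an actual neighbor \<open>j\<close> is \<open>Some j\<close>.\<close>

record network =
  last_index :: nat
  num_redundant :: nat
  pos :: "agent \<Rightarrow> real^3"
  orient :: "agent \<Rightarrow> real \<Rightarrow> real^3^3"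
  angvel :: "agent \<Rightarrow> real \<Rightarrow> real^3"
  nbrs :: "nat \<Rightarrow> agent set"
  gain :: "nat \<Rightarrow> agent option \<Rightarrow> real"
  damping :: real

definition redundant_leaders :: "network \<Rightarrow> agent set" where
  "redundant_leaders G = Redundant ` {1..num_redundant G}"

definition agents :: "network \<Rightarrow> agent set" where
  "agents G = Agent ` {1..last_index G} \<union> redundant_leaders G"

definition followers :: "network \<Rightarrow> nat set" where
  "followers G = {3..last_index G}"

definition bearing :: "network \<Rightarrow> agent \<Rightarrow> agent \<Rightarrow> real^3" where
  "bearing G i j = (pos G j - pos G i) /\<^sub>R norm (pos G j - pos G i)"

definition indices :: "network \<Rightarrow> nat \<Rightarrow> agent option set" where
  "indices G i = Some ` nbrs G i \<union> (if card (nbrs G i) = 2 then {None} else {})"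

text \<open>An enumeration of a two-element neighbor set. Exchanging the two neighbors changes the sign
  of both \<open>direction G i None\<close> and \<open>ghat G E i None t\<close> below, which leaves the sums
  \<open>gain_matrix\<close>, \<open>err\<close> and \<open>pert\<close> unchanged.\<close>

definition nbr_pair :: "network \<Rightarrow> nat \<Rightarrow> agent * agent" where
  "nbr_pair G i = (SOME (j, l). nbrs G i = {j, l})"

definition nbr_cross :: "network \<Rightarrow> nat \<Rightarrow> real^3" where
  "nbr_cross G i = (case nbr_pair G i of (j, l) \<Rightarrow> bearing G (Agent i) j \<times> bearing G (Agent i) l)"

definition direction :: "network \<Rightarrow> nat \<Rightarrow> agent option \<Rightarrow> real^3" where
  "direction G i a =
     (case a of Some j \<Rightarrow> bearing G (Agent i) j
      | None \<Rightarrow> nbr_cross G i /\<^sub>R norm (nbr_cross G i))"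

definition gain_matrix :: "network \<Rightarrow> nat \<Rightarrow> real^3^3" where
  "gain_matrix G i = (\<Sum>a\<in>indices G i.
     gain G i a *\<^sub>R (\<chi> r c. direction G i a $ r * direction G i a $ c))"

locale twin_leader_follower =
  fixes G :: network
  assumes two_leaders: "2 \<le> last_index G"
    and rotation: "\<And>i t. i \<in> agents G \<Longrightarrow> 0 \<le> t \<Longrightarrow> rotation_matrix (orient G i t)"
    and kinematics: "\<And>i t. i \<in> agents G \<Longrightarrow> 0 \<le> t \<Longrightarrow>
          (orient G i has_vector_derivative (orient G i t ** hat (angvel G i t))) (at t within {0..})"
    and angvel_bounded: "\<And>i. i \<in> agents G \<Longrightarrow> \<exists>c. \<forall>t\<ge>0. norm (angvel G i t) \<le> c"
    and angvel_deriv_bounded: "\<And>i. i \<in> agents G \<Longrightarrow> \<exists>w' c. \<forall>t\<ge>0.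
          (angvel G i has_vector_derivative w' t) (at t within {0..}) \<and> norm (w' t) \<le> c"
    and not_collocated: "inj_on (pos G) (agents G)"
    and nbrs_precede: "\<And>i. i \<in> followers G \<Longrightarrow>
          nbrs G i \<subseteq> Agent ` {1..<i} \<union> redundant_leaders G"
    and two_nbrs: "\<And>i. i \<in> followers G \<Longrightarrow> 2 \<le> card (nbrs G i)"
    and not_collinear: "\<And>i. i \<in> followers G \<Longrightarrow>
          \<exists>j\<in>nbrs G i. \<exists>l\<in>nbrs G i. \<not> collinear {pos G (Agent i), pos G j, pos G l}"
    and gain_pos: "\<And>i a. i \<in> followers G \<Longrightarrow> a \<in> indices G i \<Longrightarrow> 0 < gain G i a"
    and not_coplanar: "\<And>i. i \<in> followers G \<Longrightarrow>
          \<not> coplanar (insert 0 (direction G i ` indices G i))"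
    and distinct_eigenvalues: "\<And>i. i \<in> followers G \<Longrightarrow> card (eigenvalues (gain_matrix G i)) = 3"
    and damping_pos: "0 < damping G"


section \<open>The estimator\<close>

text \<open>In the following \<open>E i t\<close> and \<open>W i t\<close> are the orientation estimate and the auxiliary vector
  of follower \<open>i\<close> at time \<open>t\<close>.\<close>

fun estimate :: "network \<Rightarrow> (nat \<Rightarrow> real \<Rightarrow> real^3^3) \<Rightarrow> agent \<Rightarrow> real \<Rightarrow> real^3^3" where
  "estimate G E (Agent i) t = (if i \<le> 2 then orient G (Agent i) t else E i t)"
| "estimate G E (Redundant r) t = orient G (Redundant r) t"

definition ghat_nbr ::
    "network \<Rightarrow> (nat \<Rightarrow> real \<Rightarrow> real^3^3) \<Rightarrow> nat \<Rightarrow> agent \<Rightarrow> real \<Rightarrow> real^3" where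
  "ghat_nbr G E i j t = estimate G E j t *v (transpose (orient G j t) *v bearing G (Agent i) j)"

definition ghat ::
    "network \<Rightarrow> (nat \<Rightarrow> real \<Rightarrow> real^3^3) \<Rightarrow> nat \<Rightarrow> agent option \<Rightarrow> real \<Rightarrow> real^3" where
  "ghat G E i a t =
     (case a of Some j \<Rightarrow> ghat_nbr G E i j t
      | None \<Rightarrow> (case nbr_pair G i of (j, l) \<Rightarrow>
          (ghat_nbr G E i j t \<times> ghat_nbr G E i l t) /\<^sub>R norm (nbr_cross G i)))"

definition body_direction :: "network \<Rightarrow> nat \<Rightarrow> agent option \<Rightarrow> real \<Rightarrow> real^3" where
  "body_direction G i a t = transpose (orient G (Agent i) t) *v direction G i a"

definition err :: "network \<Rightarrow> (nat \<Rightarrow> real \<Rightarrow> real^3^3) \<Rightarrow> nat \<Rightarrow> real \<Rightarrow> real^3" where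
  "err G E i t = (\<Sum>a\<in>indices G i.
     gain G i a *\<^sub>R ((transpose (E i t) *v direction G i a) \<times> body_direction G i a t))"

definition pert :: "network \<Rightarrow> (nat \<Rightarrow> real \<Rightarrow> real^3^3) \<Rightarrow> nat \<Rightarrow> real \<Rightarrow> real^3" where
  "pert G E i t = (\<Sum>a\<in>indices G i.
     gain G i a *\<^sub>R ((transpose (E i t) *v (ghat G E i a t - direction G i a))
       \<times> body_direction G i a t))"

text \<open>The correction term that the estimator computes from measured and transmitted data.\<close>

lemma err_plus_pert:
  "err G E i t + pert G E i t = (\<Sum>a\<in>indices G i.
     gain G i a *\<^sub>R ((transpose (E i t) *v ghat G E i a t) \<times> body_direction G i a t))"
  unfolding err_def pert_def sum.distrib[symmetric] scaleR_add_right[symmetric]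
    cross_add_left[symmetric] matrix_vector_right_distrib[symmetric]
  by (simp del: transpose_matrix_vector)

text \<open>Followers \<open>3, \<dots>, k\<close> form a closed system, since neighbors precede.\<close>

definition cascade_solution ::
    "network \<Rightarrow> nat \<Rightarrow> real \<Rightarrow> (nat \<Rightarrow> real \<Rightarrow> real^3^3) \<Rightarrow> (nat \<Rightarrow> real \<Rightarrow> real^3) \<Rightarrow> bool" where
  "cascade_solution G k t0 E W \<longleftrightarrow>
     (\<forall>i\<in>{3..k}. \<forall>t\<ge>t0.
        rotation_matrix (E i t) \<and>
        (E i has_vector_derivative (E i t ** hat (angvel G (Agent i) t - W i t)))
          (at t within {t0..}) \<and>
        (W i has_vector_derivative (- (damping G *\<^sub>R W i t) + err G E i t + pert G E i t))
          (at t within {t0..}))"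

definition att_error :: "network \<Rightarrow> (nat \<Rightarrow> real \<Rightarrow> real^3^3) \<Rightarrow> nat \<Rightarrow> real \<Rightarrow> real^3^3" where
  "att_error G E i t = E i t ** transpose (orient G (Agent i) t)"

definition cascade_stable :: "network \<Rightarrow> nat \<Rightarrow> real \<Rightarrow> bool" where
  "cascade_stable G k t0 \<longleftrightarrow>
     (\<forall>\<epsilon>>0. \<exists>\<delta>>0. \<forall>E W. cascade_solution G k t0 E W \<longrightarrow>
        (\<forall>i\<in>{3..k}. norm (att_error G E i t0 - mat 1) < \<delta> \<and> norm (W i t0) < \<delta>) \<longrightarrow>
        (\<forall>t\<ge>t0. \<forall>i\<in>{3..k}. norm (att_error G E i t - mat 1) < \<epsilon> \<and> norm (W i t) < \<epsilon>))"

definition almost_globally_attractive :: "network \<Rightarrow> nat \<Rightarrow> real \<Rightarrow> bool" where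
  "almost_globally_attractive G k t0 \<longleftrightarrow>
     (\<exists>Z. null_states {3..k} Z \<and>
        (\<forall>E W. cascade_solution G k t0 E W \<longrightarrow> (\<lambda>i\<in>{3..k}. (E i t0, W i t0)) \<notin> Z \<longrightarrow>
           (att_error G E k \<longlongrightarrow> mat 1) at_top \<and> (W k \<longlongrightarrow> 0) at_top))"

text \<open>The system is nonautonomous; the initial time \<open>t0\<close> is arbitrary, and \<open>\<delta>\<close> and \<open>Z\<close> may
  depend on it.\<close>

definition almost_globally_asymptotically_stable :: "network \<Rightarrow> nat \<Rightarrow> bool" where
  "almost_globally_asymptotically_stable G k \<longleftrightarrow>
     (\<forall>t0\<ge>0. cascade_stable G k t0 \<and> almost_globally_attractive G k t0)"


section \<open>Consistency of the definitions\<close>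

lemma hat_components:
  "hat x = vector [vector [0, - x$3, x$2], vector [x$3, 0, - x$1], vector [- x$2, x$1, 0]]"
  unfolding hat_def matrix_def
  by (simp add: vec_eq_iff forall_3 cross3_def axis_def)

lemma rotation_matrix_cayley: "rotation_matrix (cayley x)"
proof -
  define a b c where "a = x$1" and "b = x$2" and "c = x$3"
  define d where "d = 1 + a\<^sup>2 + b\<^sup>2 + c\<^sup>2"
  have n: "1 + (norm x)\<^sup>2 = d"
    unfolding d_def a_def b_def c_def power2_norm_eq_inner
    by (simp add: inner_vec_def sum_3 power2_eq_square)
  have d0: "d \<noteq> 0"
    unfolding d_def by (smt (verit) zero_le_power2)
  define s where "s = 2 / d"
  have sd: "s * d = 2" using d0 by (simp add: s_def)
  have C: "cayley x = vector [
      vector [1 - s * (b*b + c*c), s * (a*b - c), s * (a*c + b)],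
      vector [s * (a*b + c), 1 - s * (a*a + c*c), s * (b*c - a)],
      vector [s * (a*c - b), s * (b*c + a), 1 - s * (a*a + b*b)]]"
    unfolding cayley_def n s_def[symmetric] hat_components
    by (simp add: vec_eq_iff forall_3 matrix_matrix_mult_def sum_3 mat_def a_def b_def c_def
        algebra_simps)
  have sm: "s * s * m = 2 * s * m - s * s * (a*a + b*b + c*c) * m" for m
  proof -
    have "(s * d) * (s * m) = 2 * (s * m)" by (simp only: sd)
    then show ?thesis by (simp add: d_def power2_eq_square algebra_simps)
  qed
  note expand = sm[of "a*a"] sm[of "b*b"] sm[of "c*c"] sm[of "a*b"] sm[of "b*c"] sm[of "a*c"]
  have "transpose (cayley x) ** cayley x = mat 1"
    using expand unfolding C
    by (simp add: vec_eq_iff forall_3 matrix_matrix_mult_def sum_3 mat_def transpose_def)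
      (simp add: algebra_simps)
  moreover have "det (cayley x) = 1"
    using expand unfolding C det_3
    by simp (simp add: algebra_simps)
  ultimately show ?thesis
    by (simp add: rotation_matrix_def orthogonal_matrix)
qed

lemma (in twin_leader_follower) desired_equilibrium:
  assumes k: "k \<in> followers G" and t0: "0 \<le> t0"
  shows "cascade_solution G k t0 (\<lambda>i. orient G (Agent i)) (\<lambda>i t. 0)"
proof -
  let ?E = "\<lambda>i. orient G (Agent i)"
  have est: "estimate G ?E j t = orient G j t" for j t
    by (cases j) auto
  have main: "err G ?E i t = 0 \<and> pert G ?E i t = 0"
    if i: "i \<in> followers G" and t: "0 \<le> t" for i t
  proof -
    have sub: "nbrs G i \<subseteq> agents G"
      using nbrs_precede[OF i] i by (auto simp: agents_def followers_def)
    have gh: "ghat_nbr G ?E i j t = bearing G (Agent i) j" if "j \<in> nbrs G i" for j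
    proof -
      have "orient G j t ** transpose (orient G j t) = mat 1"
        using rotation[of j t] sub that t by (auto simp: rotation_matrix_def orthogonal_matrix_def)
      then show ?thesis
        by (simp add: ghat_nbr_def est matrix_vector_mul_assoc del: transpose_matrix_vector)
    qed
    have "ghat G ?E i a t = direction G i a" if a: "a \<in> indices G i" for a
    proof (cases a)
      case None
      obtain j l where jl: "nbr_pair G i = (j, l)" by fastforce
      have "card (nbrs G i) = 2"
        using a None by (auto simp: indices_def split: if_splits)
      then obtain u v where "nbrs G i = {u, v}" by (auto simp: card_2_iff)
      then have "\<exists>q. case q of (j, l) \<Rightarrow> nbrs G i = {j, l}" by auto
      from someI_ex[OF this] have "nbrs G i = {j, l}"
        using jl by (simp add: nbr_pair_def)
      with gh None jl show ?thesis
        by (simp add: ghat_def direction_def nbr_cross_def)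
    next
      case (Some j)
      then show ?thesis using a gh by (auto simp: ghat_def direction_def indices_def split: if_splits)
    qed
    then show ?thesis
      by (simp add: err_def pert_def body_direction_def)
  qed
  show ?thesis
    unfolding cascade_solution_def
  proof (intro ballI allI impI conjI)
    fix i t assume i: "i \<in> {3..k}" and t: "t0 \<le> t"
    have f: "i \<in> followers G" and ag: "Agent i \<in> agents G"
      using i k by (auto simp: followers_def agents_def)
    show "rotation_matrix (orient G (Agent i) t)"
      using rotation[OF ag] t t0 by simp
    show "(orient G (Agent i) has_vector_derivative
        orient G (Agent i) t ** hat (angvel G (Agent i) t - 0)) (at t within {t0..})"
      using has_vector_derivative_within_subset[OF kinematics[OF ag, of t], of "{t0..}"] t t0
      by simp
    show "((\<lambda>t. 0) has_vector_derivative
        - (damping G *\<^sub>R 0) + err G ?E i t + pert G ?E i t) (at t within {t0..})"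
      using main[OF f, of t] t t0 by simp
  qed
qed

end

theory Submission
  imports Defs
begin

text \<open>Put \<open>Q = E R\<^sup>T\<close> and \<open>w = R W\<close>. In these coordinates every follower obeys \<open>Q' = - Q hat w\<close>,
  \<open>w' = \<Omega> \<times> w - \<kappa> w + torque g Q\<close>, where \<open>torque g Q\<close> is the sum of the vectors \<open>k\<^sub>a (Q\<^sup>T g\<^sub>a \<times> b\<^sub>a)\<close>,
  the \<open>b\<^sub>a\<close> are the true directions, and the directions \<open>g\<^sub>a\<close> that the follower uses depend only on
  the attitude errors of the preceding followers.

  \<^bold>\<open>One follower.\<close> For exact data, \<open>g = b\<close>, this is a damped mechanical system on the rotation group:
  \<open>torque b\<close> is the gradient of the potential \<open>V Q = \<Sum> k\<^sub>a (b\<^sub>a \<bullet> b\<^sub>a - b\<^sub>a \<bullet> Q b\<^sub>a)\<close> for tangent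
  vectors \<open>Q hat x\<close>, the velocity is \<open>- w\<close>, and the gyroscopic term does no work. The mechanical
  energy has derivative \<open>- \<kappa> |w|\<^sup>2\<close>; subtracting a small multiple of \<open>w \<bullet> torque b Q\<close> makes it
  decrease strictly off the equilibria, up to a term that is quadratic in the disturbance \<open>g - b\<close>
  (\<open>strict_lyapunov_function\<close>). Near the identity this gives stability with a margin for
  disturbances (\<open>follower_stable\<close>). If the disturbance is square integrable, the torque and \<open>w\<close> tend
  to \<open>0\<close> and \<open>Q\<close> tends to one equilibrium; if that is the identity, the error is square integrable
  again (\<open>solution_reaches_equilibrium\<close>), so the argument passes from each follower to the next.

  \<^bold>\<open>The equilibria.\<close> \<open>Q\<close> is an equilibrium iff \<open>K Q\<close> is symmetric, \<open>K\<close> being the gain matrix. As \<open>K\<close> has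
  three distinct positive eigenvalues, this forces \<open>Q e\<^sub>i = \<plusminus> e\<^sub>i\<close> on the eigenbasis: only the
  identity and half turns about the \<open>e\<^sub>i\<close> remain, hence finitely many. At each of them the Hessian
  of \<open>V\<close> is nondegenerate, and away from the identity it has a negative direction
  (\<open>hessian_nondegenerate\<close>).

  \<^bold>\<open>The exceptional set.\<close> Consider two solutions with the same inputs that both stay near an
  undesired equilibrium. A quadratic form of their difference, minus the energy of the linearised
  system with a small cross term, grows exponentially once it is positive; being bounded, it never is
  (\<open>saddle_cone\<close>). The states of all such solutions at one time form a set in which no two points
  differ by a multiple of an unstable direction, and such a set is null because it has infinitely
  many disjoint translates within a bounded set (\<open>negligible_if_cone_free\<close>). Solutions depend
  Lipschitz continuously on each other, forwards and backwards in time (\<open>cascade_gronwall\<close>), so the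
  initial states in a chart are null as well, for every fixed initial state of the preceding
  followers. Limits of solutions are solutions (\<open>error_cascade_limit\<close>), which makes the trapped
  states a closed set, and Fubini's theorem shows that it is null in the product. Induction over
  the followers and a countable union over equilibria, entry times and radii finish the proof.\<close>

section \<open>Differential inequalities on half-lines\<close>

lemma at_within_atLeast: "a < x \<Longrightarrow> at x within {a..} = at x" for a x :: real
  by (rule at_within_interior) simp

lemma deriv_nonneg_imp_le:
  fixes f f' :: "real \<Rightarrow> real"
  assumes d: "\<And>t. a \<le> t \<Longrightarrow> (f has_real_derivative f' t) (at t within {a..})"
    and nn: "\<And>t. a \<le> t \<Longrightarrow> 0 \<le> f' t"
    and "a \<le> s" "s \<le> t"
  shows "f s \<le> f t"
proof (rule DERIV_nonneg_imp_increasing_open[OF \<open>s \<le> t\<close>])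
  fix x assume x: "s < x" "x < t"
  then have "(f has_real_derivative f' x) (at x)"
    using d[of x] at_within_atLeast[of a x] \<open>a \<le> s\<close> by simp
  then show "\<exists>y. DERIV f x :> y \<and> y \<ge> 0" using nn[of x] x assms by auto
next
  have "continuous_on {a..} f"
    by (rule DERIV_continuous_on[of _ f f']) (use d in auto)
  then show "continuous_on {s..t} f"
    by (rule continuous_on_subset) (use assms in auto)
qed

text \<open>The bound on \<open>\<bar>N'\<bar>\<close> makes \<open>N exp (- C t)\<close> decrease and \<open>N exp (C t)\<close> increase. The second estimate
  runs backwards in time: states that are close now were close before.\<close>

lemma gronwall_two_sided:
  fixes N N' :: "real \<Rightarrow> real"
  assumes d: "\<And>t. a \<le> t \<Longrightarrow> (N has_real_derivative N' t) (at t within {a..})"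
    and b: "\<And>t. a \<le> t \<Longrightarrow> \<bar>N' t\<bar> \<le> C * N t"
    and "a \<le> s" "s \<le> t"
  shows "N t \<le> N s * exp (C * (t - s))" "N s \<le> N t * exp (C * (t - s))"
proof -
  have "- (N s * exp (- C * s)) \<le> - (N t * exp (- C * t))"
  proof (rule deriv_nonneg_imp_le[where a=a and f="\<lambda>t. - (N t * exp (- C * t))" and f'="\<lambda>t. - ((N' t - C * N t) * exp (- C * t))"])
    fix t assume "a \<le> t"
    show "((\<lambda>t. - (N t * exp (- C * t))) has_real_derivative - ((N' t - C * N t) * exp (- C * t)))
        (at t within {a..})"
      by (rule derivative_eq_intros d[OF \<open>a \<le> t\<close>] refl)+ (simp add: algebra_simps)
    show "0 \<le> - ((N' t - C * N t) * exp (- C * t))"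
      using b[OF \<open>a \<le> t\<close>] by (simp add: mult_le_0_iff)
  qed fact+
  then have "N t * exp (- C * t) * exp (C * t) \<le> N s * exp (- C * s) * exp (C * t)"
    by (intro mult_right_mono) auto
  then show "N t \<le> N s * exp (C * (t - s))"
    by (simp add: mult.assoc exp_add[symmetric] algebra_simps)
  have "N s * exp (C * s) \<le> N t * exp (C * t)"
  proof (rule deriv_nonneg_imp_le[where a=a and f="\<lambda>t. N t * exp (C * t)" and f'="\<lambda>t. (N' t + C * N t) * exp (C * t)"])
    fix t assume "a \<le> t"
    show "((\<lambda>t. N t * exp (C * t)) has_real_derivative (N' t + C * N t) * exp (C * t))
        (at t within {a..})"
      by (rule derivative_eq_intros d[OF \<open>a \<le> t\<close>] refl)+ (simp add: algebra_simps)
    show "0 \<le> (N' t + C * N t) * exp (C * t)"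
      using b[OF \<open>a \<le> t\<close>] by (simp add: zero_le_mult_iff)
  qed fact+
  then have "N s * exp (C * s) * exp (- C * s) \<le> N t * exp (C * t) * exp (- C * s)"
    by (intro mult_right_mono) auto
  then show "N s \<le> N t * exp (C * (t - s))"
    by (simp add: mult.assoc exp_add[symmetric] algebra_simps)
qed

text \<open>A positive initial value would be multiplied by at least \<open>exp (c (t - a))\<close>, which no bound
  survives.\<close>

lemma exponential_growth_nonpos:
  fixes S S' :: "real \<Rightarrow> real"
  assumes d: "\<And>t. a \<le> t \<Longrightarrow> (S has_real_derivative S' t) (at t within {a..})"
    and grow: "\<And>t. a \<le> t \<Longrightarrow> c * S t \<le> S' t" and c: "0 < c"
    and bounded: "\<And>t. a \<le> t \<Longrightarrow> S t \<le> B"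
  shows "S a \<le> 0"
proof (rule ccontr)
  assume "\<not> S a \<le> 0"
  then have pos: "0 < S a" by simp
  have *: "S a * exp (c * (t - a)) \<le> S t" if t: "a \<le> t" for t
  proof -
    have "S a * exp (- c * a) \<le> S t * exp (- c * t)"
    proof (rule deriv_nonneg_imp_le[where a=a and f="\<lambda>t. S t * exp (- c * t)" and f'="\<lambda>t. (S' t - c * S t) * exp (- c * t)"])
      fix t assume "a \<le> t"
      show "((\<lambda>t. S t * exp (- c * t)) has_real_derivative (S' t - c * S t) * exp (- c * t))
          (at t within {a..})"
        by (rule derivative_eq_intros d[OF \<open>a \<le> t\<close>] refl)+ (simp add: algebra_simps)
      show "0 \<le> (S' t - c * S t) * exp (- c * t)"
        using grow[OF \<open>a \<le> t\<close>] by (simp add: zero_le_mult_iff)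
    qed (use t in auto)
    then have "S a * exp (- c * a) * exp (c * t) \<le> S t * exp (- c * t) * exp (c * t)"
      by (intro mult_right_mono) auto
    then show ?thesis by (simp add: mult.assoc exp_add[symmetric] algebra_simps)
  qed
  (* Here exp x is already replaced by its lower bound 1 + x, and t is chosen so that the bound B is exceeded. *)
  define t where "t = a + \<bar>B\<bar> / (S a * c)"
  have t: "a \<le> t" unfolding t_def using pos c by simp
  have "S a * (1 + c * (t - a)) \<le> S a * exp (c * (t - a))"
    by (rule mult_left_mono) (use pos exp_ge_add_one_self[of "c * (t - a)"] in auto)
  also have "\<dots> \<le> B" using *[OF t] bounded[OF t] by simp
  moreover have "S a * (1 + c * (t - a)) = S a + \<bar>B\<bar>" using pos c by (simp add: t_def distrib_left)
  ultimately have "S a + \<bar>B\<bar> \<le> B" by simp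
  then show False using pos by linarith
qed

text \<open>At the first time at which \<open>L\<close> reaches \<open>l\<close> the derivative would be negative, so \<open>L\<close> would have been
  above \<open>l\<close> shortly before.\<close>

lemma barrier:
  fixes L L' :: "real \<Rightarrow> real"
  assumes d: "\<And>t. a \<le> t \<Longrightarrow> (L has_real_derivative L' t) (at t within {a..})"
    and start: "L a < l"
    and inward: "\<And>t. a \<le> t \<Longrightarrow> L t = l \<Longrightarrow> L' t < 0"
    and "a \<le> t"
  shows "L t < l"
proof (rule ccontr)
  assume "\<not> L t < l"
  then have t: "l \<le> L t" by simp
  have cont: "continuous_on {a..} L"
    by (rule DERIV_continuous_on[of _ L L']) (use d in auto)
  define X where "X = {s \<in> {a..t}. l \<le> L s}"
  have cont': "continuous_on {a..v} L" for v
    by (rule continuous_on_subset[OF cont]) auto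
  have "closed X" unfolding X_def
    by (rule continuous_on_closed_Collect_le) (simp_all add: cont' continuous_on_const)
  moreover have ne: "X \<noteq> {}" using t \<open>a \<le> t\<close> by (auto simp: X_def)
  moreover have bb: "bdd_below X" unfolding X_def by (rule bdd_belowI[of _ a]) auto
  ultimately have mem: "Inf X \<in> X" by (simp add: closed_contains_Inf)
  define u where "u = Inf X"
  have u: "a \<le> u" "u \<le> t" "l \<le> L u" using mem by (auto simp: u_def X_def)
  have below: "L s < l" if "a \<le> s" "s < u" for s
    using cInf_lower[OF _ bb, of s] that u unfolding u_def[symmetric] by (force simp: X_def)
  have au: "a < u" using u start by (cases "u = a") auto
  have "\<exists>s\<ge>a. s \<le> u \<and> L s = l"
    by (rule IVT') (use u start cont'[of u] in auto)
  then obtain s where "a \<le> s" "s \<le> u" "L s = l" by blast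
  then have Lu: "L u = l" using below[of s] by (cases "s = u") auto
  have "(L has_real_derivative L' u) (at u)"
    using d[of u] at_within_atLeast[OF au] au by simp
  from DERIV_neg_dec_left[OF this inward[OF u(1) Lu]]
  obtain e where e: "e > 0" "\<And>h. h > 0 \<Longrightarrow> h < e \<Longrightarrow> L u < L (u - h)" by blast
  define h where "h = min (e/2) (u - a)"
  have "L u < L (u - h)" by (rule e) (use e au in \<open>auto simp: h_def\<close>)
  moreover have "L (u - h) < l" by (rule below) (use e au in \<open>auto simp: h_def\<close>)
  ultimately show False using Lu by simp
qed

text \<open>A form of Barbalat's lemma. As \<open>m\<close> has bounded slope, each time at which \<open>m\<close> is at least \<open>e\<close> starts an
  interval of fixed length on which it is at least \<open>e / 2\<close>, and there \<open>L\<close> drops by a fixed amount;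
  near its infimum \<open>L\<close> has no room for such a drop.\<close>

lemma dissipation_tendsto_zero:
  fixes L L' m m' :: "real \<Rightarrow> real"
  assumes dL: "\<And>t. a \<le> t \<Longrightarrow> (L has_real_derivative L' t) (at t within {a..})"
    and dm: "\<And>t. a \<le> t \<Longrightarrow> (m has_real_derivative m' t) (at t within {a..})"
    and diss: "\<And>t. a \<le> t \<Longrightarrow> L' t \<le> - m t"
    and L0: "\<And>t. a \<le> t \<Longrightarrow> 0 \<le> L t"
    and m0: "\<And>t. a \<le> t \<Longrightarrow> 0 \<le> m t"
    and mB: "\<And>t. a \<le> t \<Longrightarrow> \<bar>m' t\<bar> \<le> B"
  shows "(m \<longlongrightarrow> 0) at_top"
proof (rule tendstoI)
  fix e :: real assume e: "0 < e"
  define B1 where "B1 = \<bar>B\<bar> + 1"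
  have B1: "0 < B1" "\<And>t. a \<le> t \<Longrightarrow> \<bar>m' t\<bar> \<le> B1"
    using mB by (force simp: B1_def)+
  (* m changes by at most e / 2 within time e / (2 * B1). *)
  define \<tau> where "\<tau> = e / (2 * B1)"
  have \<tau>: "0 < \<tau>" using e B1 by (simp add: \<tau>_def)
  have dec: "L t \<le> L s" if "a \<le> s" "s \<le> t" for s t
  proof -
    have "- L s \<le> - L t"
    proof (rule deriv_nonneg_imp_le[where a=a and f="\<lambda>t. - L t" and f'="\<lambda>t. - L' t"])
      fix t assume t: "a \<le> t"
      show "((\<lambda>t. - L t) has_real_derivative - L' t) (at t within {a..})"
        by (rule DERIV_minus[OF dL[OF t]])
      show "0 \<le> - L' t" using diss[OF t] m0[OF t] by linarith
    qed fact+
    then show ?thesis by simp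
  qed
  define l where "l = Inf (L ` {a..})"
  have bb: "bdd_below (L ` {a..})" by (rule bdd_belowI[of _ 0]) (use L0 in auto)
  have lower: "l \<le> L t" if "a \<le> t" for t
    unfolding l_def by (rule cInf_lower[OF _ bb]) (use that in auto)
  have "\<exists>x\<in>L ` {a..}. x < l + e * \<tau> / 2"
  proof (rule ccontr)
    assume "\<not> ?thesis"
    then have "l + e * \<tau> / 2 \<le> l" unfolding l_def
      by (intro cInf_greatest) (auto simp: not_less)
    then show False using e \<tau> by (simp add: mult_le_0_iff)
  qed
  then obtain t1 where t1: "a \<le> t1" "L t1 < l + e * \<tau> / 2" by auto
  have "m t < e" if t: "t1 \<le> t" for t
  proof (rule ccontr)
    assume "\<not> m t < e"
    then have mt: "e \<le> m t" by simp
    have at: "a \<le> t" using t t1 by simp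
    have mlow: "e / 2 \<le> m s" if s: "t \<le> s" "s \<le> t + \<tau>" for s
    proof -
      have "m t + B1 * t \<le> m s + B1 * s"
      proof (rule deriv_nonneg_imp_le[where a=t and f="\<lambda>t. m t + B1 * t" and f'="\<lambda>t. m' t + B1"])
        fix x assume x: "t \<le> x"
        then have ax: "a \<le> x" using at by simp
        have "(m has_real_derivative m' x) (at x within {t..})"
          by (rule has_field_derivative_subset[OF dm[OF ax]]) (use at in auto)
        then show "((\<lambda>t. m t + B1 * t) has_real_derivative m' x + B1) (at x within {t..})"
          by (auto intro!: derivative_eq_intros)
        show "0 \<le> m' x + B1" using B1(2)[OF ax] by (simp add: abs_le_iff)
      qed (use s in auto)
      then have "m t - B1 * (s - t) \<le> m s" by (simp add: algebra_simps)
      moreover have "B1 * (s - t) \<le> B1 * \<tau>" using s B1 by (intro mult_left_mono) auto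
      moreover have "B1 * \<tau> = e / 2" using B1 by (simp add: \<tau>_def)
      ultimately show ?thesis using mt by linarith
    qed
    have "L (t + \<tau>) + e / 2 * (t + \<tau>) \<le> L t + e / 2 * t"
    proof -
      have D: "\<exists>y. DERIV (\<lambda>s. - (L s + e / 2 * s)) x :> y \<and> y \<ge> 0" if x: "t < x" "x < t + \<tau>" for x
      proof (intro exI conjI)
        have "(L has_real_derivative L' x) (at x)"
          using dL[of x] at_within_atLeast[of a x] x(1) at by simp
        then show "DERIV (\<lambda>s. - (L s + e / 2 * s)) x :> - (L' x + e / 2)"
          by (intro DERIV_minus) (rule DERIV_add, assumption, rule DERIV_cmult_Id)
        show "0 \<le> - (L' x + e / 2)" using diss[of x] mlow[of x] x at by simp
      qed
      have C: "continuous_on {t..t+\<tau>} (\<lambda>s. - (L s + e / 2 * s))"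
      proof -
        have "continuous_on {a..} L"
          by (rule DERIV_continuous_on[of _ L L']) (use dL in auto)
        then have "continuous_on {t..t+\<tau>} L" by (rule continuous_on_subset) (use at in auto)
        then show ?thesis by (intro continuous_intros)
      qed
      have "- (L t + e / 2 * t) \<le> - (L (t+\<tau>) + e / 2 * (t+\<tau>))"
        using \<tau> D C by (intro DERIV_nonneg_imp_increasing_open[of t "t+\<tau>" "\<lambda>s. - (L s + e / 2 * s)"]) simp_all
      then show ?thesis by simp
    qed
    then have "L (t + \<tau>) \<le> L t - e * \<tau> / 2" by (simp add: field_simps)
    also have "\<dots> < l" using dec[OF t1(1) t] t1(2) by simp
    finally show False using lower[of "t+\<tau>"] at \<tau> by simp
  qed
  then show "\<forall>\<^sub>F t in at_top. dist (m t) 0 < e"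
    unfolding eventually_at_top_linorder
    by (intro exI[of _ t1]) (use m0 t1 in \<open>auto simp: abs_of_nonneg\<close>)
qed


section \<open>Matrices and rotations\<close>

lemma row_matrix_mult: "(X ** Y) $ i = X $ i v* (Y :: real^'n^'m)"
  by (simp add: matrix_matrix_mult_def vector_matrix_mult_def vec_eq_iff mult.commute)

lemma norm_matrix_vector_le: "norm (X *v x) \<le> norm X * norm (x :: real^'n)"
proof -
  have "norm ((X *v x) $ i) \<le> norm (X $ i) * norm x" for i
    using Cauchy_Schwarz_ineq2[of "X $ i" x] by (simp add: matrix_mult_dot)
  then have "norm (X *v x) \<le> L2_set (\<lambda>i. norm (X $ i) * norm x) UNIV"
    unfolding norm_vec_def by (intro L2_set_mono) auto
  also have "\<dots> = norm X * norm x"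
    by (simp add: L2_set_left_distrib[symmetric] norm_vec_def)
  finally show ?thesis .
qed

lemma norm_vector_matrix_le: "norm (x v* X) \<le> norm (x :: real^'n) * norm (X :: real^'m^'n)"
proof -
  have "norm (x v* X) * norm (x v* X) = x \<bullet> (X *v (x v* X))"
    by (simp add: dot_lmul_matrix[symmetric] norm_eq_sqrt_inner)
  also have "\<dots> \<le> norm x * norm (X *v (x v* X))"
    by (rule norm_cauchy_schwarz)
  also have "\<dots> \<le> norm x * (norm X * norm (x v* X))"
    by (intro mult_left_mono norm_matrix_vector_le) auto
  finally have "norm (x v* X) * norm (x v* X) \<le> (norm x * norm X) * norm (x v* X)"
    by (simp add: mult.assoc)
  then show ?thesis
    by (cases "norm (x v* X) = 0") (simp, simp add: mult_le_cancel_right)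
qed

lemma norm_matrix_mult_le: "norm (X ** Y) \<le> norm (X :: real^'n^'k) * norm (Y :: real^'m^'n)"
proof -
  have "norm (X ** Y) \<le> L2_set (\<lambda>i. norm (X $ i) * norm Y) UNIV"
    unfolding norm_vec_def[of "X ** Y"] row_matrix_mult
    by (intro L2_set_mono) (auto intro: norm_vector_matrix_le)
  also have "\<dots> = norm X * norm Y"
    by (simp add: L2_set_left_distrib[symmetric] norm_vec_def[of X])
  finally show ?thesis .
qed

lemma norm_cross_le: "norm (x \<times> y) \<le> norm x * norm y"
proof (rule power2_le_imp_le)
  show "(norm (x \<times> y))\<^sup>2 \<le> (norm x * norm y)\<^sup>2"
    using norm_cross_dot[of x y] by (smt (verit) zero_le_power2)
qed simp

lemma bounded_bilinear_matrix_mult: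
  "bounded_bilinear ((**) :: real^'n^'k \<Rightarrow> real^'m^'n \<Rightarrow> real^'m^'k)" (is "bounded_bilinear ?f")
proof (rule bounded_bilinear.intro)
  show "\<exists>K. \<forall>a b. norm (?f a b) \<le> norm a * norm b * K"
    by (intro exI[of _ 1]) (simp add: norm_matrix_mult_le)
qed (simp_all add: matrix_matrix_mult_def vec_eq_iff sum.distrib sum_distrib_left algebra_simps)

lemmas matrix_mult_diff =
  bounded_bilinear.diff_left[OF bounded_bilinear_matrix_mult]
  bounded_bilinear.diff_right[OF bounded_bilinear_matrix_mult]

lemma bounded_bilinear_matrix_vec:
  "bounded_bilinear ((*v) :: real^'n^'m \<Rightarrow> real^'n \<Rightarrow> real^'m)" (is "bounded_bilinear ?f")
proof (rule bounded_bilinear.intro)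
  show "\<exists>K. \<forall>a b. norm (?f a b) \<le> norm a * norm b * K"
    by (intro exI[of _ 1]) (simp add: norm_matrix_vector_le)
qed (simp_all add: matrix_vector_mult_def vec_eq_iff sum.distrib sum_distrib_left algebra_simps)

lemma bounded_bilinear_vec_matrix:
  "bounded_bilinear ((v*) :: real^'n \<Rightarrow> real^'m^'n \<Rightarrow> real^'m)" (is "bounded_bilinear ?f")
proof (rule bounded_bilinear.intro)
  show "\<exists>K. \<forall>a b. norm (?f a b) \<le> norm a * norm b * K"
    by (intro exI[of _ 1]) (simp add: norm_vector_matrix_le)
qed (simp_all add: vector_matrix_mult_def vec_eq_iff sum.distrib sum_distrib_left algebra_simps)

lemma bounded_bilinear_cross:
  "bounded_bilinear ((\<times>))" (is "bounded_bilinear ?f")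
proof (rule bounded_bilinear.intro)
  show "\<exists>K. \<forall>a b. norm (?f a b) \<le> norm a * norm b * K"
    by (intro exI[of _ 1]) (simp add: norm_cross_le)
qed (simp_all add: cross_add_left cross_add_right cross_mult_left cross_mult_right)

lemmas has_vector_derivative_inner = bounded_bilinear.has_vector_derivative[OF bounded_bilinear_inner]

lemma bounded_linear_transpose: "bounded_linear (transpose :: real^'n^'m \<Rightarrow> real^'m^'n)"
  by (intro linear_conv_bounded_linear[THEN iffD1] linearI)
    (simp_all add: transpose_def vec_eq_iff)

lemma linear_hat: "linear hat"
  by (rule linearI) (simp_all add: hat_components vec_eq_iff forall_3)

lemma bounded_linear_hat: "bounded_linear hat"
  using linear_hat by (simp add: linear_conv_bounded_linear)

lemma norm_hat_le: "norm (hat x) \<le> 2 * norm x"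
proof (rule power2_le_imp_le)
  have "(norm (hat x))\<^sup>2 = 2 * (norm x)\<^sup>2"
    by (simp add: power2_norm_eq_inner inner_vec_def sum_3 hat_components)
  then show "(norm (hat x))\<^sup>2 \<le> (2 * norm x)\<^sup>2" by (simp add: power_mult_distrib)
qed simp

lemma skew_eq_hat:
  assumes "transpose Y = - Y"
  shows "Y = hat (vector [Y$3$2, Y$1$3, Y$2$1])"
proof -
  have *: "Y $ i $ j = - Y $ j $ i" for i j
    using arg_cong[OF assms, of "\<lambda>X. X $ j $ i"]
    by (simp only: transpose_def vec_lambda_beta vector_uminus_component)
  have "Y $ i $ i = 0" for i
    using *[of i i] by simp
  then show ?thesis
    using *[of 1 2] *[of 3 1] *[of 2 3] by (simp add: hat_components vec_eq_iff forall_3)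
qed

lemma rotation_inverse:
  assumes "rotation_matrix Q"
  shows "transpose Q ** Q = mat 1" "Q ** transpose Q = mat 1"
  using assms by (auto simp: rotation_matrix_def orthogonal_matrix_def)

lemma rotation_transpose: "rotation_matrix Q \<Longrightarrow> rotation_matrix (transpose Q)"
  by (simp add: rotation_matrix_def)

lemma rotation_mult:
  "rotation_matrix P \<Longrightarrow> rotation_matrix Q \<Longrightarrow> rotation_matrix (P ** (Q :: real^'n^'n))"
  by (simp add: rotation_matrix_def orthogonal_matrix_mul det_mul)

lemma rotation_one: "rotation_matrix (mat 1 :: real^'n^'n)"
  by (simp add: rotation_matrix_def orthogonal_matrix_id)

lemma rotation_inner:
  assumes "rotation_matrix Q"
  shows "(Q *v x) \<bullet> (Q *v y) = x \<bullet> (y :: real^'n)"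
proof -
  have "(Q *v x) \<bullet> (Q *v y) = ((Q *v x) v* Q) \<bullet> y" by (simp only: dot_lmul_matrix)
  also have "(Q *v x) v* Q = x"
    using rotation_inverse(1)[OF assms]
    by (metis matrix_vector_mul_assoc matrix_vector_mul_lid transpose_matrix_vector)
  finally show ?thesis .
qed

lemma rotation_norm: "rotation_matrix Q \<Longrightarrow> norm (Q *v x) = norm (x :: real^'n)"
  by (simp add: norm_eq_sqrt_inner rotation_inner)

lemma norm_transpose: "norm (transpose X) = norm (X :: real^'n^'m)"
proof -
  have "(\<Sum>i\<in>UNIV. \<Sum>j\<in>UNIV. X $ j $ i * X $ j $ i) = (\<Sum>i\<in>UNIV. \<Sum>j\<in>UNIV. X $ i $ j * X $ i $ j)"
    by (rule sum.swap)
  then show ?thesis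
    by (simp add: norm_eq_sqrt_inner inner_vec_def transpose_def)
qed

lemma norm_mult_rotation_right:
  assumes "rotation_matrix Q"
  shows "norm (X ** Q) = norm (X :: real^'n^'m)"
proof -
  have "norm (x v* Q) = norm x" for x
    using rotation_norm[OF rotation_transpose[OF assms], of x] by simp
  then show ?thesis unfolding norm_vec_def row_matrix_mult by simp
qed

lemma norm_mult_rotation_left:
  assumes "rotation_matrix Q"
  shows "norm (Q ** X) = norm (X :: real^'n^'n)"
  using norm_mult_rotation_right[OF rotation_transpose[OF assms], of "transpose X"]
  by (metis matrix_transpose_mul norm_transpose)

lemma norm_rotation_le: "rotation_matrix Q \<Longrightarrow> norm Q \<le> 2" for Q :: "real^3^3"
proof -
  assume "rotation_matrix Q"
  then have "norm Q = norm (mat 1 :: real^3^3)"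
    using norm_mult_rotation_left[of Q "mat 1"] by simp
  also have "\<dots> \<le> 2"
    by (rule power2_le_imp_le)
      (simp_all add: power2_norm_eq_inner inner_vec_def sum_3 mat_def)
  finally show ?thesis .
qed

lemma closed_rotations: "closed {Q :: real^'n^'n. rotation_matrix Q}"
proof -
  have 1: "continuous_on UNIV (\<lambda>Q :: real^'n^'n. transpose Q ** Q)"
    by (intro continuous_intros bounded_bilinear.continuous_on[OF bounded_bilinear_matrix_mult]
        bounded_linear.continuous_on[OF bounded_linear_transpose])
  have 2: "continuous_on UNIV (\<lambda>Q :: real^'n^'n. det Q)"
    unfolding det_def by (intro continuous_intros)
  show ?thesis
    unfolding rotation_matrix_def orthogonal_matrix
    by (intro closed_Collect_conj closed_Collect_eq 1 2 continuous_on_const)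
qed

text \<open>Rotations preserve the cross product, so conjugation by \<open>R\<close> moves the axis of \<open>hat x\<close> by \<open>R\<close>.\<close>

lemma rotation_congruence_hat:
  assumes "rotation_matrix R"
  shows "R ** hat x ** transpose R = hat (R *v x)"
proof -
  have "(R ** hat x ** transpose R) *v v = hat (R *v x) *v v" for v
  proof -
    have "(R ** hat x ** transpose R) *v v = R *v (x \<times> (transpose R *v v))"
      by (simp only: matrix_vector_mul_assoc[symmetric] hat_mult_vec)
    also have "\<dots> = (R *v x) \<times> (R *v (transpose R *v v))"
      by (simp only: cross_rotation_matrix[OF assms])
    also have "R *v (transpose R *v v) = v"
      by (simp only: matrix_vector_mul_assoc rotation_inverse(2)[OF assms] matrix_vector_mul_lid)
    finally show ?thesis by (simp only: hat_mult_vec)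
  qed
  then show ?thesis by (simp add: matrix_eq)
qed


section \<open>The potential on the rotation group and its critical points\<close>

text \<open>The data of one follower: the directions \<open>b\<close> to its neighbors and their gains \<open>k\<close>. The last
  assumption says that the gain matrix has three eigenvalues.\<close>

locale weighted_directions =
  fixes A :: "'a set" and k :: "'a \<Rightarrow> real" and b :: "'a \<Rightarrow> real^3"
  assumes finite_A: "finite A"
    and k_pos: "\<And>a. a \<in> A \<Longrightarrow> 0 < k a"
    and spanning: "span (b ` A) = UNIV"
    and distinct: "card {c. \<exists>v. v \<noteq> 0 \<and> (\<Sum>a\<in>A. (k a * (b a \<bullet> v)) *\<^sub>R b a) = c *\<^sub>R v} = 3"
begin

definition torque :: "('a \<Rightarrow> real^3) \<Rightarrow> real^3^3 \<Rightarrow> real^3" where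
  "torque g X = (\<Sum>a\<in>A. k a *\<^sub>R ((g a v* X) \<times> b a))"

definition stiffness :: "real^3 \<Rightarrow> real^3" where
  "stiffness x = (\<Sum>a\<in>A. (k a * (b a \<bullet> x)) *\<^sub>R b a)"

text \<open>A weighted sum of the quantities \<open>|b\<^sub>a - Q b\<^sub>a|\<^sup>2 / 2\<close> when \<open>Q\<close> is a rotation; in this form it is
  affine in \<open>Q\<close>, which makes it easy to differentiate.\<close>

definition potential :: "real^3^3 \<Rightarrow> real" where
  "potential Q = (\<Sum>a\<in>A. k a * (b a \<bullet> b a - b a \<bullet> (Q *v b a)))"

text \<open>The linearisation of the torque at \<open>P\<close>, with tangent vectors \<open>P ** hat x\<close>. At an equilibrium it is
  the Hessian of the potential.\<close>

definition hessian :: "real^3^3 \<Rightarrow> real^3 \<Rightarrow> real^3" where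
  "hessian P x = torque b (P ** hat x)"

definition equilibrium :: "real^3^3 \<Rightarrow> bool" where
  "equilibrium P \<longleftrightarrow> rotation_matrix P \<and> torque b P = 0"

definition torque_bound :: real where
  "torque_bound = (\<Sum>a\<in>A. k a * norm (b a))"

lemma torque_bound_nonneg: "0 \<le> torque_bound"
  unfolding torque_bound_def by (intro sum_nonneg mult_nonneg_nonneg less_imp_le[OF k_pos]) auto

text \<open>Testing the torque against a vector turns every triple product into a pairing that is linear in
  \<open>X\<close>; the identities for the derivatives of potential and torque are read off from this form.\<close>

lemma torque_inner: "torque g X \<bullet> w = (\<Sum>a\<in>A. k a * (g a \<bullet> (X *v (b a \<times> w))))"
proof -
  have "((g a v* X) \<times> b a) \<bullet> w = g a \<bullet> (X *v (b a \<times> w))" for a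
  proof -
    have "((g a v* X) \<times> b a) \<bullet> w = (g a v* X) \<bullet> (b a \<times> w)"
      by (simp add: cross3_simps)
    then show ?thesis by (simp only: dot_lmul_matrix)
  qed
  then show ?thesis by (simp add: torque_def inner_sum_left)
qed

lemma linear_torque: "linear (torque g)"
  unfolding torque_def
  by (intro linear_compose_sum ballI linear_compose_scale_right
      bounded_linear.linear bounded_linear_compose[OF
        bounded_bilinear.bounded_linear_left[OF bounded_bilinear_cross]
        bounded_bilinear.bounded_linear_right[OF bounded_bilinear_vec_matrix]])

lemma bounded_linear_torque: "bounded_linear (torque g)"
  using linear_torque by (simp add: linear_conv_bounded_linear)

lemma torque_diff_directions: "torque (\<lambda>a. g a - h a) X = torque g X - torque h X"
  by (simp add: torque_def sum_subtractf[symmetric] scaleR_diff_right[symmetric]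
      bounded_bilinear.diff_left[OF bounded_bilinear_vec_matrix] 
      bounded_bilinear.diff_left[OF bounded_bilinear_cross])

lemma norm_torque_le:
  assumes "\<And>a. a \<in> A \<Longrightarrow> norm (g a) \<le> G"
  shows "norm (torque g X) \<le> G * torque_bound * norm X"
proof -
  have "norm (k a *\<^sub>R ((g a v* X) \<times> b a)) \<le> G * norm X * (k a * norm (b a))" if a: "a \<in> A" for a
  proof -
    have "norm ((g a v* X) \<times> b a) \<le> norm (g a v* X) * norm (b a)" by (rule norm_cross_le)
    also have "\<dots> \<le> (norm (g a) * norm X) * norm (b a)"
      by (intro mult_right_mono norm_vector_matrix_le) simp
    also have "\<dots> \<le> (G * norm X) * norm (b a)"
      by (intro mult_right_mono assms a) auto
    finally have "k a * norm ((g a v* X) \<times> b a) \<le> k a * (G * norm X * norm (b a))"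
      by (intro mult_left_mono less_imp_le[OF k_pos[OF a]])
    then show ?thesis using k_pos[OF a] by (simp add: abs_of_pos mult_ac)
  qed
  then have "norm (torque g X) \<le> (\<Sum>a\<in>A. G * norm X * (k a * norm (b a)))"
    unfolding torque_def by (rule sum_norm_le)
  then show ?thesis by (simp add: torque_bound_def sum_distrib_left mult_ac)
qed

lemma stiffness_inner: "stiffness x \<bullet> y = (\<Sum>a\<in>A. k a * ((b a \<bullet> x) * (b a \<bullet> y)))"
  by (simp add: stiffness_def inner_sum_left mult.assoc)

lemma stiffness_sym: "stiffness x \<bullet> y = x \<bullet> stiffness y"
  by (subst inner_commute[of x]) (simp add: stiffness_inner mult_ac)

lemma linear_stiffness: "linear stiffness"
  by (rule linearI) (simp_all add: stiffness_def inner_add_right algebra_simps sum.distrib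
      scaleR_sum_right)

lemma directions_separate:
  assumes "\<And>a. a \<in> A \<Longrightarrow> b a \<bullet> x = 0"
  shows "x = 0"
proof -
  have "x \<in> span (b ` A)" by (simp add: spanning)
  moreover have "x \<bullet> y = 0" if "y \<in> b ` A" for y using assms that by (auto simp: inner_commute)
  ultimately have "x \<bullet> x = 0"
    by (metis orthogonal_def orthogonal_to_span)
  then show ?thesis by simp
qed

lemma stiffness_pos: "x \<noteq> 0 \<Longrightarrow> 0 < stiffness x \<bullet> x"
proof (rule ccontr)
  assume x: "x \<noteq> 0" and "\<not> 0 < stiffness x \<bullet> x"
  then have le: "(\<Sum>a\<in>A. k a * ((b a \<bullet> x) * (b a \<bullet> x))) \<le> 0" by (simp add: stiffness_inner)
  have nn: "0 \<le> k a * ((b a \<bullet> x) * (b a \<bullet> x))" if "a \<in> A" for a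
    using k_pos[OF that] by simp
  have "(\<Sum>a\<in>A. k a * ((b a \<bullet> x) * (b a \<bullet> x))) = 0"
    by (intro antisym le sum_nonneg nn)
  then have "\<forall>a\<in>A. k a * ((b a \<bullet> x) * (b a \<bullet> x)) = 0"
    by (subst (asm) sum_nonneg_eq_0_iff[OF finite_A nn]) auto
  then have "b a \<bullet> x = 0" if "a \<in> A" for a using that k_pos[OF that] by auto
  then show False using directions_separate x by blast
qed

text \<open>In matrix notation the linearised torque is \<open>tr (K P) - P\<^sup>T K\<close>, where \<open>K\<close> is the stiffness.\<close>

lemma hessian_inner:
  "hessian P x \<bullet> w = (x \<bullet> w) * (\<Sum>a\<in>A. k a * (b a \<bullet> (P *v b a))) - stiffness x \<bullet> (P *v w)"
proof -
  have *: "b a \<bullet> ((P ** hat x) *v (b a \<times> w))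
      = (x \<bullet> w) * (b a \<bullet> (P *v b a)) - (b a \<bullet> x) * (b a \<bullet> (P *v w))" for a
  proof -
    have "(P ** hat x) *v (b a \<times> w) = P *v (x \<times> (b a \<times> w))"
      by (simp only: matrix_vector_mul_assoc[symmetric] hat_mult_vec)
    also have "x \<times> (b a \<times> w) = (x \<bullet> w) *\<^sub>R b a - (b a \<bullet> x) *\<^sub>R w"
      by (simp add: Lagrange inner_commute)
    finally show ?thesis
      by (simp add: matrix_vector_mult_diff_distrib matrix_vector_mult_scaleR inner_diff_right)
  qed
  then show ?thesis
    by (simp add: hessian_def torque_inner * stiffness_inner sum_distrib_left
        sum_subtractf Rings.right_diff_distrib mult_ac)
qed

text \<open>Up to a factor the torque at \<open>P\<close> is the axis of the skew part of \<open>K P\<close>, so it vanishes iff \<open>K P\<close> is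
  symmetric. Every vector is a cross product, and testing against \<open>x \<times> y\<close> gives the symmetry
  directly.\<close>

lemma equilibrium_symmetric:
  assumes "equilibrium P"
  shows "stiffness x \<bullet> (P *v y) = stiffness y \<bullet> (P *v x)"
proof -
  have "b a \<bullet> (P *v (b a \<times> (x \<times> y))) = (b a \<bullet> y) * (b a \<bullet> (P *v x)) - (b a \<bullet> x) * (b a \<bullet> (P *v y))" for a
    by (simp add: Lagrange matrix_vector_mult_diff_distrib matrix_vector_mult_scaleR inner_diff_right)
  then have "torque b P \<bullet> (x \<times> y) = stiffness y \<bullet> (P *v x) - stiffness x \<bullet> (P *v y)"
    by (simp add: torque_inner stiffness_inner sum_subtractf[symmetric] Rings.right_diff_distrib)
  then show ?thesis using assms by (simp add: equilibrium_def)
qed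

definition eigenbasis :: "(3 \<Rightarrow> real) \<Rightarrow> (3 \<Rightarrow> real^3) \<Rightarrow> bool" where
  "eigenbasis l e \<longleftrightarrow> inj l \<and> (\<forall>i. 0 < l i) \<and> (\<forall>i. stiffness (e i) = l i *\<^sub>R e i) \<and>
     (\<forall>i j. e i \<bullet> e j = (if i = j then 1 else 0)) \<and> (\<forall>x. x = (\<Sum>i\<in>UNIV. (x \<bullet> e i) *\<^sub>R e i))"

lemma eigenbasisD:
  assumes "eigenbasis l e"
  shows "inj l" "\<And>i. 0 < l i" "\<And>i. stiffness (e i) = l i *\<^sub>R e i"
    "\<And>i j. e i \<bullet> e j = (if i = j then 1 else 0)"
    "\<And>x. x = (\<Sum>i\<in>UNIV. (x \<bullet> e i) *\<^sub>R e i)"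
  using assms unfolding eigenbasis_def by auto

text \<open>Eigenvectors of a symmetric map for distinct eigenvalues are orthogonal, and the spanning
  directions make the eigenvalues positive.\<close>

lemma eigenbasis_exists: "\<exists>l e. eigenbasis l e"
proof -
  let ?S = "{c. \<exists>v. v \<noteq> 0 \<and> stiffness v = c *\<^sub>R v}"
  have c3: "card ?S = 3" using distinct by (simp add: stiffness_def)
  then have "finite ?S" by (intro card_ge_0_finite) simp
  then obtain l :: "3 \<Rightarrow> real" where l: "bij_betw l UNIV ?S"
    using finite_same_card_bij[of "UNIV :: 3 set" ?S] c3 by auto
  then have inj: "inj l" by (simp add: bij_betw_def)
  have "\<exists>v. v \<noteq> 0 \<and> stiffness v = l i *\<^sub>R v" for i
    using l by (auto simp: bij_betw_def)
  then obtain v where v: "\<And>i. v i \<noteq> 0" "\<And>i. stiffness (v i) = l i *\<^sub>R v i" by metis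
  define e where "e i = v i /\<^sub>R norm (v i)" for i
  have st: "stiffness (e i) = l i *\<^sub>R e i" for i
    by (simp add: e_def linear_scale[OF linear_stiffness] v mult.commute)
  have unit: "e i \<bullet> e i = 1" for i
    using v(1)[of i] by (simp add: e_def dot_square_norm power2_eq_square)
  have orth: "e i \<bullet> e j = 0" if "i \<noteq> j" for i j
  proof -
    have "l i * (e i \<bullet> e j) = l j * (e i \<bullet> e j)"
      using stiffness_sym[of "e i" "e j"] by (simp add: st)
    moreover have "l i \<noteq> l j" using inj that by (auto dest: injD)
    ultimately show ?thesis by simp
  qed
  have ee: "e i \<bullet> e j = (if i = j then 1 else 0)" for i j
    using unit orth by simp
  have pos: "0 < l i" for i
  proof -
    have "e i \<noteq> 0" using unit[of i] by auto
    from stiffness_pos[OF this] show ?thesis by (simp add: st unit)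
  qed
  have inje: "inj e"
  proof (rule injI)
    fix i j assume "e i = e j" then show "i = j" using ee[of i j] unit[of j] by (auto split: if_splits)
  qed
  have pw: "pairwise orthogonal (range e)"
    by (auto simp: pairwise_def orthogonal_def ee)
  have n0: "0 \<notin> range e"
  proof
    assume "0 \<in> range e"
    then obtain i where "e i = 0" by auto
    then show False using unit[of i] by simp
  qed
  have "independent (range e)" by (rule pairwise_orthogonal_independent[OF pw n0])
  then have "span (range e) = UNIV"
    using card_ge_dim_independent[of "range e" UNIV] inje
    by (auto simp: card_image)
  then have "x = (\<Sum>i\<in>UNIV. (x \<bullet> e i) *\<^sub>R e i)" for x
  proof -
    have "norm y = 1" if "y \<in> range e" for y
      using that unit by (auto simp: norm_eq_sqrt_inner)
    from orthonormal_basis_expand[OF pw this, of x, symmetric] \<open>span (range e) = UNIV\<close>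
    show ?thesis by (simp add: sum.reindex[OF inje])
  qed
  with inj pos st ee show ?thesis unfolding eigenbasis_def by blast
qed

text \<open>Let \<open>N = K P\<close>. Symmetry gives \<open>N = P\<^sup>T K\<close>, hence \<open>N\<^sup>2 = N N\<^sup>T = K\<^sup>2\<close>. So \<open>N\<close> commutes with \<open>K\<^sup>2\<close>, whose
  eigenvalues are distinct because those of \<open>K\<close> are distinct and positive; \<open>N\<close> is therefore diagonal
  in the eigenbasis, with entries \<open>\<plusminus> l\<^sub>i\<close>. The relation between the signs says that the determinant
  is \<open>1\<close>.\<close>

lemma equilibrium_signs:
  assumes P: "equilibrium P"
    and E: "eigenbasis l e"
  shows "\<exists>s :: 3 \<Rightarrow> real. (\<forall>i. s i = 1 \<or> s i = - 1) \<and> (\<forall>i. P *v e i = s i *\<^sub>R e i) \<and>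
    s 1 * s 2 = s 3"
proof -
  note l = eigenbasisD(1,2)[OF E] and st = eigenbasisD(3)[OF E]
    and ee = eigenbasisD(4)[OF E] and expand = eigenbasisD(5)[OF E]
  have rot: "rotation_matrix P" using P by (simp add: equilibrium_def)
  define N where "N x = stiffness (P *v x)" for x
  have ext: "x = y" if "\<And>z. x \<bullet> z = y \<bullet> z" for x y :: "real^3"
    using that vector_eq_rdot by blast
  have Nsym: "N x \<bullet> y = x \<bullet> N y" for x y
    using equilibrium_symmetric[OF P, of x y] stiffness_sym[of "P *v x" y] stiffness_sym[of x "P *v y"]
    by (simp add: N_def inner_commute[of "P *v x"])
  have Nalt: "N x = stiffness x v* P" for x
  proof (rule ext)
    fix z
    have "N x \<bullet> z = stiffness x \<bullet> (P *v z)"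
      by (simp add: Nsym) (simp add: N_def stiffness_sym)
    then show "N x \<bullet> z = (stiffness x v* P) \<bullet> z" by (simp only: dot_lmul_matrix)
  qed
  have NN: "N (N x) = stiffness (stiffness x)" for x
  proof (rule ext)
    fix z
    have "N (N x) \<bullet> z = N x \<bullet> N z" by (rule Nsym)
    also have "\<dots> = (transpose P *v stiffness x) \<bullet> (transpose P *v stiffness z)"
      by (simp add: Nalt)
    also have "\<dots> = stiffness x \<bullet> stiffness z"
      by (rule rotation_inner[OF rotation_transpose[OF rot]])
    finally show "N (N x) \<bullet> z = stiffness (stiffness x) \<bullet> z" by (simp add: stiffness_sym)
  qed
  have KK: "stiffness (stiffness (e i)) = (l i)\<^sup>2 *\<^sub>R e i" for i
    by (simp add: st linear_scale[OF linear_stiffness] power2_eq_square)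
  have linN: "N (c *\<^sub>R x) = c *\<^sub>R N x" for c x
    by (simp add: N_def matrix_vector_mult_scaleR linear_scale[OF linear_stiffness])
  have off: "N (e i) \<bullet> e j = 0" if "i \<noteq> j" for i j
  proof -
    have "(l j)\<^sup>2 * (N (e i) \<bullet> e j) = N (e i) \<bullet> stiffness (stiffness (e j))"
      by (simp add: KK)
    also have "\<dots> = stiffness (stiffness (N (e i))) \<bullet> e j" by (simp only: stiffness_sym)
    also have "\<dots> = N (N (N (e i))) \<bullet> e j" by (simp only: NN[of "N (e i)"])
    also have "\<dots> = (l i)\<^sup>2 * (N (e i) \<bullet> e j)" by (simp add: NN[of "e i"] KK linN)
    finally have "((l j)\<^sup>2 - (l i)\<^sup>2) * (N (e i) \<bullet> e j) = 0" by (simp add: algebra_simps)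
    moreover have "(l j)\<^sup>2 \<noteq> (l i)\<^sup>2"
      using l that by (metis injD less_imp_le power2_eq_imp_eq)
    ultimately show ?thesis by simp
  qed
  define m where "m i = N (e i) \<bullet> e i" for i
  have Ne: "N (e i) = m i *\<^sub>R e i" for i
  proof -
    have "(N (e i) \<bullet> e j) *\<^sub>R e j = (if j = i then m i *\<^sub>R e i else 0)" for j
      using off[of i j] by (simp add: m_def)
    then show ?thesis by (subst expand[of "N (e i)"]) (simp add: sum.delta)
  qed
  have m2: "(m i)\<^sup>2 = (l i)\<^sup>2" for i
  proof -
    have "(m i)\<^sup>2 *\<^sub>R e i = (l i)\<^sup>2 *\<^sub>R e i"
      using NN[of "e i"] by (simp add: Ne linN KK power2_eq_square)
    moreover have "e i \<noteq> 0" using ee[of i i] by auto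
    ultimately show ?thesis by simp
  qed
  define s where "s i = m i / l i" for i
  have s: "s i = 1 \<or> s i = - 1" for i
    using m2[of i] l(2)[of i] by (auto simp: s_def power2_eq_iff)
  have tP: "e i v* P = s i *\<^sub>R e i" for i
  proof -
    have "l i *\<^sub>R (e i v* P) = m i *\<^sub>R e i"
      using Nalt[of "e i"] by (simp add: Ne st bounded_bilinear.scaleR_left[OF bounded_bilinear_vec_matrix])
    then have "(1 / l i) *\<^sub>R (l i *\<^sub>R (e i v* P)) = (1 / l i) *\<^sub>R (m i *\<^sub>R e i)" by simp
    then show ?thesis using l(2)[of i] by (simp add: s_def)
  qed
  have Pe: "P *v e i = s i *\<^sub>R e i" for i
  proof -
    have "P *v (transpose P *v e i) = e i"
      by (simp only: matrix_vector_mul_assoc rotation_inverse[OF rot] matrix_vector_mul_lid)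
    then have "s i *\<^sub>R (s i *\<^sub>R (P *v e i)) = s i *\<^sub>R e i" by (simp add: tP matrix_vector_mult_scaleR)
    moreover have "s i * s i = 1" using s[of i] by auto
    ultimately show ?thesis by simp
  qed
  have det: "s 1 * s 2 = s 3"
  proof -
    (* A rotation preserves cross products, and this one spans the line of e 3. *)
    define x where "x = e 1 \<times> e 2"
    have "(norm x)\<^sup>2 = 1"
      using norm_cross_dot[of "e 1" "e 2"] by (simp add: x_def ee norm_eq_sqrt_inner)
    then have x0: "x \<noteq> 0" by auto
    have "x \<bullet> e 1 = 0" "x \<bullet> e 2 = 0" by (simp_all add: x_def dot_cross_self)
    then have x: "x = (x \<bullet> e 3) *\<^sub>R e 3" by (subst expand[of x]) (simp add: sum_3)
    have "(s 1 * s 2) *\<^sub>R x = (P *v e 1) \<times> (P *v e 2)"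
      by (simp add: Pe x_def cross_mult_left cross_mult_right)
    also have "\<dots> = P *v x" unfolding x_def by (rule cross_rotation_matrix[OF rot])
    also have "\<dots> = s 3 *\<^sub>R x"
      by (subst x, subst (2) x) (simp add: matrix_vector_mult_scaleR Pe)
    finally show ?thesis using x0 by simp
  qed
  from s Pe det show ?thesis by blast
qed

text \<open>An equilibrium is determined by its three signs.\<close>

lemma finite_equilibria: "finite {P. equilibrium P}"
proof -
  obtain l e where E: "eigenbasis l e" using eigenbasis_exists by blast
  note l = eigenbasisD(1,2)[OF E] and st = eigenbasisD(3)[OF E]
    and ee = eigenbasisD(4)[OF E] and expand = eigenbasisD(5)[OF E]
  define F where "F P = (\<lambda>i. (P *v e i) \<bullet> e i)" for P :: "real^3^3"
  have sgn: "(F P i = 1 \<or> F P i = - 1) \<and> P *v e i = F P i *\<^sub>R e i" if P: "equilibrium P" for P i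
  proof -
    obtain s where s: "\<And>i. s i = 1 \<or> s i = - 1" "\<And>i. P *v e i = s i *\<^sub>R e i"
      and "s 1 * s 2 = s 3"
      using equilibrium_signs[OF P E] by blast
    then have "F P i = s i" by (simp add: F_def ee)
    with s show ?thesis by simp
  qed
  have "inj_on F {P. equilibrium P}"
  proof (rule inj_onI)
    fix P Q assume *: "P \<in> {P. equilibrium P}" "Q \<in> {P. equilibrium P}" "F P = F Q"
    have "P *v x = Q *v x" for x
    proof -
      have "P *v e i = Q *v e i" for i using sgn[of P i] sgn[of Q i] * by simp
      then have "P *v (\<Sum>i\<in>UNIV. (x \<bullet> e i) *\<^sub>R e i) = Q *v (\<Sum>i\<in>UNIV. (x \<bullet> e i) *\<^sub>R e i)"
        by (simp add: sum_3 matrix_vector_right_distrib matrix_vector_mult_scaleR)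
      then show ?thesis by (simp only: expand[symmetric])
    qed
    then show "P = Q" by (simp add: matrix_eq)
  qed
  moreover have "F ` {P. equilibrium P} \<subseteq> UNIV \<rightarrow>\<^sub>E {1, - 1}"
    using sgn by auto
  then have "finite (F ` {P. equilibrium P})"
    by (rule finite_subset) (simp add: finite_PiE)
  ultimately show ?thesis by (simp add: finite_image_iff)
qed

lemma hessian_sym:
  assumes "equilibrium P"
  shows "hessian P x \<bullet> y = x \<bullet> hessian P y"
  unfolding inner_commute[of x "hessian P y"]
  by (simp only: hessian_inner equilibrium_symmetric[OF assms, of x y] inner_commute[of x y])

lemma linear_hessian: "linear (hessian P)"
proof -
  have "linear (\<lambda>x. P ** hat x)"
    by (rule linear_compose[OF linear_hat bounded_linear.linear[OF
          bounded_bilinear.bounded_linear_right[OF bounded_bilinear_matrix_mult]], unfolded o_def])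
  from linear_compose[OF this linear_torque] show ?thesis
    unfolding hessian_def o_def .
qed

text \<open>In the eigenbasis the Hessian is diagonal, and its entry at \<open>e\<^sub>i\<close> is the sum of the two other
  products \<open>s\<^sub>j l\<^sub>j\<close>. It is nonzero since the \<open>l\<^sub>j\<close> are distinct and positive. If \<open>P\<close> is not the
  identity, two signs are \<open>-1\<close>, and the entry at the third vector is negative.\<close>

lemma hessian_nondegenerate:
  assumes P: "equilibrium P"
  shows "hessian P x = 0 \<Longrightarrow> x = 0"
    and "P \<noteq> mat 1 \<Longrightarrow> \<exists>v. v \<bullet> hessian P v < 0"
proof -
  obtain l e where E: "eigenbasis l e" using eigenbasis_exists by blast
  note l = eigenbasisD(1,2)[OF E] and st = eigenbasisD(3)[OF E]
    and ee = eigenbasisD(4)[OF E] and expand = eigenbasisD(5)[OF E]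
  obtain s where s: "\<And>i. s i = 1 \<or> s i = - 1" and Pe: "\<And>i. P *v e i = s i *\<^sub>R e i"
    and det: "s 1 * s 2 = s 3"
    using equilibrium_signs[OF P E] by blast
  define \<tau> where "\<tau> = (\<Sum>i\<in>UNIV. s i * l i)"
  have tr: "(\<Sum>a\<in>A. k a * (b a \<bullet> (P *v b a))) = \<tau>"
  proof -
    have "b a \<bullet> (P *v b a) = (\<Sum>i\<in>UNIV. s i * ((b a \<bullet> e i) * (b a \<bullet> e i)))" for a
    proof -
      have "P *v b a = P *v (\<Sum>i\<in>UNIV. (b a \<bullet> e i) *\<^sub>R e i)" by (simp only: expand[symmetric])
      also have "\<dots> = (\<Sum>i\<in>UNIV. (b a \<bullet> e i) *\<^sub>R (s i *\<^sub>R e i))"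
        by (simp add: sum_3 matrix_vector_right_distrib matrix_vector_mult_scaleR Pe)
      finally show ?thesis by (simp add: inner_sum_right algebra_simps)
    qed
    then have "(\<Sum>a\<in>A. k a * (b a \<bullet> (P *v b a)))
        = (\<Sum>a\<in>A. \<Sum>i\<in>UNIV. s i * (k a * ((b a \<bullet> e i) * (b a \<bullet> e i))))"
      by (simp add: sum_distrib_left mult.left_commute)
    also have "\<dots> = (\<Sum>i\<in>UNIV. \<Sum>a\<in>A. s i * (k a * ((b a \<bullet> e i) * (b a \<bullet> e i))))"
      by (rule sum.swap)
    also have "\<dots> = (\<Sum>i\<in>UNIV. s i * (stiffness (e i) \<bullet> e i))"
      by (simp add: sum_distrib_left stiffness_inner)
    finally show ?thesis by (simp add: st ee \<tau>_def)
  qed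
  define h where "h i = \<tau> - s i * l i" for i
  have ss: "s i * s i = 1" for i using s[of i] by auto
  have he: "hessian P (e i) \<bullet> y = h i * (e i \<bullet> y)" for i y
  proof -
    have "s i * (e i \<bullet> (P *v y)) = (P *v e i) \<bullet> (P *v y)" by (simp add: Pe)
    also have "\<dots> = e i \<bullet> y"
      using P by (intro rotation_inner) (simp add: equilibrium_def)
    finally have "s i * s i * (e i \<bullet> (P *v y)) = s i * (e i \<bullet> y)" by (simp add: mult.assoc)
    then have "e i \<bullet> (P *v y) = s i * (e i \<bullet> y)" by (simp add: ss)
    then show ?thesis
      by (simp add: hessian_inner tr st h_def algebra_simps)
  qed
  have lneq: "l 1 \<noteq> l 2" "l 1 \<noteq> l 3" "l 2 \<noteq> l 3" using l(1) by (auto dest: injD)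
  have hval: "h 1 = s 2 * l 2 + s 3 * l 3" "h 2 = s 1 * l 1 + s 3 * l 3" "h 3 = s 1 * l 1 + s 2 * l 2"
    by (simp_all add: h_def \<tau>_def sum_3)
  have h0: "h i \<noteq> 0" for i
    using exhaust_3[of i] s[of 1] s[of 2] s[of 3] lneq l(2)[of 1] l(2)[of 2] l(2)[of 3]
    by (auto simp: hval)
  show "x = 0" if x: "hessian P x = 0"
  proof -
    have "x \<bullet> e i = 0" for i
      using he[of i x] hessian_sym[OF P, of x "e i"] h0[of i] x by (simp add: inner_commute)
    then show ?thesis by (subst expand[of x]) simp
  qed
  show "\<exists>v. v \<bullet> hessian P v < 0" if "P \<noteq> mat 1"
  proof -
    have "\<exists>i. h i < 0"
    proof (rule ccontr)
      assume "\<not> ?thesis"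
      then have nn: "0 \<le> h 1" "0 \<le> h 2" "0 \<le> h 3" by (auto simp: not_less)
      then have "s 1 = 1 \<and> s 2 = 1 \<and> s 3 = 1"
        using s[of 1] s[of 2] s[of 3] det l(2)[of 1] l(2)[of 2] l(2)[of 3] unfolding hval
        by (elim disjE) auto
      then have "s i = 1" for i using exhaust_3[of i] by auto
      then have "P *v x = x" for x
      proof -
        have "P *v (\<Sum>i\<in>UNIV. (x \<bullet> e i) *\<^sub>R e i) = (\<Sum>i\<in>UNIV. (x \<bullet> e i) *\<^sub>R e i)"
          using \<open>\<And>i. s i = 1\<close>
          by (simp add: sum_3 matrix_vector_right_distrib matrix_vector_mult_scaleR Pe)
        then show ?thesis by (simp only: expand[symmetric])
      qed
      then have "P = mat 1" by (simp add: matrix_eq)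
      with that show False by simp
    qed
    then obtain i where "h i < 0" by blast
    then have "e i \<bullet> hessian P (e i) < 0"
      using he[of i "e i"] by (simp add: inner_commute ee)
    then show ?thesis by blast
  qed
qed

text \<open>The torque is a local coordinate on the rotation group around an equilibrium. The difference of
  two rotations near \<open>P\<close> is \<open>P ** hat x\<close> up to a small multiple of itself, and the Hessian is bounded
  below.\<close>

lemma torque_expands_near_equilibrium:
  assumes P: "equilibrium P"
  shows "\<exists>r>0. \<exists>c>0. \<forall>Q1 Q2. rotation_matrix Q1 \<longrightarrow> rotation_matrix Q2 \<longrightarrow>
    norm (Q1 - P) \<le> r \<longrightarrow> norm (Q2 - P) \<le> r \<longrightarrow> c * norm (Q1 - Q2) \<le> norm (torque b (Q1 - Q2))"
proof -
  have rot: "rotation_matrix P" using P by (simp add: equilibrium_def)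
  have "inj (hessian P)"
    using hessian_nondegenerate(1)[OF P] linear_injective_0[OF linear_hessian] by blast
  then obtain c0 where c0: "0 < c0" "\<And>x. c0 * norm x \<le> norm (hessian P x)"
    using linear_inj_bounded_below_pos[OF linear_hessian] by blast
  obtain C where C: "0 < C" "\<And>X. norm (torque b X) \<le> norm X * C"
    using bounded_linear.pos_bounded[OF bounded_linear_torque[of b]] by blast
  (* The bound 1/4 makes the skew part at least half of the difference; the second one keeps the
     torque of the symmetric part below half of the lower bound from the Hessian. *)
  define r where "r = min (1/4) (c0 / (16 * C))"
  have r: "0 < r" "r \<le> 1/4" "16 * C * r \<le> c0"
    using c0 C by (auto simp: r_def field_simps min_def)
  have "c0 / 8 * norm (Q1 - Q2) \<le> norm (torque b (Q1 - Q2))"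
    if Q: "rotation_matrix Q1" "rotation_matrix Q2" "norm (Q1 - P) \<le> r" "norm (Q2 - P) \<le> r" for Q1 Q2
  proof -
    note bil = matrix_mult_diff
    note tr = linear_diff[OF bounded_linear.linear[OF bounded_linear_transpose]]
    define D where "D = Q1 - Q2"
    define X1 where "X1 = transpose P ** Q1"
    define X2 where "X2 = transpose P ** Q2"
    define Y where "Y = X1 - X2"
    have X: "rotation_matrix X1" "rotation_matrix X2"
      unfolding X1_def X2_def by (intro rotation_mult rotation_transpose rot Q)+
    have YD: "Y = transpose P ** D" by (simp add: Y_def X1_def X2_def D_def bil)
    have nY: "norm Y = norm D" unfolding YD by (rule norm_mult_rotation_left[OF rotation_transpose[OF rot]])
    have "P ** Y = (P ** transpose P) ** D" unfolding YD by (simp only: matrix_mul_assoc)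
    then have PY: "P ** Y = D" by (simp only: rotation_inverse(2)[OF rot] matrix_mul_lid)
    have "mat 1 - X1 = transpose P ** (P - Q1)"
      by (simp add: X1_def bil rotation_inverse(1)[OF rot])
    then have n1: "norm (mat 1 - X1) \<le> r"
      using Q(3) norm_mult_rotation_left[OF rotation_transpose[OF rot], of "P - Q1"]
      by (simp add: norm_minus_commute)
    have nD: "norm D \<le> 2 * r"
      using norm_triangle_ineq4[of "Q1 - P" "Q2 - P"] Q(3,4) by (simp add: D_def)
    define S where "S = (1/2) *\<^sub>R (Y + transpose Y)"
    (* For orthogonal matrices the symmetric part of the difference is of second order. *)
    have sym: "Y + transpose Y = transpose Y ** Y + transpose (mat 1 - X1) ** Y + transpose Y ** (mat 1 - X1)"
      by (simp add: Y_def tr bil rotation_inverse(1)[OF X(1)] rotation_inverse(1)[OF X(2)]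
          transpose_mat algebra_simps)
    have "norm (Y + transpose Y) \<le> norm (transpose Y ** Y)
        + norm (transpose (mat 1 - X1) ** Y) + norm (transpose Y ** (mat 1 - X1))"
      unfolding sym by (rule order_trans[OF norm_triangle_ineq add_right_mono[OF norm_triangle_ineq]])
    also have "\<dots> \<le> norm Y * norm Y + norm (mat 1 - X1) * norm Y + norm Y * norm (mat 1 - X1)"
      by (intro add_mono order_trans[OF norm_matrix_mult_le]) (simp_all add: norm_transpose)
    also have "\<dots> \<le> (2 * r) * norm Y + r * norm Y + norm Y * r"
      by (intro add_mono mult_right_mono mult_left_mono n1) (simp_all add: nY nD)
    finally have nS: "norm S \<le> 2 * r * norm D" by (simp add: S_def nY)
    define K where "K = (1/2) *\<^sub>R (Y - transpose Y)"
    have YK: "Y = K + S" by (simp add: K_def S_def scaleR_add_right[symmetric])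
    have "transpose K = - K"
      by (simp add: K_def tr linear_scale[OF bounded_linear.linear[OF bounded_linear_transpose]]
          transpose_transpose scaleR_diff_right)
    from skew_eq_hat[OF this] obtain x where x: "K = hat x" by blast
    have "norm D \<le> norm K + norm S"
      unfolding nY[symmetric] by (subst YK) (rule norm_triangle_ineq)
    moreover have "norm K \<le> 2 * norm x" unfolding x by (rule norm_hat_le)
    moreover have "2 * r * norm D \<le> 1/2 * norm D"
      using r by (intro mult_right_mono) auto
    ultimately have xD: "norm D \<le> 4 * norm x" using nS by linarith
    have "D = P ** hat x + P ** S"
      using PY by (simp add: YK x matrix_add_ldistrib)
    then have "torque b D = hessian P x + torque b (P ** S)"
      by (simp add: linear_add[OF linear_torque] hessian_def)
    then have "norm (hessian P x) - norm (torque b (P ** S)) \<le> norm (torque b D)"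
      by (simp add: norm_diff_ineq)
    moreover have "norm (torque b (P ** S)) \<le> 2 * r * norm D * C"
      using order_trans[OF C(2)[of "P ** S"], of "2 * r * norm D * C"] mult_right_mono[OF nS, of C] C(1)
      unfolding norm_mult_rotation_left[OF rot] by linarith
    moreover have "c0 * norm D \<le> 4 * norm (hessian P x)"
      using c0(2)[of x] mult_left_mono[OF xD, of c0] c0(1) by linarith
    moreover have "16 * (2 * r * norm D * C) \<le> 2 * (c0 * norm D)"
      using mult_right_mono[OF r(3) norm_ge_zero[of D]] by (simp add: mult_ac)
    ultimately have "c0 * norm D \<le> 8 * norm (torque b D)" by linarith
    then show ?thesis by (simp add: D_def)
  qed
  then show ?thesis using r c0 by (intro exI[of _ r] exI[of _ "c0/8"] conjI allI impI) auto
qed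

lemma torque_one: "torque b (mat 1) = 0"
  by (simp add: torque_def)

lemma equilibrium_one: "equilibrium (mat 1)"
  by (simp add: equilibrium_def rotation_one torque_one)

lemma norm_torque_le_attitude_error: "\<exists>C>0. \<forall>Q. norm (torque b Q) \<le> C * norm (Q - mat 1)"
proof -
  obtain C where C: "0 < C" "\<And>X. norm (torque b X) \<le> norm X * C"
    using bounded_linear.pos_bounded[OF bounded_linear_torque[of b]] by blast
  have "norm (torque b Q) \<le> C * norm (Q - mat 1)" for Q
    using C(2)[of "Q - mat 1"]
    by (simp add: linear_diff[OF linear_torque] torque_one mult.commute)
  then show ?thesis using C(1) by blast
qed

text \<open>The best constant is the smallest eigenvalue.\<close>

lemma stiffness_coercive: "\<exists>c>0. \<forall>x. c * (norm x)\<^sup>2 \<le> stiffness x \<bullet> x"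
proof -
  obtain l e where E: "eigenbasis l e" using eigenbasis_exists by blast
  note l = eigenbasisD(1,2)[OF E] and st = eigenbasisD(3)[OF E] and expand = eigenbasisD(5)[OF E]
  define c where "c = min (l 1) (min (l 2) (l 3))"
  have c: "0 < c" "c \<le> l i" for i
    using l(2)[of 1] l(2)[of 2] l(2)[of 3] exhaust_3[of i] by (auto simp: c_def)
  have "c * (norm x)\<^sup>2 \<le> stiffness x \<bullet> x" for x
  proof -
    have y: "x \<bullet> y = (\<Sum>i\<in>UNIV. (x \<bullet> e i) * (e i \<bullet> y))" for y
      by (subst expand[of x]) (simp add: inner_sum_left)
    have "stiffness x \<bullet> x = x \<bullet> stiffness x" by (rule stiffness_sym)
    also have "\<dots> = (\<Sum>i\<in>UNIV. (x \<bullet> e i) * (e i \<bullet> stiffness x))" by (rule y)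
    also have "\<dots> = (\<Sum>i\<in>UNIV. l i * (x \<bullet> e i)\<^sup>2)"
    proof (rule sum.cong[OF refl])
      fix i
      have "e i \<bullet> stiffness x = l i * (x \<bullet> e i)"
        using stiffness_sym[of "e i" x] by (simp add: st inner_commute[of x "e i"])
      then show "(x \<bullet> e i) * (e i \<bullet> stiffness x) = l i * (x \<bullet> e i)\<^sup>2"
        by (simp add: power2_eq_square)
    qed
    finally have "stiffness x \<bullet> x = (\<Sum>i\<in>UNIV. l i * (x \<bullet> e i)\<^sup>2)" .
    moreover have "(norm x)\<^sup>2 = (\<Sum>i\<in>UNIV. (x \<bullet> e i)\<^sup>2)"
      unfolding power2_norm_eq_inner using y[of x]
      by (simp add: power2_eq_square inner_commute[of "e _" x])
    moreover have "(\<Sum>i\<in>UNIV. c * (x \<bullet> e i)\<^sup>2) \<le> (\<Sum>i\<in>UNIV. l i * (x \<bullet> e i)\<^sup>2)"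
      by (intro sum_mono mult_right_mono c) simp
    ultimately show ?thesis by (simp add: sum_distrib_left)
  qed
  then show ?thesis using c(1) by blast
qed

text \<open>On rotations the potential is \<open>\<Sum> k\<^sub>a |(Q - 1) b\<^sub>a|\<^sup>2 / 2\<close>. Summed over the rows of \<open>Q - 1\<close> this is a
  value of the stiffness form, which is positive definite. The lower bound is global on the
  rotation group.\<close>

lemma potential_bounds:
  "\<exists>c>0. \<exists>C>0. \<forall>Q. rotation_matrix Q \<longrightarrow>
     c * (norm (Q - mat 1))\<^sup>2 \<le> potential Q \<and> potential Q \<le> C * (norm (Q - mat 1))\<^sup>2"
proof -
  obtain c where c: "0 < c" "\<And>x. c * (norm x)\<^sup>2 \<le> stiffness x \<bullet> x"
    using stiffness_coercive by blast
  define C where "C = (\<Sum>a\<in>A. k a * (norm (b a))\<^sup>2) + 1"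
  have C: "0 < C"
    unfolding C_def by (intro add_nonneg_pos sum_nonneg mult_nonneg_nonneg less_imp_le[OF k_pos]) auto
  have "c / 2 * (norm (Q - mat 1))\<^sup>2 \<le> potential Q \<and> potential Q \<le> C * (norm (Q - mat 1))\<^sup>2"
    if Q: "rotation_matrix Q" for Q
  proof -
    define X where "X = Q - mat 1"
    have half: "b a \<bullet> b a - b a \<bullet> (Q *v b a) = (norm (X *v b a))\<^sup>2 / 2" for a
      using rotation_inner[OF Q, of "b a" "b a"]
      by (simp add: X_def matrix_vector_mult_diff_rdistrib power2_norm_eq_inner
          inner_diff_left inner_diff_right inner_commute)
    have pot: "potential Q = (\<Sum>a\<in>A. k a * (norm (X *v b a))\<^sup>2) / 2"
      by (simp add: potential_def half sum_divide_distrib)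
    have nv: "(norm (X *v y))\<^sup>2 = (\<Sum>i\<in>UNIV. (y \<bullet> X $ i)\<^sup>2)" for y
      unfolding power2_norm_eq_inner inner_vec_def[of "X *v y" "X *v y"]
      by (simp add: matrix_vector_mul_component inner_commute power2_eq_square)
    have "(norm X)\<^sup>2 = (\<Sum>i\<in>UNIV. (norm (X $ i))\<^sup>2)"
      unfolding power2_norm_eq_inner by (rule inner_vec_def)
    then have "c * (norm X)\<^sup>2 = (\<Sum>i\<in>UNIV. c * (norm (X $ i))\<^sup>2)" by (simp add: sum_distrib_left)
    also have "\<dots> \<le> (\<Sum>i\<in>UNIV. stiffness (X $ i) \<bullet> X $ i)"
      by (intro sum_mono c)
    also have "\<dots> = (\<Sum>i\<in>UNIV. \<Sum>a\<in>A. k a * (b a \<bullet> X $ i)\<^sup>2)"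
      by (simp add: stiffness_inner power2_eq_square)
    also have "\<dots> = (\<Sum>a\<in>A. \<Sum>i\<in>UNIV. k a * (b a \<bullet> X $ i)\<^sup>2)"
      by (rule sum.swap)
    also have "\<dots> = 2 * potential Q"
      by (simp add: pot nv) (simp add: sum_distrib_left)
    finally have 1: "c / 2 * (norm X)\<^sup>2 \<le> potential Q" by simp
    have "(\<Sum>a\<in>A. k a * (norm (X *v b a))\<^sup>2) \<le> (\<Sum>a\<in>A. k a * (norm (b a))\<^sup>2 * (norm X)\<^sup>2)"
    proof (rule sum_mono)
      fix a assume a: "a \<in> A"
      have "(norm (X *v b a))\<^sup>2 \<le> (norm X * norm (b a))\<^sup>2"
        by (intro power_mono norm_matrix_vector_le) simp
      from mult_left_mono[OF this less_imp_le[OF k_pos[OF a]]]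
      show "k a * (norm (X *v b a))\<^sup>2 \<le> k a * (norm (b a))\<^sup>2 * (norm X)\<^sup>2"
        by (simp add: power_mult_distrib mult_ac)
    qed
    also have "\<dots> = (C - 1) * (norm X)\<^sup>2" by (simp add: C_def sum_distrib_right)
    finally have "2 * potential Q \<le> (C - 1) * (norm X)\<^sup>2" by (simp add: pot)
    moreover have "(C - 1) * (norm X)\<^sup>2 \<le> 2 * (C * (norm X)\<^sup>2)"
    proof -
      have "(C - 1) * (norm X)\<^sup>2 \<le> (2 * C) * (norm X)\<^sup>2" using C by (intro mult_right_mono) auto
      then show ?thesis by simp
    qed
    ultimately have "potential Q \<le> C * (norm X)\<^sup>2" by simp
    with 1 show ?thesis by (simp add: X_def)
  qed
  then show ?thesis using c(1) C by (intro exI[of _ "c/2"] exI[of _ C] conjI allI impI) auto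
qed

section \<open>A strict Lyapunov function\<close>

text \<open>The mechanical energy with a cross term, whose derivative supplies the missing
  \<open>- \<epsilon> |torque b Q|\<^sup>2\<close>.\<close>

definition energy :: "real \<Rightarrow> real^3^3 \<Rightarrow> real^3 \<Rightarrow> real" where
  "energy \<epsilon> Q w = potential Q + (w \<bullet> w) / 2 - \<epsilon> * (w \<bullet> torque b Q)"

text \<open>The potential is affine in \<open>Q\<close> and its derivative along \<open>Q' = - Q hat w\<close> is \<open>- torque b Q \<bullet> w\<close>.\<close>

lemma energy_derivative:
  assumes Q: "(Q has_vector_derivative - (Q t ** hat (w t))) (at t within S)"
    and w: "(w has_vector_derivative v) (at t within S)"
  shows "((\<lambda>t. energy \<epsilon> (Q t) (w t)) has_real_derivative
    (- (torque b (Q t) \<bullet> w t) + w t \<bullet> v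
       - \<epsilon> * (v \<bullet> torque b (Q t) - w t \<bullet> torque b (Q t ** hat (w t))))) (at t within S)"
proof -
  define \<phi> where "\<phi> X = (\<Sum>a\<in>A. k a * (b a \<bullet> (X *v b a)))" for X :: "real^3^3"
  have "linear \<phi>"
    unfolding \<phi>_def by (rule linearI)
      (simp_all add: matrix_vector_mult_add_rdistrib inner_add_right distrib_left sum.distrib
        scaleR_matrix_vector_assoc[symmetric] sum_distrib_left mult.left_commute)
  then have "bounded_linear \<phi>" by (simp add: linear_conv_bounded_linear)
  then have 1: "((\<lambda>t. \<phi> (Q t)) has_vector_derivative \<phi> (- (Q t ** hat (w t)))) (at t within S)"
    by (rule bounded_linear.has_vector_derivative) (rule Q)
  have "\<phi> (Q t ** hat (w t)) = - (torque b (Q t) \<bullet> w t)"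
  proof -
    have "b a \<bullet> ((Q t ** hat (w t)) *v b a) = - (b a \<bullet> (Q t *v (b a \<times> w t)))" for a
    proof -
      have "(Q t ** hat (w t)) *v b a = Q t *v (w t \<times> b a)"
        by (simp only: matrix_vector_mul_assoc[symmetric] hat_mult_vec)
      also have "w t \<times> b a = - (b a \<times> w t)" by (rule cross_skew)
      finally show ?thesis
        by (simp add: bounded_bilinear.minus_right[OF bounded_bilinear_matrix_vec])
    qed
    then show ?thesis by (simp add: \<phi>_def torque_inner sum_negf)
  qed
  then have "\<phi> (- (Q t ** hat (w t))) = torque b (Q t) \<bullet> w t"
    using linear_neg[OF \<open>linear \<phi>\<close>] by simp
  with 1 have d1: "((\<lambda>t. \<phi> (Q t)) has_vector_derivative torque b (Q t) \<bullet> w t) (at t within S)" by simp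
  have "((\<lambda>t. torque b (Q t)) has_vector_derivative torque b (- (Q t ** hat (w t)))) (at t within S)"
    by (rule bounded_linear.has_vector_derivative[OF bounded_linear_torque Q])
  then have d2: "((\<lambda>t. torque b (Q t)) has_vector_derivative - torque b (Q t ** hat (w t))) (at t within S)"
    by (simp add: linear_neg[OF linear_torque])
  note d3 = has_vector_derivative_inner[OF w w]
  note d4 = has_vector_derivative_inner[OF w d2]
  have eq: "energy \<epsilon> (Q t) (w t) = (\<Sum>a\<in>A. k a * (b a \<bullet> b a)) - \<phi> (Q t) + (1/2) * (w t \<bullet> w t)
      - \<epsilon> * (w t \<bullet> torque b (Q t))" for t
    by (simp add: energy_def potential_def \<phi>_def sum_subtractf Rings.right_diff_distrib)
  show ?thesis
    unfolding has_real_derivative_iff_has_vector_derivative eq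
    by (rule derivative_eq_intros d1 d3 d4 refl)+ (simp add: inner_commute algebra_simps)
qed

end


lemma mult_le_sum_squares:
  fixes x y c :: real
  shows "c * x * y \<le> y\<^sup>2 / 4 + c\<^sup>2 * x\<^sup>2"
proof -
  have "0 \<le> (y / 2 - c * x)\<^sup>2" by simp
  then show ?thesis by (simp add: power2_diff power_mult_distrib power_divide mult_ac)
qed

context weighted_directions
begin

definition energy_rate :: "real \<Rightarrow> real^3^3 \<Rightarrow> real^3 \<Rightarrow> real^3 \<Rightarrow> real" where
  "energy_rate \<epsilon> Q w v = - (torque b Q \<bullet> w) + w \<bullet> v
     - \<epsilon> * (v \<bullet> torque b Q - w \<bullet> torque b (Q ** hat w))"

definition accel :: "real \<Rightarrow> real^3 \<Rightarrow> ('a \<Rightarrow> real^3) \<Rightarrow> real^3^3 \<Rightarrow> real^3 \<Rightarrow> real^3" where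
  "accel \<kappa> \<Omega> g Q w = \<Omega> \<times> w - \<kappa> *\<^sub>R w + torque g Q"

text \<open>The terms \<open>torque b Q \<bullet> w\<close> cancel and the gyroscopic term drops out against \<open>w\<close>. What is left of the
  cross term are products that are absorbed into \<open>\<kappa> |w|\<^sup>2\<close> and \<open>\<epsilon> |torque b Q|\<^sup>2\<close> when \<open>\<epsilon>\<close> is small. The
  disturbance enters only through its effect on the torque.\<close>

lemma energy_rate_le:
  assumes Q: "rotation_matrix Q" and C: "0 \<le> C" "\<And>X. norm (torque b X) \<le> C * norm X"
    and \<kappa>: "0 < \<kappa>" and \<Omega>: "norm \<Omega> \<le> B"
    and \<epsilon>: "0 < \<epsilon>" "\<epsilon> * ((B + \<kappa>)\<^sup>2 + 2 * C) \<le> \<kappa> / 4"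
  shows "energy_rate \<epsilon> Q w (accel \<kappa> \<Omega> g Q w) \<le>
    - (\<kappa> / 2) * (norm w)\<^sup>2 - (\<epsilon> / 2) * (norm (torque b Q))\<^sup>2
      + (1 / \<kappa> + \<epsilon>) * (norm (torque g Q - torque b Q))\<^sup>2"
proof -
  define f where "f = torque b Q"
  define p where "p = torque g Q - torque b Q"
  define x where "x = norm w"
  define y where "y = norm f"
  define P where "P = norm p"
  have gq: "torque g Q = f + p" by (simp add: f_def p_def)
  have x0: "0 \<le> x" and y0: "0 \<le> y" and P0: "0 \<le> P" by (simp_all add: x_def y_def P_def)
  have e1: "energy_rate \<epsilon> Q w (accel \<kappa> \<Omega> g Q w)
      = - \<kappa> * x\<^sup>2 + w \<bullet> p - \<epsilon> * ((\<Omega> \<times> w) \<bullet> f - \<kappa> * (w \<bullet> f) + y\<^sup>2 + p \<bullet> f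
           - w \<bullet> torque b (Q ** hat w))"
    unfolding energy_rate_def accel_def gq f_def[symmetric] x_def y_def power2_norm_eq_inner
    by (simp add: inner_add_left inner_add_right inner_diff_left inner_diff_right dot_cross_self
        inner_commute[of f w] algebra_simps)
  have w1: "w \<bullet> p \<le> x * P" unfolding x_def P_def by (rule norm_cauchy_schwarz)
  have w2: "- ((\<Omega> \<times> w) \<bullet> f) \<le> B * x * y"
  proof -
    have "- ((\<Omega> \<times> w) \<bullet> f) \<le> norm (\<Omega> \<times> w) * norm f"
      using Cauchy_Schwarz_ineq2[of "\<Omega> \<times> w" f] by linarith
    also have "\<dots> \<le> (norm \<Omega> * norm w) * norm f" by (intro mult_right_mono norm_cross_le) simp
    also have "\<dots> \<le> (B * norm w) * norm f" by (intro mult_right_mono \<Omega>) simp_all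
    finally show ?thesis by (simp add: x_def y_def)
  qed
  have w3: "\<kappa> * (w \<bullet> f) \<le> \<kappa> * x * y"
    using mult_left_mono[OF norm_cauchy_schwarz[of w f] less_imp_le[OF \<kappa>]]
    by (simp add: x_def y_def mult.assoc)
  have w4: "- (p \<bullet> f) \<le> P * y"
    using Cauchy_Schwarz_ineq2[of p f] by (simp add: P_def y_def abs_le_iff)
  have w5: "w \<bullet> torque b (Q ** hat w) \<le> 2 * C * x\<^sup>2"
  proof -
    have "norm (torque b (Q ** hat w)) \<le> C * (2 * x)"
      by (rule order_trans[OF C(2)])
        (simp add: norm_mult_rotation_left[OF Q] x_def mult_left_mono[OF norm_hat_le C(1)])
    then have "norm w * norm (torque b (Q ** hat w)) \<le> x * (C * (2 * x))"
      unfolding x_def by (rule mult_left_mono) simp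
    then show ?thesis using norm_cauchy_schwarz[of w "torque b (Q ** hat w)"]
      by (simp add: power2_eq_square mult_ac)
  qed
  have "x * P \<le> \<kappa> / 4 * x\<^sup>2 + P\<^sup>2 / \<kappa>"
  proof -
    have "\<kappa> / 4 * x\<^sup>2 + P\<^sup>2 / \<kappa> - x * P = (\<kappa> * x / 2 - P)\<^sup>2 / \<kappa>"
      using \<kappa> by (simp add: field_simps power2_eq_square)
    moreover have "0 \<le> (\<kappa> * x / 2 - P)\<^sup>2 / \<kappa>" using \<kappa> by simp
    ultimately show ?thesis by linarith
  qed
  moreover have "(B + \<kappa>) * x * y \<le> y\<^sup>2 / 4 + (B + \<kappa>)\<^sup>2 * x\<^sup>2" by (rule mult_le_sum_squares)
  moreover have "P * y \<le> y\<^sup>2 / 4 + P\<^sup>2" using mult_le_sum_squares[of 1 P y] by simp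
  ultimately have "- ((\<Omega> \<times> w) \<bullet> f - \<kappa> * (w \<bullet> f) + y\<^sup>2 + p \<bullet> f - w \<bullet> torque b (Q ** hat w))
      \<le> - (y\<^sup>2 / 2) + P\<^sup>2 + ((B + \<kappa>)\<^sup>2 + 2 * C) * x\<^sup>2" and xP: "x * P \<le> \<kappa> / 4 * x\<^sup>2 + P\<^sup>2 / \<kappa>"
    using w2 w3 w4 w5 by (simp_all add: algebra_simps)
  from mult_left_mono[OF this(1) less_imp_le[OF \<epsilon>(1)]]
  have "- (\<epsilon> * ((\<Omega> \<times> w) \<bullet> f - \<kappa> * (w \<bullet> f) + y\<^sup>2 + p \<bullet> f - w \<bullet> torque b (Q ** hat w)))
      \<le> \<epsilon> * (- (y\<^sup>2 / 2) + P\<^sup>2) + (\<epsilon> * ((B + \<kappa>)\<^sup>2 + 2 * C)) * x\<^sup>2"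
    by (simp add: algebra_simps)
  also have "\<dots> \<le> \<epsilon> * (- (y\<^sup>2 / 2) + P\<^sup>2) + (\<kappa> / 4) * x\<^sup>2"
    by (intro add_left_mono mult_right_mono \<epsilon>) simp
  finally have "energy_rate \<epsilon> Q w (accel \<kappa> \<Omega> g Q w)
      \<le> - \<kappa> * x\<^sup>2 + (\<kappa> / 4 * x\<^sup>2 + P\<^sup>2 / \<kappa>) + (\<epsilon> * (- (y\<^sup>2 / 2) + P\<^sup>2) + (\<kappa> / 4) * x\<^sup>2)"
    unfolding e1 using w1 xP by linarith
  then show ?thesis
    unfolding p_def[symmetric] P_def[symmetric] unfolding f_def[symmetric] x_def[symmetric] y_def[symmetric]
    by (simp add: algebra_simps)
qed

text \<open>The function \<open>energy \<epsilon>\<close> is equivalent to the squared error and decreases strictly as long as the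
  disturbance \<open>\<eta>\<close> of the directions is small compared with the torque or the velocity.\<close>

definition lyapunov_constants ::
    "real \<Rightarrow> real \<Rightarrow> real \<Rightarrow> real \<Rightarrow> real \<Rightarrow> real \<Rightarrow> real \<Rightarrow> bool" where
  "lyapunov_constants \<kappa> B \<epsilon> c1 c2 c3 c4 \<longleftrightarrow> 0 < c1 \<and> 0 < c2 \<and> 0 < c3 \<and> 0 < c4 \<and>
    (\<forall>Q w. rotation_matrix Q \<longrightarrow>
       c1 * ((norm (Q - mat 1))\<^sup>2 + (norm w)\<^sup>2) \<le> energy \<epsilon> Q w \<and>
       energy \<epsilon> Q w \<le> c2 * ((norm (Q - mat 1))\<^sup>2 + (norm w)\<^sup>2)) \<and>
    (\<forall>Q w \<Omega> g \<eta>. rotation_matrix Q \<longrightarrow> norm \<Omega> \<le> B \<longrightarrow> 0 \<le> \<eta> \<longrightarrow> (\<forall>a\<in>A. norm (g a - b a) \<le> \<eta>) \<longrightarrow>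
       energy_rate \<epsilon> Q w (accel \<kappa> \<Omega> g Q w) \<le> - c3 * ((norm (torque b Q))\<^sup>2 + (norm w)\<^sup>2) + c4 * \<eta>\<^sup>2)"

lemma lyapunov_constantsD:
  assumes "lyapunov_constants \<kappa> B \<epsilon> c1 c2 c3 c4"
  shows "0 < c1" "0 < c2" "0 < c3" "0 < c4"
    and "rotation_matrix Q \<Longrightarrow> c1 * ((norm (Q - mat 1))\<^sup>2 + (norm w)\<^sup>2) \<le> energy \<epsilon> Q w"
    and "rotation_matrix Q \<Longrightarrow> energy \<epsilon> Q w \<le> c2 * ((norm (Q - mat 1))\<^sup>2 + (norm w)\<^sup>2)"
    and "rotation_matrix Q \<Longrightarrow> norm \<Omega> \<le> B \<Longrightarrow> 0 \<le> \<eta> \<Longrightarrow> \<forall>a\<in>A. norm (g a - b a) \<le> \<eta> \<Longrightarrow>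
       energy_rate \<epsilon> Q w (accel \<kappa> \<Omega> g Q w) \<le> - c3 * ((norm (torque b Q))\<^sup>2 + (norm w)\<^sup>2) + c4 * \<eta>\<^sup>2"
  using assms unfolding lyapunov_constants_def by blast+

lemma strict_lyapunov_function:
  assumes \<kappa>: "0 < \<kappa>" and B: "0 \<le> B"
  shows "\<exists>\<epsilon> c1 c2 c3 c4. lyapunov_constants \<kappa> B \<epsilon> c1 c2 c3 c4"
proof -
  obtain cl cu where c: "0 < cl" "0 < cu" and pot: "\<And>Q. rotation_matrix Q \<Longrightarrow>
     cl * (norm (Q - mat 1))\<^sup>2 \<le> potential Q \<and> potential Q \<le> cu * (norm (Q - mat 1))\<^sup>2"
    using potential_bounds by blast
  obtain C1 where C1: "0 < C1" "\<And>X. norm (torque b X) \<le> norm X * C1"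
    using bounded_linear.pos_bounded[OF bounded_linear_torque[of b]] by blast
  obtain C where C: "0 < C" "\<And>Q. norm (torque b Q) \<le> C * norm (Q - mat 1)"
    using norm_torque_le_attitude_error by blast
  define M where "M = (B + \<kappa>)\<^sup>2 + 2 * C1 + 1"
  have M: "0 < M" "(B + \<kappa>)\<^sup>2 + 2 * C1 \<le> M" using C1 by (auto simp: M_def intro: add_nonneg_pos)
  (* The second bound is the hypothesis of the rate estimate, the third one keeps the attitude
     part of the cross term below half of the potential. *)
  define \<epsilon> where "\<epsilon> = min 1 (min (\<kappa> / (4 * M)) (cl / (2 * C\<^sup>2)))"
  have \<epsilon>: "0 < \<epsilon>" "\<epsilon> \<le> 1" using \<kappa> M c C by (auto simp: \<epsilon>_def)
  have eM: "\<epsilon> * M \<le> \<kappa> / 4"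
  proof -
    have "\<epsilon> \<le> \<kappa> / (4 * M)" by (simp add: \<epsilon>_def)
    then show ?thesis using M by (simp add: field_simps)
  qed
  have eM2: "\<epsilon> * ((B + \<kappa>)\<^sup>2 + 2 * C1) \<le> \<kappa> / 4"
    using mult_left_mono[OF M(2) less_imp_le[OF \<epsilon>(1)]] eM by linarith
  have eC: "\<epsilon>\<^sup>2 * C\<^sup>2 \<le> cl / 2"
  proof -
    have "\<epsilon> \<le> cl / (2 * C\<^sup>2)" by (simp add: \<epsilon>_def)
    then have "\<epsilon> * C\<^sup>2 \<le> cl / 2" using C by (simp add: field_simps)
    moreover have "\<epsilon>\<^sup>2 * C\<^sup>2 \<le> \<epsilon> * C\<^sup>2"
      using \<epsilon> by (intro mult_right_mono) (simp_all add: power2_eq_square mult_left_le)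
    ultimately show ?thesis by linarith
  qed
  define c1 where "c1 = min (cl / 2) (1 / 4)"
  define c2 where "c2 = cu + C\<^sup>2 + 1"
  define c3 where "c3 = min (\<kappa> / 2) (\<epsilon> / 2)"
  define c4 where "c4 = (1 / \<kappa> + \<epsilon>) * (2 * torque_bound)\<^sup>2 + 1"
  have pos: "0 < c1" "0 < c2" "0 < c3" "0 < c4"
    using c \<epsilon> \<kappa> by (auto simp: c1_def c2_def c3_def c4_def intro!: add_nonneg_pos)
  have 1: "c1 * ((norm (Q - mat 1))\<^sup>2 + (norm w)\<^sup>2) \<le> energy \<epsilon> Q w \<and>
       energy \<epsilon> Q w \<le> c2 * ((norm (Q - mat 1))\<^sup>2 + (norm w)\<^sup>2)" if Q: "rotation_matrix Q" for Q w
  proof -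
    define d where "d = norm (Q - mat 1)"
    define x where "x = norm w"
    have d0: "0 \<le> d" and x0: "0 \<le> x" by (simp_all add: d_def x_def)
    have "\<bar>w \<bullet> torque b Q\<bar> \<le> x * (C * d)"
      using Cauchy_Schwarz_ineq2[of w "torque b Q"] mult_left_mono[OF C(2)[of Q] norm_ge_zero[of w]]
      unfolding x_def d_def by linarith
    from mult_left_mono[OF this less_imp_le[OF \<epsilon>(1)]]
    have "\<bar>\<epsilon> * (w \<bullet> torque b Q)\<bar> \<le> (\<epsilon> * C) * d * x"
      using \<epsilon>(1) by (simp add: abs_mult mult_ac)
    also have "\<dots> \<le> x\<^sup>2 / 4 + (\<epsilon> * C)\<^sup>2 * d\<^sup>2" by (rule mult_le_sum_squares)
    finally have cross: "\<bar>\<epsilon> * (w \<bullet> torque b Q)\<bar> \<le> x\<^sup>2 / 4 + (\<epsilon> * C)\<^sup>2 * d\<^sup>2" .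
    have ww: "w \<bullet> w = x\<^sup>2" by (simp add: x_def power2_norm_eq_inner)
    have p: "cl * d\<^sup>2 \<le> potential Q" "potential Q \<le> cu * d\<^sup>2" using pot[OF Q] by (auto simp: d_def)
    have q: "(\<epsilon> * C)\<^sup>2 * d\<^sup>2 \<le> (cl / 2) * d\<^sup>2"
      using eC by (intro mult_right_mono) (simp_all add: power_mult_distrib)
    have q2: "(\<epsilon> * C)\<^sup>2 * d\<^sup>2 \<le> C\<^sup>2 * d\<^sup>2"
    proof (intro mult_right_mono)
      have "\<epsilon>\<^sup>2 * C\<^sup>2 \<le> 1 * C\<^sup>2" using \<epsilon> by (intro mult_right_mono) (auto simp: power_le_one)
      then show "(\<epsilon> * C)\<^sup>2 \<le> C\<^sup>2" by (simp add: power_mult_distrib)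
    qed simp
    have r1: "c1 * d\<^sup>2 \<le> (cl / 2) * d\<^sup>2" "c1 * x\<^sup>2 \<le> (1/4) * x\<^sup>2"
      by (intro mult_right_mono; simp add: c1_def)+
    have r2: "x\<^sup>2 \<le> c2 * x\<^sup>2" "cu * d\<^sup>2 + C\<^sup>2 * d\<^sup>2 \<le> c2 * d\<^sup>2"
      using mult_right_mono[of 1 c2 "x\<^sup>2"] c by (auto simp: c2_def algebra_simps)
    have "c1 * (d\<^sup>2 + x\<^sup>2) \<le> energy \<epsilon> Q w"
      unfolding energy_def ww using cross p q r1 by (simp add: distrib_left abs_le_iff)
    moreover have "energy \<epsilon> Q w \<le> c2 * (d\<^sup>2 + x\<^sup>2)"
      unfolding energy_def ww distrib_left
      using cross[unfolded abs_le_iff] p q2 r2 zero_le_power2[of x] by linarith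
    ultimately show ?thesis by (simp add: d_def x_def)
  qed
  have 2: "energy_rate \<epsilon> Q w (accel \<kappa> \<Omega> g Q w) \<le> - c3 * ((norm (torque b Q))\<^sup>2 + (norm w)\<^sup>2) + c4 * \<eta>\<^sup>2"
    if Q: "rotation_matrix Q" and \<Omega>: "norm \<Omega> \<le> B" and \<eta>: "0 \<le> \<eta>" and g: "\<forall>a\<in>A. norm (g a - b a) \<le> \<eta>"
    for Q w \<Omega> g \<eta>
  proof -
    have "norm (torque g Q - torque b Q) \<le> \<eta> * torque_bound * norm Q"
      unfolding torque_diff_directions[symmetric] by (rule norm_torque_le) (use g in auto)
    also have "\<dots> \<le> \<eta> * torque_bound * 2"
      using \<eta> torque_bound_nonneg norm_rotation_le[OF Q] by (intro mult_left_mono) auto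
    finally have "(norm (torque g Q - torque b Q))\<^sup>2 \<le> (\<eta> * torque_bound * 2)\<^sup>2"
      by (rule power_mono) simp
    then have "(1 / \<kappa> + \<epsilon>) * (norm (torque g Q - torque b Q))\<^sup>2 \<le> (1 / \<kappa> + \<epsilon>) * (\<eta> * torque_bound * 2)\<^sup>2"
      using \<kappa> \<epsilon> by (intro mult_left_mono) auto
    also have "\<dots> \<le> c4 * \<eta>\<^sup>2"
      by (simp add: c4_def power_mult_distrib algebra_simps)
    finally have p: "(1 / \<kappa> + \<epsilon>) * (norm (torque g Q - torque b Q))\<^sup>2 \<le> c4 * \<eta>\<^sup>2" .
    have "c3 * (norm w)\<^sup>2 \<le> \<kappa> / 2 * (norm w)\<^sup>2"
      "c3 * (norm (torque b Q))\<^sup>2 \<le> \<epsilon> / 2 * (norm (torque b Q))\<^sup>2"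
      by (intro mult_right_mono; simp add: c3_def)+
    moreover have "energy_rate \<epsilon> Q w (accel \<kappa> \<Omega> g Q w) \<le>
      - (\<kappa> / 2) * (norm w)\<^sup>2 - (\<epsilon> / 2) * (norm (torque b Q))\<^sup>2
      + (1 / \<kappa> + \<epsilon>) * (norm (torque g Q - torque b Q))\<^sup>2"
      by (rule energy_rate_le[OF Q _ _ \<kappa> \<Omega> \<epsilon>(1) eM2])
        (use C1 in \<open>auto simp: mult.commute\<close>)
    ultimately show ?thesis using p by (simp add: distrib_left)
  qed
  have "lyapunov_constants \<kappa> B \<epsilon> c1 c2 c3 c4"
    unfolding lyapunov_constants_def by (intro conjI pos) (use 1 2 in simp_all)
  then show ?thesis by blast
qed

end


section \<open>Convergence of one follower\<close>

text \<open>A convenient form of square integrability of the error from some time on: the integral is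
  bounded by the decrease of a nonnegative function. Such functions can be added to Lyapunov
  functions without integrating.\<close>

definition settles :: "(real \<Rightarrow> real^3^3) \<Rightarrow> (real \<Rightarrow> real^3) \<Rightarrow> bool" where
  "settles Q w \<longleftrightarrow> (\<exists>T \<Phi> \<Phi>'. \<forall>t\<ge>T. (\<Phi> has_real_derivative \<Phi>' t) (at t within {T..}) \<and>
     0 \<le> \<Phi> t \<and> \<Phi>' t \<le> - ((norm (Q t - mat 1))\<^sup>2 + (norm (w t))\<^sup>2))"

context weighted_directions
begin

definition solution ::
    "real \<Rightarrow> (real \<Rightarrow> real^3) \<Rightarrow> (real \<Rightarrow> 'a \<Rightarrow> real^3) \<Rightarrow> real \<Rightarrow> (real \<Rightarrow> real^3^3) \<Rightarrow> (real \<Rightarrow> real^3) \<Rightarrow> bool"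
  where "solution \<kappa> \<Omega> g t0 Q w \<longleftrightarrow> (\<forall>t\<ge>t0. rotation_matrix (Q t) \<and>
     (Q has_vector_derivative - (Q t ** hat (w t))) (at t within {t0..}) \<and>
     (w has_vector_derivative accel \<kappa> (\<Omega> t) (g t) (Q t) (w t)) (at t within {t0..}))"

lemma solutionD:
  assumes "solution \<kappa> \<Omega> g t0 Q w" "t0 \<le> t"
  shows "rotation_matrix (Q t)"
    "(Q has_vector_derivative - (Q t ** hat (w t))) (at t within {t0..})"
    "(w has_vector_derivative accel \<kappa> (\<Omega> t) (g t) (Q t) (w t)) (at t within {t0..})"
  using assms by (auto simp: solution_def)

lemma solution_later:
  assumes "solution \<kappa> \<Omega> g t0 Q w" "t0 \<le> T"
  shows "solution \<kappa> \<Omega> g T Q w"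
proof -
  have sub: "{T..} \<subseteq> {t0..}" using assms(2) by auto
  show ?thesis
    unfolding solution_def
  proof (intro allI impI conjI)
    fix t assume "T \<le> t"
    then have t: "t0 \<le> t" using assms(2) by simp
    note D = solutionD[OF assms(1) t]
    show "rotation_matrix (Q t)" by (rule D)
    show "(Q has_vector_derivative - (Q t ** hat (w t))) (at t within {T..})"
      by (rule has_vector_derivative_within_subset[OF D(2) sub])
    show "(w has_vector_derivative accel \<kappa> (\<Omega> t) (g t) (Q t) (w t)) (at t within {T..})"
      by (rule has_vector_derivative_within_subset[OF D(3) sub])
  qed
qed

lemma accel_inner_self: "accel \<kappa> \<Omega> g Q w \<bullet> w = - \<kappa> * (w \<bullet> w) + torque g Q \<bullet> w"
  by (simp add: accel_def inner_add_left inner_diff_left dot_cross_self)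

lemma norm_torque_rotation_le:
  assumes "rotation_matrix Q" "0 \<le> G" "\<And>a. a \<in> A \<Longrightarrow> norm (g a) \<le> G"
  shows "norm (torque g Q) \<le> 2 * G * torque_bound"
proof -
  have "norm (torque g Q) \<le> G * torque_bound * norm Q" by (rule norm_torque_le) (rule assms)
  also have "\<dots> \<le> G * torque_bound * 2"
    using norm_rotation_le[OF assms(1)] assms(2) torque_bound_nonneg
    by (intro mult_left_mono) auto
  finally show ?thesis by simp
qed

text \<open>The torque is bounded on rotations, so the damping wins where \<open>w\<close> is large.\<close>

lemma velocity_bounded:
  assumes sol: "solution \<kappa> \<Omega> g t0 Q w" and \<kappa>: "0 < \<kappa>" and G: "0 \<le> G"
    and g: "\<And>t a. t0 \<le> t \<Longrightarrow> a \<in> A \<Longrightarrow> norm (g t a) \<le> G" and t: "t0 \<le> t"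
  shows "(norm (w t))\<^sup>2 \<le> (norm (w t0))\<^sup>2 + (2 * G * torque_bound / \<kappa>)\<^sup>2 + 1"
proof -
  define m where "m = 2 * G * torque_bound"
  have m0: "0 \<le> m" using G torque_bound_nonneg by (simp add: m_def)
  (* Above m / \<kappa> the damping exceeds the torque; the 1 makes the initial inequality strict. *)
  define l where "l = (norm (w t0))\<^sup>2 + (m / \<kappa>)\<^sup>2 + 1"
  have "w t \<bullet> w t < l"
  proof (rule barrier[where L = "\<lambda>t. w t \<bullet> w t" and a = t0
        and L' = "\<lambda>t. 2 * (accel \<kappa> (\<Omega> t) (g t) (Q t) (w t) \<bullet> w t)"])
    fix t assume t: "t0 \<le> t"
    note d = solutionD(3)[OF sol t]
    show "((\<lambda>t. w t \<bullet> w t) has_real_derivative 2 * (accel \<kappa> (\<Omega> t) (g t) (Q t) (w t) \<bullet> w t))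
        (at t within {t0..})"
      unfolding has_real_derivative_iff_has_vector_derivative
      by (rule has_vector_derivative_eq_rhs[OF
            has_vector_derivative_inner[OF d d]])
        (simp add: inner_commute)
    assume wl: "w t \<bullet> w t = l"
    have "(m / \<kappa>)\<^sup>2 < (norm (w t))\<^sup>2"
      using wl by (simp add: power2_norm_eq_inner l_def add_pos_nonneg add_nonneg_pos)
    then have "m / \<kappa> < norm (w t)"
      by (rule power_less_imp_less_base) simp
    then have mw: "m < \<kappa> * norm (w t)" using \<kappa> by (simp add: field_simps)
    have w0: "0 < norm (w t)" using mw m0 \<kappa> by (metis le_less_trans zero_less_mult_pos)
    have "torque (g t) (Q t) \<bullet> w t \<le> norm (torque (g t) (Q t)) * norm (w t)"
      by (rule norm_cauchy_schwarz)
    also have "\<dots> \<le> m * norm (w t)"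
      unfolding m_def by (intro mult_right_mono norm_torque_rotation_le solutionD(1)[OF sol t] G g t) auto
    also have "\<dots> < \<kappa> * norm (w t) * norm (w t)"
      using mw w0 by (rule mult_strict_right_mono)
    also have "\<dots> = \<kappa> * (w t \<bullet> w t)" by (simp add: dot_square_norm power2_eq_square)
    finally show "2 * (accel \<kappa> (\<Omega> t) (g t) (Q t) (w t) \<bullet> w t) < 0"
      by (simp add: accel_inner_self)
  next
    show "w t0 \<bullet> w t0 < l"
      by (simp add: l_def power2_norm_eq_inner add_nonneg_pos)
  qed (rule t)
  then show ?thesis by (simp add: l_def m_def power2_norm_eq_inner)
qed

text \<open>The torque is bounded away from \<open>0\<close> outside neighborhoods of the finitely many equilibria. So the
  path is eventually in a union of small disjoint balls, and being connected it stays in one of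
  them.\<close>

lemma converges_to_equilibrium:
  fixes Q :: "real \<Rightarrow> real^3^3"
  assumes cont: "continuous_on {t0..} Q" and rot: "\<And>t. t0 \<le> t \<Longrightarrow> rotation_matrix (Q t)"
    and lim: "((\<lambda>t. torque b (Q t)) \<longlongrightarrow> 0) at_top"
  shows "\<exists>P. equilibrium P \<and> (Q \<longlongrightarrow> P) at_top"
proof -
  define E where "E = {P. equilibrium P}"
  have finE: "finite E" unfolding E_def by (rule finite_equilibria)
  have near: "\<exists>T\<ge>t0. \<forall>t\<ge>T. \<exists>P\<in>E. dist P (Q t) < e" if e: "0 < e" for e
  proof -
    define K where "K = {Q :: real^3^3. rotation_matrix Q} - (\<Union>P\<in>E. ball P e)"
    have "bounded {Q :: real^3^3. rotation_matrix Q}"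
      unfolding bounded_iff using norm_rotation_le by blast
    then have "compact {Q :: real^3^3. rotation_matrix Q}"
      using closed_rotations by (simp add: compact_eq_bounded_closed)
    then have K: "compact K" unfolding K_def by (intro compact_diff open_UN ballI open_ball)
    have nz: "torque b X \<noteq> 0" if "X \<in> K" for X
      using that e by (force simp: K_def E_def equilibrium_def)
    have "\<exists>c>0. \<forall>X\<in>K. c \<le> norm (torque b X)"
    proof (cases "K = {}")
      case False
      have "continuous_on K (\<lambda>X. norm (torque b X))"
        by (intro continuous_intros bounded_linear.continuous_on[OF bounded_linear_torque])
      from continuous_attains_inf[OF K False this]
      obtain X where X: "X \<in> K" "\<forall>Y\<in>K. norm (torque b X) \<le> norm (torque b Y)" by blast
      then show ?thesis using nz[OF X(1)] by (intro exI[of _ "norm (torque b X)"]) simp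
    qed (auto intro: exI[of _ 1])
    then obtain c where c: "0 < c" "\<And>X. X \<in> K \<Longrightarrow> c \<le> norm (torque b X)" by blast
    obtain T where T: "\<And>t. T \<le> t \<Longrightarrow> norm (torque b (Q t)) < c"
      using tendstoD[OF lim c(1)] unfolding eventually_at_top_linorder by auto
    have "\<exists>P\<in>E. dist P (Q t) < e" if t: "max T t0 \<le> t" for t
    proof -
      have "Q t \<notin> K" using T[of t] c(2)[of "Q t"] t by force
      then show ?thesis using rot[of t] t by (auto simp: K_def)
    qed
    then show ?thesis by (intro exI[of _ "max T t0"]) auto
  qed
  define D where "D = {dist P P' | P P'. P \<in> E \<and> P' \<in> E \<and> P \<noteq> P'}"
  have finD: "finite D"
  proof (rule finite_subset)
    show "D \<subseteq> (\<lambda>(P, P'). dist P P') ` Sigma E (\<lambda>_. E)" by (auto simp: D_def)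
  qed (use finE in auto)
  (* At most half the least distance between equilibria; the 1 makes the minimum exist. *)
  define e0 where "e0 = Min (insert 1 D) / 2"
  have e0: "0 < e0" using finD by (auto simp: e0_def D_def Min_gr_iff)
  (* Balls of radius e0 around distinct equilibria are disjoint. *)
  have sep: "P = P'" if "P \<in> E" "P' \<in> E" "dist P X < e0" "dist P' X < e0" for P P' X
  proof (rule ccontr)
    assume "P \<noteq> P'"
    then have "dist P P' \<in> D" using that by (auto simp: D_def)
    then have "2 * e0 \<le> dist P P'" using finD by (simp add: e0_def)
    moreover have "dist P P' \<le> dist P X + dist P' X" by (rule dist_triangle2)
    ultimately show False using that by simp
  qed
  obtain T0 where T0: "t0 \<le> T0" "\<forall>t\<ge>T0. \<exists>P\<in>E. dist P (Q t) < e0" using near[OF e0] by blast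
  obtain P where P: "P \<in> E" "dist P (Q T0) < e0" using T0 by blast
  have stay: "dist P (Q t) < e0" if t: "T0 \<le> t" for t
  proof (rule ccontr)
    assume far: "\<not> dist P (Q t) < e0"
    define U where "U = ball P e0"
    define V where "V = (\<Union>P'\<in>E - {P}. ball P' e0)"
    have "continuous_on {T0..t} Q" using cont by (rule continuous_on_subset) (use T0 in auto)
    then have "connected (Q ` {T0..t})" by (rule connected_continuous_image) simp
    moreover have "open U" "open V" by (auto simp: U_def V_def)
    moreover have "U \<inter> V \<inter> Q ` {T0..t} = {}"
      by (auto simp: U_def V_def) (metis sep P(1))
    moreover have "Q ` {T0..t} \<subseteq> U \<union> V"
    proof
      fix X assume "X \<in> Q ` {T0..t}"
      then obtain P' where "P' \<in> E" "dist P' X < e0" using T0(2) by force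
      then show "X \<in> U \<union> V" by (cases "P' = P") (auto simp: U_def V_def)
    qed
    ultimately have "U \<inter> Q ` {T0..t} = {} \<or> V \<inter> Q ` {T0..t} = {}"
      by (rule connectedD)
    moreover have "Q T0 \<in> U \<inter> Q ` {T0..t}" using P t by (simp add: U_def)
    moreover have "Q t \<in> V \<inter> Q ` {T0..t}"
    proof -
      obtain P' where "P' \<in> E" "dist P' (Q t) < e0" using T0(2) t by blast
      then show ?thesis using far t by (auto simp: V_def)
    qed
    ultimately show False by blast
  qed
  have "(Q \<longlongrightarrow> P) at_top"
  proof (rule tendstoI)
    fix e :: real assume e: "0 < e"
    obtain T where T: "\<forall>t\<ge>T. \<exists>P\<in>E. dist P (Q t) < min e e0"
      using near[of "min e e0"] e e0 by auto
    have "dist (Q t) P < e" if t: "max T T0 \<le> t" for t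
    proof -
      obtain P' where P': "P' \<in> E" "dist P' (Q t) < min e e0" using T t by (meson max.boundedE)
      moreover have "P' = P" by (rule sep[OF P'(1) P(1), of "Q t"]) (use P' stay[of t] t in auto)
      ultimately show ?thesis by (simp add: dist_commute)
    qed
    then show "\<forall>\<^sub>F t in at_top. dist (Q t) P < e" unfolding eventually_at_top_linorder by blast
  qed
  then show ?thesis using P(1) by (auto simp: E_def)
qed

text \<open>Here \<open>- \<Psi>'\<close> bounds the squared disturbance. The energy plus a multiple of \<open>\<Psi>\<close> decreases at least at
  a rate proportional to the squared torque and velocity, so these tend to \<open>0\<close>. Near the identity
  the torque controls the attitude error, and then the same function shows that the error settles.\<close>

lemma solution_reaches_equilibrium:
  assumes sol: "solution \<kappa> \<Omega> g t0 Q w" and \<kappa>: "0 < \<kappa>"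
    and \<Omega>: "\<And>t. t0 \<le> t \<Longrightarrow> norm (\<Omega> t) \<le> B"
    and g: "\<And>t a. t0 \<le> t \<Longrightarrow> a \<in> A \<Longrightarrow> norm (g t a) \<le> G"
    and T: "t0 \<le> T" and \<Psi>: "\<And>t. T \<le> t \<Longrightarrow> (\<Psi> has_real_derivative \<Psi>' t) (at t within {T..})"
    and \<Psi>0: "\<And>t. T \<le> t \<Longrightarrow> 0 \<le> \<Psi> t"
    and dist: "\<And>t. T \<le> t \<Longrightarrow> \<exists>\<eta>\<ge>0. (\<forall>a\<in>A. norm (g t a - b a) \<le> \<eta>) \<and> \<eta>\<^sup>2 \<le> - \<Psi>' t"
  shows "\<exists>P. equilibrium P \<and> (Q \<longlongrightarrow> P) at_top \<and> (w \<longlongrightarrow> 0) at_top \<and> (P = mat 1 \<longrightarrow> settles Q w)"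
proof -
  have B0: "0 \<le> B" using \<Omega>[of t0] norm_ge_zero[of "\<Omega> t0"] by linarith
  define G1 where "G1 = max G 0"
  have G1: "0 \<le> G1" "\<And>t a. t0 \<le> t \<Longrightarrow> a \<in> A \<Longrightarrow> norm (g t a) \<le> G1"
    by (auto simp: G1_def intro: max.coboundedI1 g)
  obtain \<epsilon> c1 c2 c3 c4 where ly: "lyapunov_constants \<kappa> B \<epsilon> c1 c2 c3 c4"
    using strict_lyapunov_function[OF \<kappa> B0] by blast
  note c = lyapunov_constantsD(1,3,4)[OF ly] and E1 = lyapunov_constantsD(5)[OF ly]
  have solT: "solution \<kappa> \<Omega> g T Q w" by (rule solution_later[OF sol T])
  define m where "m t = torque b (Q t) \<bullet> torque b (Q t) + w t \<bullet> w t" for t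
  define m' where "m' t = 2 * (torque b (Q t) \<bullet> torque b (- (Q t ** hat (w t))))
      + 2 * (accel \<kappa> (\<Omega> t) (g t) (Q t) (w t) \<bullet> w t)" for t
  define L where "L t = energy \<epsilon> (Q t) (w t) + c4 * \<Psi> t" for t
  define L' where "L' t = energy_rate \<epsilon> (Q t) (w t) (accel \<kappa> (\<Omega> t) (g t) (Q t) (w t)) + c4 * \<Psi>' t" for t
  have dL: "(L has_real_derivative L' t) (at t within {T..})" if t: "T \<le> t" for t
    unfolding L_def L'_def energy_rate_def
    by (intro DERIV_add DERIV_cmult \<Psi> t energy_derivative solutionD[OF solT t])
  have L0: "0 \<le> L t" if t: "T \<le> t" for t
  proof -
    have "0 \<le> c1 * ((norm (Q t - mat 1))\<^sup>2 + (norm (w t))\<^sup>2)" using c by simp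
    then have "0 \<le> energy \<epsilon> (Q t) (w t)"
      by (rule order_trans[OF _ E1[OF solutionD(1)[OF solT t]]])
    then show ?thesis using \<Psi>0[OF t] c by (simp add: L_def)
  qed
  have diss: "L' t \<le> - (c3 * m t)" if t: "T \<le> t" for t
  proof -
    obtain \<eta> where \<eta>: "\<eta> \<ge> 0" "\<forall>a\<in>A. norm (g t a - b a) \<le> \<eta>" "\<eta>\<^sup>2 \<le> - \<Psi>' t"
      using dist[OF t] by blast
    have "energy_rate \<epsilon> (Q t) (w t) (accel \<kappa> (\<Omega> t) (g t) (Q t) (w t))
        \<le> - c3 * ((norm (torque b (Q t)))\<^sup>2 + (norm (w t))\<^sup>2) + c4 * \<eta>\<^sup>2"
      by (rule lyapunov_constantsD(7)[OF ly solutionD(1)[OF solT t] \<Omega> \<eta>(1,2)]) (use t T in simp)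
    then have "L' t \<le> - c3 * m t + c4 * \<eta>\<^sup>2 + c4 * \<Psi>' t"
      by (simp add: L'_def m_def power2_norm_eq_inner)
    also have "\<dots> \<le> - (c3 * m t)" using mult_left_mono[OF \<eta>(3), of c4] c by simp
    finally show ?thesis .
  qed
  have dm: "((\<lambda>t. c3 * m t) has_real_derivative c3 * m' t) (at t within {T..})" if t: "T \<le> t" for t
  proof -
    note w = solutionD(3)[OF solT t]
    note f = bounded_linear.has_vector_derivative[OF bounded_linear_torque[of b] solutionD(2)[OF solT t]]
    note ff = has_vector_derivative_add[OF
        has_vector_derivative_inner[OF f f]
        has_vector_derivative_inner[OF w w]]
    have "(m has_real_derivative m' t) (at t within {T..})"
      unfolding has_real_derivative_iff_has_vector_derivative m_def m'_def
      by (rule has_vector_derivative_eq_rhs[OF ff]) (simp add: inner_commute)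
    then show ?thesis by (rule DERIV_cmult)
  qed
  obtain C where C: "0 < C" "\<And>X. norm (torque b X) \<le> norm X * C"
    using bounded_linear.pos_bounded[OF bounded_linear_torque[of b]] by blast
  define W where "W = sqrt ((norm (w t0))\<^sup>2 + (2 * G1 * torque_bound / \<kappa>)\<^sup>2 + 1)"
  have W: "norm (w t) \<le> W" if "t0 \<le> t" for t
    unfolding W_def by (rule real_le_rsqrt) (rule velocity_bounded[OF sol \<kappa> G1 that])
  have W0: "0 \<le> W" using W[of t0] norm_ge_zero[of "w t0"] by linarith
  have bm: "\<bar>c3 * m' t\<bar> \<le> c3 * (2 * ((2 * C) * (2 * W * C)) + 2 * (\<kappa> * W\<^sup>2 + 2 * G1 * torque_bound * W))"
    if t: "T \<le> t" for t
  proof -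
    have t0: "t0 \<le> t" using t T by simp
    note rot = solutionD(1)[OF sol t0]
    have "\<bar>torque b (Q t) \<bullet> torque b (- (Q t ** hat (w t)))\<bar>
        \<le> norm (torque b (Q t)) * norm (torque b (- (Q t ** hat (w t))))"
      by (rule Cauchy_Schwarz_ineq2)
    also have "\<dots> \<le> (2 * C) * (2 * W * C)"
    proof (rule mult_mono)
      show "norm (torque b (Q t)) \<le> 2 * C"
        using C(2)[of "Q t"] mult_right_mono[OF norm_rotation_le[OF rot], of C] C(1) by linarith
      have "norm (- (Q t ** hat (w t))) \<le> 2 * W"
        using norm_hat_le[of "w t"] W[OF t0] by (simp add: norm_mult_rotation_left[OF rot])
      from mult_right_mono[OF this, of C] show "norm (torque b (- (Q t ** hat (w t)))) \<le> 2 * W * C"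
        using C(2)[of "- (Q t ** hat (w t))"] C(1) by linarith
    qed (use C in auto)
    finally have 1: "\<bar>torque b (Q t) \<bullet> torque b (- (Q t ** hat (w t)))\<bar> \<le> (2 * C) * (2 * W * C)" .
    have "\<bar>torque (g t) (Q t) \<bullet> w t\<bar> \<le> norm (torque (g t) (Q t)) * norm (w t)"
      by (rule Cauchy_Schwarz_ineq2)
    also have "\<dots> \<le> (2 * G1 * torque_bound) * W"
      by (intro mult_mono norm_torque_rotation_le rot G1 t0 W)
        (use G1 torque_bound_nonneg in auto)
    finally have 2: "\<bar>torque (g t) (Q t) \<bullet> w t\<bar> \<le> 2 * G1 * torque_bound * W" .
    have "\<kappa> * (w t \<bullet> w t) \<le> \<kappa> * W\<^sup>2"
      unfolding power2_norm_eq_inner[symmetric] using \<kappa> W[OF t0] by (intro mult_left_mono power_mono) auto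
    then have 3: "\<bar>\<kappa> * (w t \<bullet> w t)\<bar> \<le> \<kappa> * W\<^sup>2" using \<kappa> by (simp add: abs_mult)
    have "\<bar>m' t\<bar> \<le> 2 * ((2 * C) * (2 * W * C)) + 2 * (\<kappa> * W\<^sup>2 + 2 * G1 * torque_bound * W)"
    proof -
      have "\<bar>2 * x + 2 * (- z + y)\<bar> \<le> 2 * X + 2 * (Z + Y)"
        if "\<bar>x\<bar> \<le> X" "\<bar>y\<bar> \<le> Y" "\<bar>z\<bar> \<le> Z" for x y z X Y Z :: real
        using that by (auto simp: abs_le_iff)
      from this[OF 1 2 3] show ?thesis by (simp add: m'_def accel_inner_self)
    qed
    then show ?thesis using c by (simp add: abs_mult)
  qed
  have "((\<lambda>t. c3 * m t) \<longlongrightarrow> 0) at_top"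
    by (rule dissipation_tendsto_zero[OF dL dm diss L0 _ bm]) (use c in \<open>auto simp: m_def\<close>)
  from tendsto_mult_left[OF this, of "1 / c3"] have mlim: "(m \<longlongrightarrow> 0) at_top"
    using c by simp
  have sq: "(v \<longlongrightarrow> 0) at_top" if "\<And>t. v t \<bullet> v t \<le> m t" for v :: "real \<Rightarrow> real^3"
  proof -
    have "((\<lambda>t. v t \<bullet> v t) \<longlongrightarrow> 0) at_top"
      by (rule tendsto_sandwich[OF _ _ tendsto_const mlim]) (use that in auto)
    from tendsto_real_sqrt[OF this] show ?thesis
      by (simp add: norm_eq_sqrt_inner[symmetric] tendsto_norm_zero_iff)
  qed
  have wlim: "(w \<longlongrightarrow> 0) at_top" by (rule sq) (simp add: m_def)
  have flim: "((\<lambda>t. torque b (Q t)) \<longlongrightarrow> 0) at_top" by (rule sq) (simp add: m_def)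
  have "continuous_on {t0..} Q"
    unfolding continuous_on_eq_continuous_within
    using solutionD(2)[OF sol] by (auto intro: has_vector_derivative_continuous)
  from converges_to_equilibrium[OF this solutionD(1)[OF sol] flim]
  obtain P where P: "equilibrium P" "(Q \<longlongrightarrow> P) at_top" by blast
  have "settles Q w" if P1: "P = mat 1"
  proof -
    obtain r c where r: "0 < r" "0 < c" and exp: "\<And>Q1 Q2. rotation_matrix Q1 \<Longrightarrow> rotation_matrix Q2 \<Longrightarrow>
      norm (Q1 - mat 1) \<le> r \<Longrightarrow> norm (Q2 - mat 1) \<le> r \<Longrightarrow> c * norm (Q1 - Q2) \<le> norm (torque b (Q1 - Q2))"
      using torque_expands_near_equilibrium[OF equilibrium_one] by blast
    obtain T1 where T1: "\<And>t. T1 \<le> t \<Longrightarrow> dist (Q t) (mat 1) < r"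
      using tendstoD[OF P(2) r(1)] unfolding P1 eventually_at_top_linorder by blast
    define T2 where "T2 = max T T1"
    (* The squared error is at most (1 / c^2 + 1) * m, and m is at most - L' / c3. *)
    define k where "k = (1 / c\<^sup>2 + 1) / c3"
    have k: "0 < k" using r c by (simp add: k_def add_pos_pos)
    have "((\<lambda>t. k * L t) has_real_derivative k * L' t) (at t within {T2..}) \<and> 0 \<le> k * L t \<and>
        k * L' t \<le> - ((norm (Q t - mat 1))\<^sup>2 + (norm (w t))\<^sup>2)" if t: "T2 \<le> t" for t
    proof (intro conjI)
      have tT: "T \<le> t" "T1 \<le> t" "t0 \<le> t" using t T by (auto simp: T2_def)
      have "(L has_real_derivative L' t) (at t within {T2..})"
        by (rule has_field_derivative_subset[OF dL[OF tT(1)]]) (auto simp: T2_def)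
      then show "((\<lambda>t. k * L t) has_real_derivative k * L' t) (at t within {T2..})" by (rule DERIV_cmult)
      show "0 \<le> k * L t" using k L0[OF tT(1)] by simp
      have "c * norm (Q t - mat 1) \<le> norm (torque b (Q t))"
        using exp[OF solutionD(1)[OF sol tT(3)] rotation_one] T1[OF tT(2)] r(1)
        by (simp add: dist_norm linear_diff[OF linear_torque] torque_one)
      then have "(c * norm (Q t - mat 1))\<^sup>2 \<le> (norm (torque b (Q t)))\<^sup>2"
        using r by (intro power_mono) auto
      then have "(norm (Q t - mat 1))\<^sup>2 \<le> (1 / c\<^sup>2) * (norm (torque b (Q t)))\<^sup>2"
        using r by (simp add: power_mult_distrib field_simps)
      also have "\<dots> \<le> (1 / c\<^sup>2) * m t" by (intro mult_left_mono) (auto simp: m_def power2_norm_eq_inner)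
      finally have "(norm (Q t - mat 1))\<^sup>2 \<le> (1 / c\<^sup>2) * m t" .
      moreover have "(norm (w t))\<^sup>2 \<le> m t" by (simp add: m_def power2_norm_eq_inner)
      ultimately have "(norm (Q t - mat 1))\<^sup>2 + (norm (w t))\<^sup>2 \<le> (1 / c\<^sup>2 + 1) * m t"
        by (simp add: distrib_right)
      also have "\<dots> = k * (c3 * m t)" using c by (simp add: k_def)
      also have "\<dots> \<le> k * (- L' t)" using k diss[OF tT(1)] by (intro mult_left_mono) auto
      finally show "k * L' t \<le> - ((norm (Q t - mat 1))\<^sup>2 + (norm (w t))\<^sup>2)" by simp
    qed
    then show ?thesis unfolding settles_def
      by (intro exI[of _ T2] exI[of _ "\<lambda>t. k * L t"] exI[of _ "\<lambda>t. k * L' t"]) simp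
  qed
  with P wlim show ?thesis by blast
qed

end


section \<open>Instability of the undesired equilibria\<close>

text \<open>Two points of \<open>X\<close>, or of its closure, never differ by a nonzero multiple of \<open>z0\<close>. So translates of
  the closure by distinct multiples of \<open>z0\<close> are disjoint. Infinitely many of them, all of the same
  measure, lie in one ball.\<close>

lemma negligible_if_cone_free:
  fixes X :: "'a::euclidean_space set" and S :: "'a \<Rightarrow> real"
  assumes cont: "continuous_on UNIV S" and pos: "\<And>s. s \<noteq> 0 \<Longrightarrow> 0 < S (s *\<^sub>R z0)"
    and bounded: "bounded X" and le: "\<And>x y. x \<in> X \<Longrightarrow> y \<in> X \<Longrightarrow> S (x - y) \<le> 0"
  shows "negligible X"
proof -
  define Y where "Y = closure X"
  have compY: "compact Y" unfolding Y_def using bounded by (simp add: compact_closure)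
  have leY: "S (x - y) \<le> 0" if "x \<in> Y" "y \<in> Y" for x y
  proof -
    obtain u where u: "\<And>n. u n \<in> X" "u \<longlonglongrightarrow> x"
      using \<open>x \<in> Y\<close> unfolding Y_def closure_sequential by blast
    obtain v where v: "\<And>n. v n \<in> X" "v \<longlonglongrightarrow> y"
      using \<open>y \<in> Y\<close> unfolding Y_def closure_sequential by blast
    have "(\<lambda>n. S (u n - v n)) \<longlonglongrightarrow> S (x - y)"
      by (rule continuous_on_tendsto_compose[OF cont tendsto_diff[OF u(2) v(2)]]) auto
    then show ?thesis by (rule tendsto_upperbound) (use le u v in auto)
  qed
  (* Infinitely many translates that stay in a bounded set. *)
  define F where "F n = (\<lambda>x. (1 / real (Suc n)) *\<^sub>R z0 + x) ` Y" for n :: nat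
  have lm: "F n \<in> lmeasurable" "measure lebesgue (F n) = measure lebesgue Y" for n
    unfolding F_def using compY
    by (simp_all add: measurable_translation lmeasurable_compact measure_translation)
  have disj: "disjoint_family F"
    unfolding disjoint_family_on_def
  proof (intro ballI impI)
    fix m n :: nat assume mn: "m \<noteq> n"
    show "F m \<inter> F n = {}"
    proof (rule ccontr)
      assume "F m \<inter> F n \<noteq> {}"
      then obtain x y where xy: "x \<in> Y" "y \<in> Y"
        and eq: "(1 / real (Suc m)) *\<^sub>R z0 + x = (1 / real (Suc n)) *\<^sub>R z0 + y"
        by (auto simp: F_def)
      define s where "s = 1 / real (Suc n) - 1 / real (Suc m)"
      have "x - y = s *\<^sub>R z0"
        using eq by (simp add: s_def scaleR_diff_left algebra_simps)
      moreover have "s \<noteq> 0" using mn by (simp add: s_def del: of_nat_Suc)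
      ultimately show False using pos[of s] leY[OF xy] by simp
    qed
  qed
  obtain r where r: "\<And>x. x \<in> Y \<Longrightarrow> norm x \<le> r"
    using compact_imp_bounded[OF compY] unfolding bounded_iff by blast
  define b where "b = measure lebesgue (cball 0 (norm z0 + r) :: 'a set)"
  have sub: "F n \<subseteq> cball 0 (norm z0 + r)" for n
  proof
    fix x assume "x \<in> F n"
    then obtain y where y: "y \<in> Y" "x = (1 / real (Suc n)) *\<^sub>R z0 + y" by (auto simp: F_def)
    have "norm ((1 / real (Suc n)) *\<^sub>R z0) \<le> norm z0"
      by (simp add: divide_le_eq distrib_left)
    then have "norm x \<le> norm z0 + r"
      unfolding y(2) using r[OF y(1)] norm_triangle_le by (smt (verit) norm_triangle_ineq)
    then show "x \<in> cball 0 (norm z0 + r)" by simp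
  qed
  have "real N * measure lebesgue Y \<le> b" for N
  proof -
    have "real N * measure lebesgue Y = (\<Sum>n<N. measure lebesgue (F n))" by (simp add: lm)
    also have "\<dots> = measure lebesgue (\<Union>n<N. F n)"
    proof (rule measure_finite_Union[symmetric])
      show "F ` {..<N} \<subseteq> sets lebesgue" using fmeasurableD[OF lm(1)] by blast
      show "disjoint_family_on F {..<N}" by (rule disjoint_family_on_mono[OF subset_UNIV disj])
      show "emeasure lebesgue (F n) \<noteq> \<infinity>" for n
        unfolding infinity_ennreal_def by (rule fmeasurableD2[OF lm(1)])
    qed simp
    also have "\<dots> \<le> b"
      unfolding b_def by (rule measure_mono_fmeasurable)
        (use sub lm in \<open>auto intro!: sets.finite_UN fmeasurableD\<close>)
    finally show ?thesis .
  qed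
  then have "measure lebesgue Y \<le> 0"
    by (metis linorder_not_le mult.commute reals_Archimedean3)
  then have "measure lebesgue Y = 0" by (simp add: measure_le_0_iff)
  then have "negligible Y"
    using lmeasurable_compact[OF compY] by (simp add: negligible_iff_measure)
  then show ?thesis
    by (rule negligible_subset) (simp add: Y_def closure_subset)
qed

context weighted_directions
begin

text \<open>\<open>S\<close> is a form on torque and velocity differences that is positive in the direction \<open>z0\<close> but not on
  differences of two solutions that stay near \<open>P\<close> under the same inputs. \<open>C\<close> relates torques back to
  attitudes.\<close>

definition separating_form ::
    "real \<Rightarrow> real \<Rightarrow> real^3^3 \<Rightarrow> real \<Rightarrow> real \<Rightarrow> ((real^3) \<times> (real^3) \<Rightarrow> real) \<Rightarrow> (real^3) \<times> (real^3) \<Rightarrow> bool"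
  where "separating_form \<kappa> B P \<delta> C S z0 \<longleftrightarrow>
    continuous_on UNIV S \<and> (\<forall>s. s \<noteq> 0 \<longrightarrow> 0 < S (s *\<^sub>R z0)) \<and>
    (\<forall>\<Omega> g T Q1 w1 Q2 w2. (\<forall>t\<ge>T. norm (\<Omega> t) \<le> B) \<longrightarrow>
       solution \<kappa> \<Omega> g T Q1 w1 \<longrightarrow> solution \<kappa> \<Omega> g T Q2 w2 \<longrightarrow>
       (\<forall>t\<ge>T. \<forall>a\<in>A. norm (g t a - b a) \<le> \<delta>) \<longrightarrow>
       (\<forall>t\<ge>T. norm (Q1 t - P) \<le> \<delta> \<and> norm (w1 t) \<le> \<delta>) \<longrightarrow>
       (\<forall>t\<ge>T. norm (Q2 t - P) \<le> \<delta> \<and> norm (w2 t) \<le> \<delta>) \<longrightarrow>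
       S ((torque b (Q1 T), w1 T) - (torque b (Q2 T), w2 T)) \<le> 0 \<and>
       norm (Q1 T - Q2 T) \<le> C * norm (torque b (Q1 T) - torque b (Q2 T)))"

lemma separating_formD:
  assumes "separating_form \<kappa> B P \<delta> C S z0"
  shows "continuous_on UNIV S" and "s \<noteq> 0 \<Longrightarrow> 0 < S (s *\<^sub>R z0)"
    and "\<forall>t\<ge>T. norm (\<Omega> t) \<le> B \<Longrightarrow> solution \<kappa> \<Omega> g T Q1 w1 \<Longrightarrow> solution \<kappa> \<Omega> g T Q2 w2 \<Longrightarrow>
       \<forall>t\<ge>T. \<forall>a\<in>A. norm (g t a - b a) \<le> \<delta> \<Longrightarrow>
       \<forall>t\<ge>T. norm (Q1 t - P) \<le> \<delta> \<and> norm (w1 t) \<le> \<delta> \<Longrightarrow>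
       \<forall>t\<ge>T. norm (Q2 t - P) \<le> \<delta> \<and> norm (w2 t) \<le> \<delta> \<Longrightarrow>
       S ((torque b (Q1 T), w1 T) - (torque b (Q2 T), w2 T)) \<le> 0 \<and>
       norm (Q1 T - Q2 T) \<le> C * norm (torque b (Q1 T) - torque b (Q2 T))"
  using assms unfolding separating_form_def by simp_all

text \<open>Let \<open>y\<close> be the difference of the torques, \<open>d\<close> that of the velocities, and \<open>M\<close> the Hessian with inverse
  \<open>N\<close>. Up to small terms \<open>y' = - M d\<close> and \<open>d' = \<Omega> \<times> d - \<kappa> d + y\<close>. Along this linear system
  \<open>- (y \<bullet> N y + |d|\<^sup>2)\<close> has derivative \<open>2 \<kappa> |d|\<^sup>2\<close>, and the cross term \<open>2 \<epsilon> d \<bullet> y\<close> adds \<open>2 \<epsilon> |y|\<^sup>2\<close>. Hence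
  the form grows exponentially once it is positive, which a bounded difference does not allow. At
  \<open>y = M v\<close>, \<open>d = 0\<close> its value is \<open>- v \<bullet> M v\<close>, which is positive in the negative direction of the
  Hessian.\<close>

lemma saddle_cone:
  assumes P: "equilibrium P" "P \<noteq> mat 1" and \<kappa>: "0 < \<kappa>" and B: "0 \<le> B"
  shows "\<exists>\<delta>>0. \<exists>C>0. \<exists>S z0. separating_form \<kappa> B P \<delta> C S z0"
proof -
  have inj: "inj (hessian P)"
    using hessian_nondegenerate(1)[OF P(1)] linear_injective_0[OF linear_hessian] by blast
  obtain N where N: "linear N" "\<And>x. N (hessian P x) = x" "\<And>x. hessian P (N x) = x"
    using linear_injective_isomorphism[OF linear_hessian inj] by blast
  have Nsym: "N y \<bullet> z = y \<bullet> N z" for y z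
    using hessian_sym[OF P(1), of "N y" "N z"] by (simp add: N)
  obtain v where v: "v \<bullet> hessian P v < 0" using hessian_nondegenerate(2)[OF P] by blast
  obtain r c where r: "0 < r" and c: "0 < c"
    and exp: "\<forall>Q1 Q2. rotation_matrix Q1 \<longrightarrow> rotation_matrix Q2 \<longrightarrow>
      norm (Q1 - P) \<le> r \<longrightarrow> norm (Q2 - P) \<le> r \<longrightarrow> c * norm (Q1 - Q2) \<le> norm (torque b (Q1 - Q2))"
    using torque_expands_near_equilibrium[OF P(1)] by blast
  have bN: "bounded_linear N" using N(1) by (simp add: linear_conv_bounded_linear)
  obtain \<nu> where \<nu>: "0 < \<nu>" "\<And>x. norm (N x) \<le> norm x * \<nu>"
    using bounded_linear.pos_bounded[OF bN] by blast
  have bM: "bounded_linear (hessian P)" using linear_hessian by (simp add: linear_conv_bounded_linear)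
  obtain \<mu> where \<mu>: "0 < \<mu>" "\<And>x. norm (hessian P x) \<le> norm x * \<mu>"
    using bounded_linear.pos_bounded[OF bM] by blast
  obtain C where C: "0 < C" "\<And>X. norm (torque b X) \<le> norm X * C"
    using bounded_linear.pos_bounded[OF bounded_linear_torque[of b]] by blast
  define M where "M = (B + \<kappa>)\<^sup>2 + \<mu>"
  have M: "0 < M" using \<mu> by (simp add: M_def add_nonneg_pos)
  define \<epsilon> where "\<epsilon> = min 1 (\<kappa> / (2 * M))"
  have \<epsilon>: "0 < \<epsilon>" "\<epsilon> \<le> 1" "2 * \<epsilon> * M \<le> \<kappa>"
  proof -
    show "0 < \<epsilon>" "\<epsilon> \<le> 1" using \<kappa> M by (auto simp: \<epsilon>_def)
    have "\<epsilon> \<le> \<kappa> / (2 * M)" by (simp add: \<epsilon>_def)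
    then show "2 * \<epsilon> * M \<le> \<kappa>" using M by (simp add: field_simps)
  qed
  define S where "S = (\<lambda>(y, d). - (y \<bullet> N y + d \<bullet> d) + 2 * \<epsilon> * (d \<bullet> y))"
  define c5 where "c5 = min \<kappa> \<epsilon>"
  have c5: "0 < c5" "c5 \<le> \<kappa>" "c5 \<le> \<epsilon>" using \<kappa> \<epsilon> by (auto simp: c5_def)
  (* A common constant for both remainder terms, which are of size \<delta> times the norms of d and y. *)
  define k1 where "k1 = 2 * C / c + 2 * C + torque_bound / c"
  have k1: "0 < k1" "2 * C / c \<le> k1" "2 * C \<le> k1" "torque_bound / c \<le> k1" "2 * C / c + 2 * C \<le> k1"
  proof -
    have "0 < 2 * C / c" "0 < 2 * C" "0 \<le> torque_bound / c"
      using C c torque_bound_nonneg by simp_all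
    then show "0 < k1" "2 * C / c \<le> k1" "2 * C \<le> k1" "torque_bound / c \<le> k1" "2 * C / c + 2 * C \<le> k1"
      unfolding k1_def by linarith+
  qed
  define k2 where "k2 = 2 * k1 * (\<nu> + 2)"
  have k2: "0 < k2" using k1 \<nu> by (simp add: k2_def)
  (* Remainder terms then use up at most half of the growth of the linear system. *)
  define \<delta> where "\<delta> = min r (c5 / (4 * k2))"
  have \<delta>: "0 < \<delta>" "\<delta> \<le> r" "4 * \<delta> * k2 \<le> c5"
  proof -
    show "0 < \<delta>" "\<delta> \<le> r" using r c5 k2 by (auto simp: \<delta>_def)
    have "\<delta> \<le> c5 / (4 * k2)" by (simp add: \<delta>_def)
    then show "4 * \<delta> * k2 \<le> c5" using k2 by (simp add: field_simps)
  qed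
  have bil: "bounded_linear (\<lambda>z. N (fst z))"
    using bounded_linear_compose[OF bN bounded_linear_fst] by simp
  have "continuous_on UNIV S"
    unfolding S_def case_prod_unfold
    by (intro continuous_intros bounded_linear.continuous_on[OF bil])
  moreover have "0 < S (s *\<^sub>R (hessian P v, 0))" if "s \<noteq> 0" for s
  proof -
    have "S (s *\<^sub>R (hessian P v, 0)) = s\<^sup>2 * (- (v \<bullet> hessian P v))"
      by (simp add: S_def linear_scale[OF N(1)] N power2_eq_square inner_commute)
    then show ?thesis using v that by (simp add: zero_less_mult_iff mult_less_0_iff)
  qed
  moreover have "S ((torque b (Q1 T), w1 T) - (torque b (Q2 T), w2 T)) \<le> 0 \<and>
       norm (Q1 T - Q2 T) \<le> 1 / c * norm (torque b (Q1 T) - torque b (Q2 T))"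
    if \<Omega>: "\<forall>t\<ge>T. norm (\<Omega> t) \<le> B"
      and s1: "solution \<kappa> \<Omega> g T Q1 w1" and s2: "solution \<kappa> \<Omega> g T Q2 w2"
      and g: "\<forall>t\<ge>T. \<forall>a\<in>A. norm (g t a - b a) \<le> \<delta>"
      and near1: "\<forall>t\<ge>T. norm (Q1 t - P) \<le> \<delta> \<and> norm (w1 t) \<le> \<delta>"
      and near2: "\<forall>t\<ge>T. norm (Q2 t - P) \<le> \<delta> \<and> norm (w2 t) \<le> \<delta>"
    for \<Omega> g T Q1 w1 Q2 w2
  proof -
    define D where "D t = Q1 t - Q2 t" for t
    define d where "d t = w1 t - w2 t" for t
    define y where "y t = torque b (D t)" for t
    have Dy: "norm (D t) \<le> norm (y t) / c" if t: "T \<le> t" for t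
    proof -
      have "norm (Q1 t - P) \<le> r" "norm (Q2 t - P) \<le> r"
        using near1 near2 \<delta>(2) t by (force intro: order_trans)+
      then have "c * norm (D t) \<le> norm (y t)"
        using exp solutionD(1)[OF s1 t] solutionD(1)[OF s2 t] by (simp add: D_def y_def)
      then show ?thesis using c by (simp add: field_simps)
    qed
    define \<rho>1 where "\<rho>1 t = - torque b (D t ** hat (w1 t)) - torque b ((Q2 t - P) ** hat (d t))" for t
    define \<rho>2 where "\<rho>2 t = torque (\<lambda>a. g t a - b a) (D t)" for t
    define y' where "y' t = - hessian P (d t) + \<rho>1 t" for t
    define d' where "d' t = \<Omega> t \<times> d t - \<kappa> *\<^sub>R d t + y t + \<rho>2 t" for t
    have dy: "(y has_vector_derivative y' t) (at t within {T..})" if t: "T \<le> t" for t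
    proof -
      have "(D has_vector_derivative - (Q1 t ** hat (w1 t)) - - (Q2 t ** hat (w2 t))) (at t within {T..})"
        unfolding D_def by (rule has_vector_derivative_diff[OF solutionD(2)[OF s1 t] solutionD(2)[OF s2 t]])
      from bounded_linear.has_vector_derivative[OF bounded_linear_torque[of b] this]
      have "(y has_vector_derivative torque b (- (Q1 t ** hat (w1 t)) - - (Q2 t ** hat (w2 t)))) (at t within {T..})"
        unfolding y_def .
      moreover have eq: "- (Q1 t ** hat (w1 t)) - - (Q2 t ** hat (w2 t))
          = - (D t ** hat (w1 t)) - (Q2 t - P) ** hat (d t) - P ** hat (d t)"
        by (simp add: D_def d_def linear_diff[OF linear_hat]
            matrix_mult_diff)
      have "torque b (- (Q1 t ** hat (w1 t)) - - (Q2 t ** hat (w2 t))) = y' t"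
        unfolding eq
        by (simp add: y'_def \<rho>1_def hessian_def linear_diff[OF linear_torque] linear_neg[OF linear_torque])
      ultimately show ?thesis by (simp only:)
    qed
    have dd: "(d has_vector_derivative d' t) (at t within {T..})" if t: "T \<le> t" for t
    proof -
      have "accel \<kappa> (\<Omega> t) (g t) (Q1 t) (w1 t) - accel \<kappa> (\<Omega> t) (g t) (Q2 t) (w2 t) = d' t"
        by (simp add: accel_def d'_def d_def y_def \<rho>2_def D_def torque_diff_directions
            linear_diff[OF linear_torque] Cross3.right_diff_distrib scaleR_diff_right)
      with has_vector_derivative_diff[OF solutionD(3)[OF s1 t] solutionD(3)[OF s2 t]]
      show ?thesis unfolding d_def by simp
    qed
    define S' where "S' t = - (2 * (y' t \<bullet> N (y t)) + 2 * (d' t \<bullet> d t)) + 2 * \<epsilon> * (d' t \<bullet> y t + d t \<bullet> y' t)" for t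
    have dS: "((\<lambda>t. S (y t, d t)) has_real_derivative S' t) (at t within {T..})" if t: "T \<le> t" for t
    proof -
      note yN = has_vector_derivative_inner[OF dy[OF t]
          bounded_linear.has_vector_derivative[OF bN dy[OF t]]]
      note d1 = has_vector_derivative_inner[OF dd[OF t] dd[OF t]]
      note d2 = has_vector_derivative_inner[OF dd[OF t] dy[OF t]]
      have e: "y t \<bullet> N (y' t) = y' t \<bullet> N (y t)" using Nsym[of "y t" "y' t"] by (simp add: inner_commute)
      have "((\<lambda>t. - (y t \<bullet> N (y t) + d t \<bullet> d t) + 2 * \<epsilon> * (d t \<bullet> y t)) has_vector_derivative S' t) (at t within {T..})"
        unfolding S'_def
        by (rule derivative_eq_intros yN d1 d2 refl)+ (simp add: e inner_commute algebra_simps)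
      then show ?thesis
        by (simp add: S_def has_real_derivative_iff_has_vector_derivative)
    qed
    have grow: "(c5 / 2) * ((norm (d t))\<^sup>2 + (norm (y t))\<^sup>2) \<le> S' t" if t: "T \<le> t" for t
    proof -
      define x where "x = norm (d t)"
      define u where "u = norm (y t)"
      have x0: "0 \<le> x" "0 \<le> u" by (auto simp: x_def u_def)
      have n: "norm (Q2 t - P) \<le> \<delta>" "norm (w1 t) \<le> \<delta>" using near1 near2 t by auto
      have D: "norm (D t) \<le> u / c" using Dy[OF t] by (simp add: u_def)
      have \<rho>1: "norm (\<rho>1 t) \<le> \<delta> * k1 * (x + u)"
      proof -
        have 1: "norm (D t ** hat (w1 t)) \<le> (u / c) * (2 * \<delta>)"
          by (rule order_trans[OF norm_matrix_mult_le], rule mult_mono)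
            (use D n norm_hat_le[of "w1 t"] x0 c in auto)
        have 2: "norm ((Q2 t - P) ** hat (d t)) \<le> \<delta> * (2 * x)"
          by (rule order_trans[OF norm_matrix_mult_le], rule mult_mono)
            (use n norm_hat_le[of "d t"] \<delta> in \<open>auto simp: x_def\<close>)
        have "norm (\<rho>1 t) \<le> norm (torque b (D t ** hat (w1 t))) + norm (torque b ((Q2 t - P) ** hat (d t)))"
          unfolding \<rho>1_def by (metis norm_minus_cancel norm_triangle_ineq4)
        also have "\<dots> \<le> (u / c) * (2 * \<delta>) * C + \<delta> * (2 * x) * C"
          by (intro add_mono order_trans[OF C(2)] mult_right_mono 1 2) (use C in auto)
        also have "\<dots> = \<delta> * ((2 * C / c) * u + 2 * C * x)" by (simp add: algebra_simps)
        also have "\<dots> \<le> \<delta> * (k1 * u + k1 * x)"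
          by (intro mult_left_mono add_mono mult_right_mono k1 x0) (use \<delta> in auto)
        finally show ?thesis by (simp add: algebra_simps)
      qed
      have \<rho>2: "norm (\<rho>2 t) \<le> \<delta> * k1 * (x + u)"
      proof -
        have "norm (\<rho>2 t) \<le> \<delta> * torque_bound * norm (D t)"
          unfolding \<rho>2_def by (rule norm_torque_le) (use g t in auto)
        also have "\<dots> \<le> \<delta> * torque_bound * (u / c)"
          by (intro mult_left_mono D) (use \<delta> torque_bound_nonneg in auto)
        also have "\<dots> = \<delta> * ((torque_bound / c) * u)" by simp
        also have "\<dots> \<le> \<delta> * (k1 * (x + u))"
          by (intro mult_left_mono mult_mono k1) (use \<delta> x0 k1 in auto)
        finally show ?thesis by (simp add: mult.assoc)
      qed
      define R where "R = \<delta> * k1 * (x + u)"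
      have R0: "0 \<le> R" using \<delta> k1 x0 by (simp add: R_def)
      have ip: "\<bar>p \<bullet> q\<bar> \<le> R * s" if "norm p \<le> R" "norm q \<le> s" for p q :: "real^3" and s
      proof -
        have "\<bar>p \<bullet> q\<bar> \<le> norm p * norm q" by (rule Cauchy_Schwarz_ineq2)
        also have "\<dots> \<le> R * s" by (intro mult_mono that R0) simp
        finally show ?thesis .
      qed
      have i1: "\<bar>\<rho>1 t \<bullet> N (y t)\<bar> \<le> R * (\<nu> * u)"
        by (rule ip) (use \<rho>1 \<nu>(2)[of "y t"] in \<open>auto simp: R_def u_def mult.commute\<close>)
      have i2: "\<bar>\<rho>2 t \<bullet> d t\<bar> \<le> R * x" by (rule ip) (use \<rho>2 in \<open>auto simp: R_def x_def\<close>)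
      have i3: "\<bar>\<rho>2 t \<bullet> y t\<bar> \<le> R * u" by (rule ip) (use \<rho>2 in \<open>auto simp: R_def u_def\<close>)
      have i4: "\<bar>\<rho>1 t \<bullet> d t\<bar> \<le> R * x" by (rule ip) (use \<rho>1 in \<open>auto simp: R_def x_def\<close>)
      define E where "E = - 2 * (\<rho>1 t \<bullet> N (y t)) - 2 * (\<rho>2 t \<bullet> d t) + 2 * \<epsilon> * (\<rho>2 t \<bullet> y t + \<rho>1 t \<bullet> d t)"
      have Ele: "- (2 * \<delta> * k2 * (x\<^sup>2 + u\<^sup>2)) \<le> E"
      proof -
        have "\<bar>\<epsilon> * (\<rho>2 t \<bullet> y t + \<rho>1 t \<bullet> d t)\<bar> \<le> 1 * (R * u + R * x)"
          unfolding abs_mult using \<epsilon> i3 i4 by (intro mult_mono) auto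
        then have "- E \<le> 2 * (R * (\<nu> * u)) + 2 * (R * x) + 2 * (R * u + R * x)"
          unfolding E_def using i1 i2 by (auto simp: abs_le_iff)
        also have "\<dots> = 2 * R * ((\<nu> + 1) * u + 2 * x)" by (simp add: algebra_simps)
        also have "\<dots> \<le> 2 * R * ((\<nu> + 2) * (x + u))"
          by (rule mult_left_mono) (use x0 \<nu> R0 in \<open>auto simp: algebra_simps\<close>)
        also have "\<dots> = \<delta> * k2 * (x + u)\<^sup>2" by (simp add: R_def k2_def power2_eq_square algebra_simps)
        also have "\<dots> \<le> \<delta> * k2 * (2 * (x\<^sup>2 + u\<^sup>2))"
        proof (rule mult_left_mono)
          have "0 \<le> (x - u)\<^sup>2" by simp
          then show "(x + u)\<^sup>2 \<le> 2 * (x\<^sup>2 + u\<^sup>2)" by (simp add: power2_eq_square algebra_simps)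
        qed (use \<delta> k2 in auto)
        finally show ?thesis by (simp add: algebra_simps)
      qed
      have j1: "\<bar>(\<Omega> t \<times> d t) \<bullet> y t\<bar> \<le> B * x * u"
      proof -
        have "\<bar>(\<Omega> t \<times> d t) \<bullet> y t\<bar> \<le> norm (\<Omega> t \<times> d t) * u"
          unfolding u_def by (rule Cauchy_Schwarz_ineq2)
        also have "\<dots> \<le> (norm (\<Omega> t) * x) * u"
          unfolding x_def by (intro mult_right_mono norm_cross_le x0)
        also have "\<dots> \<le> (B * x) * u" using \<Omega> t x0 by (intro mult_right_mono) auto
        finally show ?thesis .
      qed
      have j2: "\<bar>\<kappa> * (d t \<bullet> y t)\<bar> \<le> \<kappa> * x * u"
        using Cauchy_Schwarz_ineq2[of "d t" "y t"] \<kappa> by (simp add: abs_mult x_def u_def)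
      have j3: "\<bar>d t \<bullet> hessian P (d t)\<bar> \<le> \<mu> * x\<^sup>2"
        using Cauchy_Schwarz_ineq2[of "d t" "hessian P (d t)"] mult_left_mono[OF \<mu>(2)[of "d t"] x0(1)]
        by (simp add: x_def power2_eq_square mult_ac)
      define F where "F = (\<Omega> t \<times> d t) \<bullet> y t - \<kappa> * (d t \<bullet> y t) - d t \<bullet> hessian P (d t)"
      have "- F \<le> (B + \<kappa>) * x * u + \<mu> * x\<^sup>2"
        unfolding F_def using j1 j2 j3 by (auto simp: abs_le_iff algebra_simps)
      also have "\<dots> \<le> u\<^sup>2 / 4 + M * x\<^sup>2"
        using mult_le_sum_squares[of "B + \<kappa>" x u] by (simp add: M_def algebra_simps)
      finally have "2 * \<epsilon> * (- F) \<le> 2 * \<epsilon> * (u\<^sup>2 / 4 + M * x\<^sup>2)"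
        using \<epsilon> by (intro mult_left_mono) auto
      also have "\<dots> \<le> \<epsilon> * u\<^sup>2 + \<kappa> * x\<^sup>2"
        using mult_right_mono[OF \<epsilon>(3), of "x\<^sup>2"] mult_nonneg_nonneg[OF less_imp_le[OF \<epsilon>(1)] zero_le_power2[of u]]
        by (simp add: algebra_simps)
      finally have F: "- (\<epsilon> * u\<^sup>2 + \<kappa> * x\<^sup>2) \<le> 2 * \<epsilon> * F" by simp
      have "hessian P (d t) \<bullet> N (y t) = d t \<bullet> y t"
        using Nsym[of "hessian P (d t)" "y t"] by (simp add: N)
      then have "S' t = 2 * \<kappa> * x\<^sup>2 + 2 * \<epsilon> * u\<^sup>2 + 2 * \<epsilon> * F + E"
        unfolding S'_def y'_def d'_def F_def E_def x_def u_def power2_norm_eq_inner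
        by (simp add: inner_add_left inner_add_right inner_diff_left inner_diff_right
            dot_cross_self inner_commute[of "y t" "d t"] inner_commute[of "d t" "\<rho>1 t"] algebra_simps)
      moreover have "c5 * x\<^sup>2 \<le> \<kappa> * x\<^sup>2" "c5 * u\<^sup>2 \<le> \<epsilon> * u\<^sup>2" by (intro mult_right_mono c5; simp)+
      moreover have "2 * (2 * \<delta> * k2 * (x\<^sup>2 + u\<^sup>2)) \<le> c5 * (x\<^sup>2 + u\<^sup>2)"
        using mult_right_mono[OF \<delta>(3), of "x\<^sup>2 + u\<^sup>2"] by (simp add: mult_ac)
      ultimately have "c5 * (x\<^sup>2 + u\<^sup>2) / 2 \<le> S' t" using F Ele by (simp add: distrib_left)
      then show ?thesis by (simp add: x_def u_def)
    qed
    have Sle: "S (y t, d t) \<le> (\<nu> + 2) * ((norm (d t))\<^sup>2 + (norm (y t))\<^sup>2)" for t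
    proof -
      define x where "x = norm (d t)"
      define u where "u = norm (y t)"
      have x0: "0 \<le> x" "0 \<le> u" by (auto simp: x_def u_def)
      have "- (y t \<bullet> N (y t)) \<le> \<nu> * u\<^sup>2"
        using Cauchy_Schwarz_ineq2[of "y t" "N (y t)"] mult_left_mono[OF \<nu>(2)[of "y t"] x0(2)]
        by (simp add: u_def power2_eq_square mult_ac abs_le_iff)
      moreover have "2 * \<epsilon> * (d t \<bullet> y t) \<le> x\<^sup>2 + u\<^sup>2"
      proof -
        have "\<epsilon> * (d t \<bullet> y t) \<le> \<epsilon> * (x * u)"
          unfolding x_def u_def using \<epsilon> by (intro mult_left_mono norm_cauchy_schwarz) auto
        also have "\<dots> \<le> x * u" using \<epsilon> x0 by (simp add: mult_left_le_one_le)
        finally have "2 * \<epsilon> * (d t \<bullet> y t) \<le> 2 * x * u" by simp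
        moreover have "0 \<le> (x - u)\<^sup>2" by simp
        ultimately show ?thesis by (simp add: power2_diff)
      qed
      moreover have "\<nu> * u\<^sup>2 + x\<^sup>2 + u\<^sup>2 \<le> (\<nu> + 2) * (x\<^sup>2 + u\<^sup>2)"
        using \<nu>(1) by (simp add: algebra_simps)
      ultimately show ?thesis
        using inner_ge_zero[of "d t"] unfolding S_def x_def[symmetric] u_def[symmetric] prod.case
        by linarith
    qed
    have "S (y T, d T) \<le> 0"
    proof (rule exponential_growth_nonpos[where S = "\<lambda>t. S (y t, d t)" and S' = S' and a = T])
      show "0 < c5 / 2 / (\<nu> + 2)" using c5 \<nu> by simp
      fix t assume t: "T \<le> t"
      show "((\<lambda>t. S (y t, d t)) has_real_derivative S' t) (at t within {T..})" by (rule dS[OF t])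
      have "c5 / 2 / (\<nu> + 2) * S (y t, d t) \<le> c5 / 2 / (\<nu> + 2) * ((\<nu> + 2) * ((norm (d t))\<^sup>2 + (norm (y t))\<^sup>2))"
        using c5 \<nu> by (intro mult_left_mono Sle) auto
      also have "\<dots> = (c5 / 2) * ((norm (d t))\<^sup>2 + (norm (y t))\<^sup>2)"
      proof -
        have *: "c5 / 2 / q * (q * z) = c5 / 2 * z" if "q \<noteq> 0" for q z using that by simp
        show ?thesis by (rule *) (use \<nu>(1) in simp)
      qed
      also have "\<dots> \<le> S' t" by (rule grow[OF t])
      finally show "c5 / 2 / (\<nu> + 2) * S (y t, d t) \<le> S' t" .
      have "norm (d t) \<le> 2 * \<delta>"
        using norm_triangle_ineq4[of "w1 t" "w2 t"] near1 near2 t unfolding d_def by force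
      moreover have "norm (y t) \<le> 4 * C"
      proof -
        have "norm (D t) \<le> 4"
          using norm_triangle_ineq4[of "Q1 t" "Q2 t"] norm_rotation_le[OF solutionD(1)[OF s1 t]]
            norm_rotation_le[OF solutionD(1)[OF s2 t]] unfolding D_def by linarith
        from mult_right_mono[OF this, of C] show ?thesis using C(2)[of "D t"] C(1) unfolding y_def by linarith
      qed
      ultimately have "(norm (d t))\<^sup>2 + (norm (y t))\<^sup>2 \<le> (2 * \<delta>)\<^sup>2 + (4 * C)\<^sup>2"
        by (intro add_mono power_mono) auto
      then have "(\<nu> + 2) * ((norm (d t))\<^sup>2 + (norm (y t))\<^sup>2) \<le> (\<nu> + 2) * ((2 * \<delta>)\<^sup>2 + (4 * C)\<^sup>2)"
        using \<nu> by (intro mult_left_mono) auto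
      with Sle[of t] show "S (y t, d t) \<le> (\<nu> + 2) * ((2 * \<delta>)\<^sup>2 + (4 * C)\<^sup>2)" by linarith
    qed
    moreover have "norm (D T) \<le> 1 / c * norm (y T)" using Dy[of T] by simp
    ultimately show ?thesis
      by (simp add: y_def d_def D_def linear_diff[OF linear_torque])
  qed
  ultimately have "separating_form \<kappa> B P \<delta> (1/c) S (hessian P v, 0)"
    unfolding separating_form_def by simp
  then show ?thesis
    using \<delta>(1) c by (intro exI[of _ \<delta>] exI[of _ "1/c"] exI[of _ S] exI[of _ "(hessian P v, 0)"] conjI) simp_all
qed

section \<open>Stability of one follower\<close>

text \<open>A small sublevel set of the Lyapunov function lies near the identity. On its boundary the torque
  is bounded below, so a small disturbance leaves the derivative negative and the boundary is not
  reached.\<close>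

lemma follower_stable:
  assumes \<kappa>: "0 < \<kappa>" and B: "0 \<le> B" and e: "0 < e"
  shows "\<exists>\<eta>>0. \<exists>\<delta>>0. \<forall>\<Omega> g t0 Q w. (\<forall>t\<ge>t0. norm (\<Omega> t) \<le> B) \<longrightarrow> solution \<kappa> \<Omega> g t0 Q w \<longrightarrow>
    (\<forall>t\<ge>t0. \<forall>a\<in>A. norm (g t a - b a) \<le> \<eta>) \<longrightarrow> norm (Q t0 - mat 1) < \<delta> \<longrightarrow> norm (w t0) < \<delta> \<longrightarrow>
    (\<forall>t\<ge>t0. norm (Q t - mat 1) < e \<and> norm (w t) < e)"
proof -
  obtain \<epsilon> c1 c2 c3 c4 where ly: "lyapunov_constants \<kappa> B \<epsilon> c1 c2 c3 c4"
    using strict_lyapunov_function[OF \<kappa> B] by blast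
  note c = lyapunov_constantsD(1-4)[OF ly]
  obtain r c where r: "0 < r" "0 < c" and exp: "\<forall>Q1 Q2. rotation_matrix Q1 \<longrightarrow> rotation_matrix Q2 \<longrightarrow>
      norm (Q1 - mat 1) \<le> r \<longrightarrow> norm (Q2 - mat 1) \<le> r \<longrightarrow> c * norm (Q1 - Q2) \<le> norm (torque b (Q1 - Q2))"
    using torque_expands_near_equilibrium[OF equilibrium_one] by blast
  define s where "s = min e r"
  have s: "0 < s" using e r by (simp add: s_def)
  define l where "l = c1 * s\<^sup>2"
  have l: "0 < l" using c s by (simp add: l_def)
  define c6 where "c6 = min 1 (c\<^sup>2)"
  have c6: "0 < c6" "c6 \<le> 1" "c6 \<le> c\<^sup>2" using r by (auto simp: c6_def)
  (* On the level set L = l the function decreases at least at this rate without disturbance. *)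
  define a where "a = c3 * c6 * l / c2"
  have a: "0 < a" using c c6 l by (simp add: a_def)
  define \<eta> where "\<eta> = min 1 (a / (2 * c4))"
  have \<eta>: "0 < \<eta>" "c4 * \<eta>\<^sup>2 < a"
  proof -
    show "0 < \<eta>" using a c by (simp add: \<eta>_def)
    have "\<eta> \<le> 1" by (simp add: \<eta>_def)
    then have "\<eta>\<^sup>2 \<le> \<eta>"
      unfolding power2_eq_square using \<open>0 < \<eta>\<close> by (intro mult_left_le) auto
    then have "c4 * \<eta>\<^sup>2 \<le> c4 * \<eta>"
      using c by (intro mult_left_mono) auto
    also have "\<dots> \<le> c4 * (a / (2 * c4))" using c by (intro mult_left_mono) (auto simp: \<eta>_def)
    also have "\<dots> < a" using a c by simp
    finally show "c4 * \<eta>\<^sup>2 < a" .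
  qed
  define \<delta> where "\<delta> = min 1 (l / (4 * c2))"
  have \<delta>: "0 < \<delta>" "c2 * (\<delta>\<^sup>2 + \<delta>\<^sup>2) < l"
  proof -
    show "0 < \<delta>" using l c by (simp add: \<delta>_def)
    have "\<delta> \<le> 1" by (simp add: \<delta>_def)
    then have "\<delta>\<^sup>2 \<le> \<delta>"
      unfolding power2_eq_square using \<open>0 < \<delta>\<close> by (intro mult_left_le) auto
    also have "\<delta> \<le> l / (4 * c2)" by (simp add: \<delta>_def)
    finally have "c2 * (\<delta>\<^sup>2 + \<delta>\<^sup>2) \<le> c2 * (l / (4 * c2) + l / (4 * c2))"
      using c by (intro mult_left_mono add_mono) auto
    also have "\<dots> < l" using c l by (simp add: field_simps)
    finally show "c2 * (\<delta>\<^sup>2 + \<delta>\<^sup>2) < l" .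
  qed
  have "norm (Q t - mat 1) < e \<and> norm (w t) < e"
    if \<Omega>: "\<forall>t\<ge>t0. norm (\<Omega> t) \<le> B" and sol: "solution \<kappa> \<Omega> g t0 Q w"
      and g: "\<forall>t\<ge>t0. \<forall>a\<in>A. norm (g t a - b a) \<le> \<eta>"
      and Q0: "norm (Q t0 - mat 1) < \<delta>" and w0: "norm (w t0) < \<delta>" and t: "t0 \<le> t"
    for \<Omega> g t0 Q w t
  proof -
    have small: "(norm (Q t - mat 1))\<^sup>2 + (norm (w t))\<^sup>2 \<le> energy \<epsilon> (Q t) (w t) / c1" if "t0 \<le> t" for t
      using lyapunov_constantsD(5)[OF ly solutionD(1)[OF sol that], of "w t"] c(1)
      by (simp add: field_simps)
    have "energy \<epsilon> (Q t) (w t) < l"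
    proof (rule barrier[where L = "\<lambda>t. energy \<epsilon> (Q t) (w t)" and a = t0
          and L' = "\<lambda>t. energy_rate \<epsilon> (Q t) (w t) (accel \<kappa> (\<Omega> t) (g t) (Q t) (w t))"])
      show "((\<lambda>t. energy \<epsilon> (Q t) (w t)) has_real_derivative
          energy_rate \<epsilon> (Q t) (w t) (accel \<kappa> (\<Omega> t) (g t) (Q t) (w t))) (at t within {t0..})"
        if "t0 \<le> t" for t
        unfolding energy_rate_def by (intro energy_derivative solutionD[OF sol that])
      have "energy \<epsilon> (Q t0) (w t0) \<le> c2 * ((norm (Q t0 - mat 1))\<^sup>2 + (norm (w t0))\<^sup>2)"
        by (rule lyapunov_constantsD(6)[OF ly solutionD(1)[OF sol]]) simp
      also have "\<dots> \<le> c2 * (\<delta>\<^sup>2 + \<delta>\<^sup>2)"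
        using Q0 w0 c by (intro mult_left_mono add_mono power_mono) auto
      also have "\<dots> < l" by (rule \<delta>)
      finally show "energy \<epsilon> (Q t0) (w t0) < l" .
      show "energy_rate \<epsilon> (Q t) (w t) (accel \<kappa> (\<Omega> t) (g t) (Q t) (w t)) < 0"
        if t: "t0 \<le> t" and eq: "energy \<epsilon> (Q t) (w t) = l" for t
      proof -
        define d where "d = norm (Q t - mat 1)"
        define x where "x = norm (w t)"
        note rot = solutionD(1)[OF sol t]
        have "d\<^sup>2 + x\<^sup>2 \<le> s\<^sup>2" using small[OF t] c(1) by (simp add: eq l_def d_def x_def)
        then have "d\<^sup>2 \<le> s\<^sup>2" using zero_le_power2[of x] by linarith
        then have "d \<le> s" by (rule power2_le_imp_le) (use s in simp)
        then have "d \<le> r" by (simp add: s_def)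
        then have "c * d \<le> norm (torque b (Q t))"
          using exp[rule_format, OF rot rotation_one] r(1)
          by (simp add: d_def linear_diff[OF linear_torque] torque_one)
        then have "(c * d)\<^sup>2 \<le> (norm (torque b (Q t)))\<^sup>2"
          using r by (intro power_mono) (auto simp: d_def)
        then have cd: "c\<^sup>2 * d\<^sup>2 \<le> (norm (torque b (Q t)))\<^sup>2" by (simp add: power_mult_distrib)
        have "l \<le> c2 * (d\<^sup>2 + x\<^sup>2)"
          using lyapunov_constantsD(6)[OF ly rot, of "w t"] by (simp add: eq d_def x_def)
        then have "a \<le> c3 * c6 * (c2 * (d\<^sup>2 + x\<^sup>2)) / c2"
          unfolding a_def using c c6 by (intro divide_right_mono mult_left_mono) auto
        also have "\<dots> = c3 * (c6 * d\<^sup>2 + c6 * x\<^sup>2)" using c by (simp add: field_simps)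
        also have "\<dots> \<le> c3 * (c\<^sup>2 * d\<^sup>2 + 1 * x\<^sup>2)"
          using c c6 by (intro mult_left_mono add_mono mult_right_mono) auto
        also have "\<dots> \<le> c3 * ((norm (torque b (Q t)))\<^sup>2 + x\<^sup>2)"
          using cd c by (intro mult_left_mono) auto
        finally have "a \<le> c3 * ((norm (torque b (Q t)))\<^sup>2 + x\<^sup>2)" .
        moreover have "energy_rate \<epsilon> (Q t) (w t) (accel \<kappa> (\<Omega> t) (g t) (Q t) (w t))
          \<le> - c3 * ((norm (torque b (Q t)))\<^sup>2 + x\<^sup>2) + c4 * \<eta>\<^sup>2"
          unfolding x_def by (rule lyapunov_constantsD(7)[OF ly rot]) (use \<Omega> g \<eta> t in auto)
        ultimately show ?thesis using \<eta>(2) by simp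
      qed
    qed (rule t)
    then have "energy \<epsilon> (Q t) (w t) / c1 < s\<^sup>2" using c(1) by (simp add: l_def field_simps)
    with small[OF t] have *: "(norm (Q t - mat 1))\<^sup>2 + (norm (w t))\<^sup>2 < s\<^sup>2" by linarith
    have "(norm (Q t - mat 1))\<^sup>2 < s\<^sup>2" "(norm (w t))\<^sup>2 < s\<^sup>2"
      using * zero_le_power2[of "norm (w t)"] zero_le_power2[of "norm (Q t - mat 1)"] by linarith+
    then have "norm (Q t - mat 1) < s" "norm (w t) < s"
      using power_less_imp_less_base[of _ 2 s] s by (blast intro: less_imp_le)+
    then show ?thesis by (simp add: s_def)
  qed
  then show ?thesis using \<eta>(1) \<delta>(1) by (intro exI[of _ \<eta>] exI[of _ \<delta>] conjI allI impI) auto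
qed

end

section \<open>The directions that a follower uses\<close>

text \<open>The attitude error of a neighbor; leaders know their orientation.\<close>

fun est_error :: "(nat \<Rightarrow> real^3^3) \<Rightarrow> agent \<Rightarrow> real^3^3" where
  "est_error Q (Agent i) = (if i \<le> 2 then mat 1 else Q i)"
| "est_error Q (Redundant r) = mat 1"

text \<open>The vectors \<open>ghat\<close> as a function of the current attitude errors of the followers.\<close>

definition sight :: "network \<Rightarrow> nat \<Rightarrow> (nat \<Rightarrow> real^3^3) \<Rightarrow> agent option \<Rightarrow> real^3" where
  "sight G i Q a = (case a of Some j \<Rightarrow> est_error Q j *v bearing G (Agent i) j
     | None \<Rightarrow> (case nbr_pair G i of (j, l) \<Rightarrow>
         ((est_error Q j *v bearing G (Agent i) j) \<times> (est_error Q l *v bearing G (Agent i) l))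
           /\<^sub>R norm (nbr_cross G i)))"

lemma norm_bearing_le: "norm (bearing G i j) \<le> 1"
  by (cases "pos G j = pos G i") (simp_all add: bearing_def)

lemma sight_exact: "sight G i (\<lambda>_. mat 1) a = direction G i a"
proof -
  have "est_error (\<lambda>_. mat 1) j = mat 1" for j by (cases j) auto
  then show ?thesis by (auto simp: sight_def direction_def nbr_cross_def split: option.split prod.split)
qed

context twin_leader_follower
begin

lemma nbr_pair_nbrs:
  assumes "card (nbrs G i) = 2" "nbr_pair G i = (j, l)"
  shows "nbrs G i = {j, l}"
proof -
  obtain u v where "nbrs G i = {u, v}" using assms(1) by (auto simp: card_2_iff)
  then have "\<exists>q. case q of (j, l) \<Rightarrow> nbrs G i = {j, l}" by auto
  from someI_ex[OF this] show ?thesis using assms(2) by (simp add: nbr_pair_def)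
qed

lemma est_error_diff_le:
  assumes i: "i \<in> followers G" and j: "j \<in> nbrs G i"
  shows "norm (est_error Q j - est_error Q' j) \<le> (\<Sum>m\<in>{3..<i}. norm (Q m - Q' m))"
proof (cases j)
  case (Agent m)
  show ?thesis
  proof (cases "m \<le> 2")
    case False
    then have "m \<in> {3..<i}" using nbrs_precede[OF i] j Agent by (auto simp: redundant_leaders_def)
    from member_le_sum[OF this, of "\<lambda>m. norm (Q m - Q' m)"] show ?thesis
      using False Agent by simp
  qed (simp add: Agent sum_nonneg)
qed (simp add: sum_nonneg)

lemma norm_est_error_mult:
  assumes i: "i \<in> followers G" and j: "j \<in> nbrs G i" and Q: "\<And>m. m \<in> {3..<i} \<Longrightarrow> rotation_matrix (Q m)"
  shows "norm (est_error Q j *v x) = norm x"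
proof -
  have "rotation_matrix (est_error Q j)"
  proof (cases j)
    case (Agent m)
    show ?thesis
      using nbrs_precede[OF i] j Agent Q[of m] by (auto simp: redundant_leaders_def rotation_one)
  qed (simp add: rotation_one)
  then show ?thesis by (rule rotation_norm)
qed

lemma norm_sight_le:
  assumes i: "i \<in> followers G" and Q: "\<And>m. m \<in> {3..<i} \<Longrightarrow> rotation_matrix (Q m)"
    and a: "a \<in> indices G i"
  shows "norm (sight G i Q a) \<le> 1 + inverse (norm (nbr_cross G i))"
proof (cases a)
  case (Some j)
  then have "j \<in> nbrs G i" using a by (auto simp: indices_def split: if_splits)
  then have "norm (sight G i Q a) \<le> 1"
    using norm_est_error_mult[OF i _ Q] norm_bearing_le by (simp add: sight_def Some)
  then show ?thesis by (simp add: add_increasing2)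
next
  case None
  obtain j l where jl: "nbr_pair G i = (j, l)" by fastforce
  have "card (nbrs G i) = 2" using a None by (auto simp: indices_def split: if_splits)
  from nbr_pair_nbrs[OF this jl] have m: "j \<in> nbrs G i" "l \<in> nbrs G i" by auto
  have "norm ((est_error Q j *v bearing G (Agent i) j) \<times> (est_error Q l *v bearing G (Agent i) l)) \<le> 1 * 1"
    by (rule order_trans[OF norm_cross_le], rule mult_mono)
      (use norm_est_error_mult[OF i m(1) Q] norm_est_error_mult[OF i m(2) Q] norm_bearing_le in auto)
  then have "inverse (norm (nbr_cross G i)) * norm ((est_error Q j *v bearing G (Agent i) j) \<times> (est_error Q l *v bearing G (Agent i) l))
      \<le> inverse (norm (nbr_cross G i)) * 1"
    by (intro mult_left_mono) simp_all
  then show ?thesis by (simp add: sight_def None jl)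
qed

text \<open>For an actual neighbor the dependence is linear; for the extra index it is a product of two
  bounded linear terms, divided by a positive constant or by \<open>0\<close>, in which case the direction is \<open>0\<close>.\<close>

lemma sight_lipschitz:
  assumes i: "i \<in> followers G" and Q: "\<And>m. m \<in> {3..<i} \<Longrightarrow> rotation_matrix (Q m)"
    and Q': "\<And>m. m \<in> {3..<i} \<Longrightarrow> rotation_matrix (Q' m)" and a: "a \<in> indices G i"
  shows "norm (sight G i Q a - sight G i Q' a)
    \<le> (1 + 2 * inverse (norm (nbr_cross G i))) * (\<Sum>m\<in>{3..<i}. norm (Q m - Q' m))"
proof -
  define S where "S = (\<Sum>m\<in>{3..<i}. norm (Q m - Q' m))"
  have S0: "0 \<le> S" by (simp add: S_def sum_nonneg)
  have one: "norm (est_error Q j *v bearing G (Agent i) j - est_error Q' j *v bearing G (Agent i) j) \<le> S"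
    if j: "j \<in> nbrs G i" for j
  proof -
    have "norm ((est_error Q j - est_error Q' j) *v bearing G (Agent i) j)
        \<le> norm (est_error Q j - est_error Q' j) * norm (bearing G (Agent i) j)"
      by (rule norm_matrix_vector_le)
    also have "\<dots> \<le> S * 1"
      unfolding S_def by (intro mult_mono est_error_diff_le[OF i j] norm_bearing_le sum_nonneg) auto
    finally show ?thesis by (simp add: matrix_vector_mult_diff_rdistrib)
  qed
  show ?thesis
  proof (cases a)
    case (Some j)
    then have "j \<in> nbrs G i" using a by (auto simp: indices_def split: if_splits)
    from one[OF this] have "norm (sight G i Q a - sight G i Q' a) \<le> 1 * S" by (simp add: sight_def Some)
    also have "\<dots> \<le> (1 + 2 * inverse (norm (nbr_cross G i))) * S"
      by (rule mult_right_mono) (use S0 in auto)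
    finally show ?thesis by (simp add: S_def)
  next
    case None
    obtain j l where jl: "nbr_pair G i = (j, l)" by fastforce
    have "card (nbrs G i) = 2" using a None by (auto simp: indices_def split: if_splits)
    from nbr_pair_nbrs[OF this jl] have m: "j \<in> nbrs G i" "l \<in> nbrs G i" by auto
    define p where "p = est_error Q j *v bearing G (Agent i) j"
    define q where "q = est_error Q l *v bearing G (Agent i) l"
    define p' where "p' = est_error Q' j *v bearing G (Agent i) j"
    define q' where "q' = est_error Q' l *v bearing G (Agent i) l"
    have n: "norm q \<le> 1" "norm p' \<le> 1" "norm (p - p') \<le> S" "norm (q - q') \<le> S"
      unfolding p_def q_def p'_def q'_def
      using norm_est_error_mult[OF i m(2) Q] norm_est_error_mult[OF i m(1) Q'] norm_bearing_le one m by auto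
    have eq: "p \<times> q - p' \<times> q' = (p - p') \<times> q + p' \<times> (q - q')"
      by (simp add: Cross3.left_diff_distrib Cross3.right_diff_distrib)
    have "norm (p \<times> q - p' \<times> q') \<le> norm (p - p') * norm q + norm p' * norm (q - q')"
      unfolding eq using norm_triangle_ineq[of "(p - p') \<times> q" "p' \<times> (q - q')"] norm_cross_le[of "p - p'" q]
        norm_cross_le[of p' "q - q'"] by linarith
    also have "\<dots> \<le> S * 1 + 1 * S" using n S0 by (intro add_mono mult_mono) auto
    finally have 1: "norm (p \<times> q - p' \<times> q') \<le> 2 * S" by simp
    have "norm (sight G i Q a - sight G i Q' a) = inverse (norm (nbr_cross G i)) * norm (p \<times> q - p' \<times> q')"
      by (simp add: sight_def None jl p_def q_def p'_def q'_def scaleR_diff_right[symmetric])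
    also have "\<dots> \<le> inverse (norm (nbr_cross G i)) * (2 * S)"
      using 1 by (intro mult_left_mono) auto
    also have "\<dots> \<le> (1 + 2 * inverse (norm (nbr_cross G i))) * S"
      using S0 by (simp add: distrib_right)
    finally show ?thesis by (simp add: S_def)
  qed
qed

lemma gain_matrix_mult:
  "gain_matrix G i *v v = (\<Sum>a\<in>indices G i. (gain G i a * (direction G i a \<bullet> v)) *\<^sub>R direction G i a)"
proof -
  have "(\<chi> r c. d $ r * d $ c) *v v = (d \<bullet> v) *\<^sub>R d" for d :: "real^3"
    by (simp add: matrix_vector_mult_def vec_eq_iff inner_vec_def sum_distrib_left sum_distrib_right mult_ac)
  moreover have "(\<Sum>a\<in>indices G i. gain G i a *\<^sub>R M a) *v v = (\<Sum>a\<in>indices G i. gain G i a *\<^sub>R (M a *v v))"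
    for M :: "agent option \<Rightarrow> real^3^3"
    by (simp add: bounded_bilinear.sum_left[OF bounded_bilinear_matrix_vec]
        bounded_bilinear.scaleR_left[OF bounded_bilinear_matrix_vec])
  ultimately show ?thesis by (simp add: gain_matrix_def)
qed

text \<open>Directions in a plane through the origin would be coplanar together with \<open>0\<close>, so they span the
  space.\<close>

lemma weighted_directions_follower:
  assumes i: "i \<in> followers G"
  shows "weighted_directions (indices G i) (gain G i) (direction G i)"
proof
  have "finite (nbrs G i)" using two_nbrs[OF i] by (intro card_ge_0_finite) simp
  then show "finite (indices G i)" by (simp add: indices_def)
  show "0 < gain G i a" if "a \<in> indices G i" for a by (rule gain_pos[OF i that])
  let ?D = "direction G i ` indices G i"
  show "span ?D = UNIV"
  proof (rule ccontr)
    assume ns: "span ?D \<noteq> UNIV"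
    have "dim ?D \<le> 2"
    proof -
      have "dim (span ?D) \<noteq> DIM(real^3)"
        using ns dim_eq_full[of ?D] by simp
      then show ?thesis using dim_subset_UNIV[of ?D] by simp
    qed
    obtain Bs where Bs: "Bs \<subseteq> span ?D" "independent Bs" "span ?D \<subseteq> span Bs" "card Bs = dim ?D" "finite Bs"
      by (metis basis_exists dim_span finiteI_independent)
    obtain u v where "span Bs \<subseteq> span {u, v}"
    proof -
      have "card Bs = 0 \<or> card Bs = 1 \<or> card Bs = 2" using \<open>dim ?D \<le> 2\<close> Bs(4) by linarith
      then show thesis
      proof (elim disjE)
        assume "card Bs = 0"
        then show thesis using that[of 0 0] Bs(5) by simp
      next
        assume "card Bs = 1"
        then obtain u where "Bs = {u}" by (auto simp: card_1_singleton_iff)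
        then show thesis using that[of u u] by simp
      next
        assume "card Bs = 2"
        then obtain u v where "Bs = {u, v}" by (auto simp: card_2_iff)
        then show thesis using that[of u v] by simp
      qed
    qed
    then have "insert 0 ?D \<subseteq> span {u, v}"
      using Bs(3) span_superset[of ?D] span_zero by fastforce
    also have "span {u, v} = affine hull {0, u, v}"
      by (subst affine_hull_span_0) (simp_all add: hull_inc)
    finally have "coplanar (insert 0 ?D)" unfolding coplanar_def by blast
    then show False using not_coplanar[OF i] by simp
  qed
  show "card {c. \<exists>v. v \<noteq> 0 \<and> (\<Sum>a\<in>indices G i. (gain G i a * (direction G i a \<bullet> v)) *\<^sub>R direction G i a) = c *\<^sub>R v} = 3"
    using distinct_eigenvalues[OF i] by (simp add: eigenvalues_def gain_matrix_mult)
qed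

end


section \<open>The cascade in error coordinates\<close>

lemma transpose_hat: "transpose (hat x) = - hat x"
  by (simp add: hat_components transpose_def vec_eq_iff forall_3)

lemma settles_later:
  assumes "settles Q w"
  shows "\<exists>T0 \<Phi> \<Phi>'. \<forall>T\<ge>T0. \<forall>t\<ge>T. (\<Phi> has_real_derivative \<Phi>' t) (at t within {T..}) \<and>
     0 \<le> \<Phi> t \<and> \<Phi>' t \<le> - ((norm (Q t - mat 1))\<^sup>2 + (norm (w t))\<^sup>2)"
proof -
  obtain T0 \<Phi> \<Phi>' where *: "\<forall>t\<ge>T0. (\<Phi> has_real_derivative \<Phi>' t) (at t within {T0..}) \<and>
     0 \<le> \<Phi> t \<and> \<Phi>' t \<le> - ((norm (Q t - mat 1))\<^sup>2 + (norm (w t))\<^sup>2)"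
    using assms unfolding settles_def by blast
  have "(\<Phi> has_real_derivative \<Phi>' t) (at t within {T..}) \<and>
     0 \<le> \<Phi> t \<and> \<Phi>' t \<le> - ((norm (Q t - mat 1))\<^sup>2 + (norm (w t))\<^sup>2)" if "T0 \<le> T" "T \<le> t" for T t
  proof -
    have "T0 \<le> t" using that by simp
    then show ?thesis using * has_field_derivative_subset[of \<Phi> "\<Phi>' t" t "{T0..}" "{T..}"] that by auto
  qed
  then show ?thesis by blast
qed

context twin_leader_follower
begin

text \<open>The angular velocity in the inertial frame.\<close>

definition spin :: "nat \<Rightarrow> real \<Rightarrow> real^3" where
  "spin i t = orient G (Agent i) t *v angvel G (Agent i) t"

definition error_cascade :: "nat \<Rightarrow> real \<Rightarrow> (nat \<Rightarrow> real \<Rightarrow> real^3^3) \<Rightarrow> (nat \<Rightarrow> real \<Rightarrow> real^3) \<Rightarrow> bool" where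
  "error_cascade k t0 Q w \<longleftrightarrow> (\<forall>i\<in>{3..k}.
     weighted_directions.solution (indices G i) (gain G i) (direction G i) (damping G) (spin i)
       (\<lambda>t. sight G i (\<lambda>j. Q j t)) t0 (Q i) (w i))"

lemma follower_agent: "i \<in> followers G \<Longrightarrow> Agent i \<in> agents G"
  by (auto simp: followers_def agents_def)

lemma nbrs_agents: "i \<in> followers G \<Longrightarrow> nbrs G i \<subseteq> agents G"
  using nbrs_precede[of i] by (auto simp: agents_def followers_def)

lemma spin_bounded:
  assumes k: "k \<le> last_index G"
  shows "\<exists>B\<ge>0. \<forall>i\<in>{3..k}. \<forall>t\<ge>0. norm (spin i t) \<le> B"
proof -
  have "\<exists>c. \<forall>t\<ge>0. norm (spin i t) \<le> c" if i: "i \<in> {3..k}" for i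
  proof -
    have f: "i \<in> followers G" using i k by (simp add: followers_def)
    obtain c where "\<forall>t\<ge>0. norm (angvel G (Agent i) t) \<le> c"
      using angvel_bounded[OF follower_agent[OF f]] by blast
    then show ?thesis
      unfolding spin_def using rotation_norm[OF rotation[OF follower_agent[OF f]]] by (intro exI[of _ c]) simp
  qed
  then obtain c where c: "\<And>i t. i \<in> {3..k} \<Longrightarrow> 0 \<le> t \<Longrightarrow> norm (spin i t) \<le> c i" by metis
  have "norm (spin i t) \<le> (\<Sum>i\<in>{3..k}. \<bar>c i\<bar>)" if "i \<in> {3..k}" "0 \<le> t" for i t
    using c[OF that] member_le_sum[OF that(1), of "\<lambda>i. \<bar>c i\<bar>"] by fastforce
  then show ?thesis by (intro exI[of _ "\<Sum>i\<in>{3..k}. \<bar>c i\<bar>"]) (simp add: sum_nonneg)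
qed

text \<open>By definition of the attitude error, \<open>E\<^sub>j R\<^sub>j\<^sup>T\<close> is the error of neighbor \<open>j\<close>.\<close>

lemma ghat_eq_sight:
  assumes i: "i \<in> followers G" and t: "0 \<le> t" and a: "a \<in> indices G i"
  shows "ghat G E i a t = sight G i (\<lambda>j. att_error G E j t) a"
proof -
  have gn: "ghat_nbr G E i j t = est_error (\<lambda>j. att_error G E j t) j *v bearing G (Agent i) j"
    if j: "j \<in> nbrs G i" for j
  proof -
    have "estimate G E j t ** transpose (orient G j t) = est_error (\<lambda>j. att_error G E j t) j"
    proof (cases "\<exists>m. j = Agent m \<and> \<not> m \<le> 2")
      case True then show ?thesis by (auto simp: att_error_def)
    next
      case False
      have "orient G j t ** transpose (orient G j t) = mat 1"
        using rotation_inverse(2)[OF rotation[of j t]] nbrs_agents[OF i] j t by auto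
      then show ?thesis using False by (cases j) auto
    qed
    then show ?thesis
      by (simp add: ghat_nbr_def matrix_vector_mul_assoc del: transpose_matrix_vector)
  qed
  show ?thesis
  proof (cases a)
    case (Some j)
    then have "j \<in> nbrs G i" using a by (auto simp: indices_def split: if_splits)
    then show ?thesis by (simp add: ghat_def sight_def Some gn)
  next
    case None
    obtain j l where jl: "nbr_pair G i = (j, l)" by fastforce
    have "card (nbrs G i) = 2" using a None by (auto simp: indices_def split: if_splits)
    from nbr_pair_nbrs[OF this jl] have "j \<in> nbrs G i" "l \<in> nbrs G i" by auto
    then show ?thesis by (simp add: ghat_def sight_def None jl gn)
  qed
qed

text \<open>In \<open>Q = E R\<^sup>T\<close> the angular velocity of the agent cancels and \<open>Q' = - E hat W R\<^sup>T\<close>. The velocity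
  \<open>w = R W\<close> picks up the gyroscopic term from \<open>R'\<close>, and \<open>R\<close> moves the correction term to the inertial
  frame.\<close>

lemma error_cascade_of_solution:
  assumes sol: "cascade_solution G k t0 E W" and t0: "0 \<le> t0" and k: "k \<le> last_index G"
  shows "error_cascade k t0 (att_error G E) (\<lambda>i t. orient G (Agent i) t *v W i t)"
  unfolding error_cascade_def
proof
  fix i assume i: "i \<in> {3..k}"
  have f: "i \<in> followers G" using i k by (simp add: followers_def)
  interpret F: weighted_directions "indices G i" "gain G i" "direction G i"
    by (rule weighted_directions_follower[OF f])
  let ?R = "orient G (Agent i)"
  show "F.solution (damping G) (spin i) (\<lambda>t. sight G i (\<lambda>j. att_error G E j t)) t0
      (att_error G E i) (\<lambda>t. ?R t *v W i t)"
    unfolding F.solution_def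
  proof (intro allI impI conjI)
    fix t assume t: "t0 \<le> t"
    then have t': "0 \<le> t" using t0 by simp
    have rotR: "rotation_matrix (?R t)" by (rule rotation[OF follower_agent[OF f] t'])
    have rotE: "rotation_matrix (E i t)"
      and dE: "(E i has_vector_derivative (E i t ** hat (angvel G (Agent i) t - W i t))) (at t within {t0..})"
      and dW: "(W i has_vector_derivative (- (damping G *\<^sub>R W i t) + err G E i t + pert G E i t)) (at t within {t0..})"
      using sol i t by (auto simp: cascade_solution_def)
    have dR: "(?R has_vector_derivative (?R t ** hat (angvel G (Agent i) t))) (at t within {t0..})"
      by (rule has_vector_derivative_within_subset[OF kinematics[OF follower_agent[OF f] t']]) (use t0 in auto)
    show "rotation_matrix (att_error G E i t)"
      unfolding att_error_def by (intro rotation_mult rotE rotation_transpose rotR)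
    show "(att_error G E i has_vector_derivative - (att_error G E i t ** hat (?R t *v W i t))) (at t within {t0..})"
    proof -
      let ?\<omega> = "angvel G (Agent i) t"
      note dRT = bounded_linear.has_vector_derivative[OF bounded_linear_transpose dR]
      note d = bounded_bilinear.has_vector_derivative[OF bounded_bilinear_matrix_mult dE dRT]
      have "E i t ** transpose (?R t ** hat ?\<omega>) + E i t ** hat (?\<omega> - W i t) ** transpose (?R t)
          = - (E i t ** (hat (W i t) ** transpose (?R t)))"
        by (simp add: matrix_transpose_mul transpose_hat linear_diff[OF linear_hat]
            matrix_mult_diff
            bounded_bilinear.minus_left[OF bounded_bilinear_matrix_mult]
            bounded_bilinear.minus_right[OF bounded_bilinear_matrix_mult] matrix_mul_assoc)
      moreover have "E i t ** (hat (W i t) ** transpose (?R t))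
          = (E i t ** transpose (?R t)) ** hat (?R t *v W i t)"
      proof -
        have "(E i t ** transpose (?R t)) ** hat (?R t *v W i t)
            = E i t ** ((transpose (?R t) ** ?R t) ** (hat (W i t) ** transpose (?R t)))"
          unfolding rotation_congruence_hat[OF rotR, symmetric] by (simp only: matrix_mul_assoc)
        then show ?thesis by (simp only: rotation_inverse[OF rotR] matrix_mul_lid)
      qed
      ultimately show ?thesis
        unfolding att_error_def by (intro has_vector_derivative_eq_rhs[OF d]) simp
    qed
    show "((\<lambda>t. ?R t *v W i t) has_vector_derivative
        F.accel (damping G) (spin i t) (sight G i (\<lambda>j. att_error G E j t)) (att_error G E i t) (?R t *v W i t))
        (at t within {t0..})"
    proof -
      let ?\<omega> = "angvel G (Agent i) t"
      let ?g = "sight G i (\<lambda>j. att_error G E j t)"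
      note d = bounded_bilinear.has_vector_derivative[OF bounded_bilinear_matrix_vec dR dW]
      have torque: "?R t *v (err G E i t + pert G E i t) = F.torque ?g (att_error G E i t)"
      proof -
        have "?R t *v ((transpose (E i t) *v x) \<times> (transpose (?R t) *v y)) = (x v* att_error G E i t) \<times> y" for x y
        proof -
          have "?R t *v ((transpose (E i t) *v x) \<times> (transpose (?R t) *v y))
              = (?R t *v (transpose (E i t) *v x)) \<times> (?R t *v (transpose (?R t) *v y))"
            by (rule cross_rotation_matrix[OF rotR, symmetric])
          also have "?R t *v (transpose (?R t) *v y) = y"
            by (simp only: matrix_vector_mul_assoc rotation_inverse[OF rotR] matrix_vector_mul_lid)
          also have "?R t *v (transpose (E i t) *v x) = transpose (att_error G E i t) *v x"
            by (simp only: matrix_vector_mul_assoc att_error_def matrix_transpose_mul transpose_transpose)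
          finally show ?thesis by simp
        qed
        then show ?thesis
          unfolding err_plus_pert F.torque_def body_direction_def
          by (simp add: bounded_bilinear.sum_right[OF bounded_bilinear_matrix_vec]
              matrix_vector_mult_scaleR ghat_eq_sight[OF f t'] del: transpose_matrix_vector)
      qed
      have "?R t *v (- (damping G *\<^sub>R W i t) + err G E i t + pert G E i t) + (?R t ** hat ?\<omega>) *v W i t
          = (?R t *v ?\<omega>) \<times> (?R t *v W i t) - damping G *\<^sub>R (?R t *v W i t) + ?R t *v (err G E i t + pert G E i t)"
      proof -
        have "(?R t ** hat ?\<omega>) *v W i t = (?R t *v ?\<omega>) \<times> (?R t *v W i t)"
          by (simp only: matrix_vector_mul_assoc[symmetric] hat_mult_vec cross_rotation_matrix[OF rotR])
        moreover have "?R t *v (- (damping G *\<^sub>R W i t)) = - (damping G *\<^sub>R (?R t *v W i t))"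
          by (simp add: bounded_bilinear.minus_right[OF bounded_bilinear_matrix_vec] matrix_vector_mult_scaleR)
        ultimately show ?thesis
          by (simp only: matrix_vector_right_distrib add.assoc) simp
      qed
      then show ?thesis
        by (intro has_vector_derivative_eq_rhs[OF d]) (simp add: F.accel_def spin_def torque)
    qed
  qed
qed

lemma error_cascade_mono: "error_cascade k t0 Q w \<Longrightarrow> j \<le> k \<Longrightarrow> error_cascade j t0 Q w"
  by (auto simp: error_cascade_def)

lemma error_cascade_solution:
  assumes "error_cascade k t0 Q w" "i \<in> {3..k}"
  shows "weighted_directions.solution (indices G i) (gain G i) (direction G i) (damping G) (spin i)
    (\<lambda>t. sight G i (\<lambda>j. Q j t)) t0 (Q i) (w i)"
  using assms unfolding error_cascade_def by blast

lemma error_cascade_rotation: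
  assumes "error_cascade k t0 Q w" "k \<le> last_index G" "i \<in> {3..k}" "t0 \<le> t"
  shows "rotation_matrix (Q i t)"
proof -
  have f: "i \<in> followers G" using assms by (simp add: followers_def)
  interpret F: weighted_directions "indices G i" "gain G i" "direction G i"
    by (rule weighted_directions_follower[OF f])
  show ?thesis by (rule F.solutionD(1)[OF error_cascade_solution[OF assms(1,3)] assms(4)])
qed

lemma sight_error:
  assumes i: "i \<in> followers G" and Q: "\<And>m. m \<in> {3..<i} \<Longrightarrow> rotation_matrix (Q m)" and a: "a \<in> indices G i"
  shows "norm (sight G i Q a - direction G i a)
    \<le> (1 + 2 * inverse (norm (nbr_cross G i))) * (\<Sum>m\<in>{3..<i}. norm (Q m - mat 1))"
  using sight_lipschitz[OF i Q _ a, where Q'="\<lambda>_. mat 1"] by (simp add: sight_exact rotation_one)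

text \<open>Induction over the followers: the disturbance of follower \<open>i\<close> is controlled by the errors of its
  predecessors, which stay below any prescribed bound if they start small enough.\<close>

lemma error_cascade_stable:
  assumes "k \<le> last_index G" "0 \<le> t0" "0 < e"
  shows "\<exists>\<delta>>0. \<forall>Q w. error_cascade k t0 Q w \<longrightarrow>
    (\<forall>i\<in>{3..k}. norm (Q i t0 - mat 1) < \<delta> \<and> norm (w i t0) < \<delta>) \<longrightarrow>
    (\<forall>t\<ge>t0. \<forall>i\<in>{3..k}. norm (Q i t - mat 1) < e \<and> norm (w i t) < e)"
  using assms
proof (induction k arbitrary: e)
  case 0
  then show ?case by (intro exI[of _ 1]) simp
next
  case (Suc k)
  show ?case
  proof (cases "Suc k < 3")
    case True
    then show ?thesis by (intro exI[of _ 1]) auto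
  next
    case False
    define i where "i = Suc k"
    have i: "i \<in> followers G" "i \<in> {3..Suc k}" "{3..<i} = {3..k}"
      using False Suc.prems by (auto simp: i_def followers_def)
    interpret F: weighted_directions "indices G i" "gain G i" "direction G i"
      by (rule weighted_directions_follower[OF i(1)])
    obtain B where B: "0 \<le> B" "\<forall>i\<in>{3..Suc k}. \<forall>t\<ge>0. norm (spin i t) \<le> B"
      using spin_bounded[OF Suc.prems(1)] by blast
    obtain \<eta> \<delta> where \<eta>: "0 < \<eta>" and \<delta>: "0 < \<delta>" and st: "\<forall>\<Omega> g t0 Q w. (\<forall>t\<ge>t0. norm (\<Omega> t) \<le> B) \<longrightarrow>
      F.solution (damping G) \<Omega> g t0 Q w \<longrightarrow>
      (\<forall>t\<ge>t0. \<forall>a\<in>indices G i. norm (g t a - direction G i a) \<le> \<eta>) \<longrightarrow> norm (Q t0 - mat 1) < \<delta> \<longrightarrow> norm (w t0) < \<delta> \<longrightarrow>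
      (\<forall>t\<ge>t0. norm (Q t - mat 1) < e \<and> norm (w t) < e)"
      using F.follower_stable[OF damping_pos B(1) Suc.prems(3)] by blast
    (* At most k predecessors contribute; the 1 keeps the constant positive. *)
    define C where "C = (1 + 2 * inverse (norm (nbr_cross G i))) * (real k + 1)"
    have C: "0 < C"
      unfolding C_def by (rule mult_pos_pos) (auto intro: add_pos_nonneg)
    define e' where "e' = min e (\<eta> / C)"
    have e': "0 < e'" using Suc.prems \<eta> C by (simp add: e'_def)
    obtain \<delta>' where \<delta>': "0 < \<delta>'" and IH: "\<forall>Q w. error_cascade k t0 Q w \<longrightarrow>
      (\<forall>i\<in>{3..k}. norm (Q i t0 - mat 1) < \<delta>' \<and> norm (w i t0) < \<delta>') \<longrightarrow>
      (\<forall>t\<ge>t0. \<forall>i\<in>{3..k}. norm (Q i t - mat 1) < e' \<and> norm (w i t) < e')"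
      using Suc.IH[OF _ Suc.prems(2) e'] Suc.prems(1) by auto
    have "\<forall>t\<ge>t0. \<forall>j\<in>{3..Suc k}. norm (Q j t - mat 1) < e \<and> norm (w j t) < e"
      if cas: "error_cascade (Suc k) t0 Q w"
        and init: "\<forall>i\<in>{3..Suc k}. norm (Q i t0 - mat 1) < min \<delta> \<delta>' \<and> norm (w i t0) < min \<delta> \<delta>'"
      for Q w
    proof -
      have prev: "norm (Q j t - mat 1) < e' \<and> norm (w j t) < e'" if "t0 \<le> t" "j \<in> {3..k}" for t j
        using IH[rule_format, OF error_cascade_mono[OF cas] _ that] init by auto
      have "norm (sight G i (\<lambda>j. Q j t) a - direction G i a) \<le> \<eta>" if t: "t0 \<le> t" and a: "a \<in> indices G i" for t a
      proof -
        have "norm (sight G i (\<lambda>j. Q j t) a - direction G i a)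
            \<le> (1 + 2 * inverse (norm (nbr_cross G i))) * (\<Sum>m\<in>{3..<i}. norm (Q m t - mat 1))"
          by (rule sight_error[OF i(1) _ a]) (use error_cascade_rotation[OF cas Suc.prems(1) _ t] i in auto)
        also have "\<dots> \<le> (1 + 2 * inverse (norm (nbr_cross G i))) * ((real k + 1) * e')"
        proof (rule mult_left_mono)
          have "(\<Sum>m\<in>{3..<i}. norm (Q m t - mat 1)) \<le> (\<Sum>m\<in>{3..<i}. e')"
            using prev[OF t] i(3) by (intro sum_mono less_imp_le) auto
          also have "\<dots> = real (card {3..<i}) * e'" by simp
          also have "\<dots> \<le> (real k + 1) * e'"
            using e' False by (intro mult_right_mono) (auto simp: i_def)
          finally show "(\<Sum>m\<in>{3..<i}. norm (Q m t - mat 1)) \<le> (real k + 1) * e'" .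
        qed simp
        also have "\<dots> = C * e'" by (simp add: C_def)
        also have "\<dots> \<le> C * (\<eta> / C)" using C by (intro mult_left_mono) (auto simp: e'_def)
        also have "\<dots> = \<eta>" using C by simp
        finally show ?thesis .
      qed
      moreover have "F.solution (damping G) (spin i) (\<lambda>t. sight G i (\<lambda>j. Q j t)) t0 (Q i) (w i)"
        using cas i(2) by (simp add: error_cascade_def)
      moreover have "\<forall>t\<ge>t0. norm (spin i t) \<le> B" using B(2) i(2) Suc.prems(2) by auto
      ultimately have new: "\<forall>t\<ge>t0. norm (Q i t - mat 1) < e \<and> norm (w i t) < e"
        using st[rule_format, of t0 "spin i" "\<lambda>t. sight G i (\<lambda>j. Q j t)" "Q i" "w i"] init i(2) by auto
      show ?thesis
      proof (intro allI impI ballI)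
        fix t j assume "t0 \<le> t" "j \<in> {3..Suc k}"
        then show "norm (Q j t - mat 1) < e \<and> norm (w j t) < e"
          using new prev[of t j] by (cases "j = i") (auto simp: i_def e'_def)
      qed
    qed
    then show ?thesis using \<delta> \<delta>' by (intro exI[of _ "min \<delta> \<delta>'"]) auto
  qed
qed

text \<open>The squared disturbance of follower \<open>i\<close> is at most a constant times the sum of the squared errors
  of its predecessors, which is bounded by minus the derivative of a multiple of the sum of their
  \<open>\<Phi>\<^sub>j\<close>.\<close>

lemma error_cascade_reaches_equilibrium:
  assumes cas: "error_cascade k t0 Q w" and k: "k \<le> last_index G" and t0: "0 \<le> t0" and i: "i \<in> {3..k}"
    and prev: "\<And>j. j \<in> {3..<i} \<Longrightarrow> settles (Q j) (w j)"
  shows "\<exists>P. weighted_directions.equilibrium (indices G i) (gain G i) (direction G i) P \<and>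
    (Q i \<longlongrightarrow> P) at_top \<and> (w i \<longlongrightarrow> 0) at_top \<and> (P = mat 1 \<longrightarrow> settles (Q i) (w i))"
proof -
  have f: "i \<in> followers G" using i k by (simp add: followers_def)
  interpret F: weighted_directions "indices G i" "gain G i" "direction G i"
    by (rule weighted_directions_follower[OF f])
  obtain B where B: "0 \<le> B" "\<forall>i\<in>{3..k}. \<forall>t\<ge>0. norm (spin i t) \<le> B"
    using spin_bounded[OF k] by blast
  have rot: "rotation_matrix (Q m t)" if "m \<in> {3..<i}" "t0 \<le> t" for m t
    using error_cascade_rotation[OF cas k _ that(2)] that(1) i by auto
  have "\<forall>j\<in>{3..<i}. \<exists>T0 \<Phi> \<Phi>'. \<forall>T\<ge>T0. \<forall>t\<ge>T. (\<Phi> has_real_derivative \<Phi>' t) (at t within {T..}) \<and>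
     0 \<le> \<Phi> t \<and> \<Phi>' t \<le> - ((norm (Q j t - mat 1))\<^sup>2 + (norm (w j t))\<^sup>2)"
    using settles_later[OF prev] by blast
  then obtain T0 \<Phi> \<Phi>' where \<Phi>: "\<forall>j. j \<in> {3..<i} \<longrightarrow> (\<forall>T\<ge>T0 j. \<forall>t\<ge>T. (\<Phi> j has_real_derivative \<Phi>' j t) (at t within {T..}) \<and>
     0 \<le> \<Phi> j t \<and> \<Phi>' j t \<le> - ((norm (Q j t - mat 1))\<^sup>2 + (norm (w j t))\<^sup>2))"
    by metis
  define T where "T = Max (insert t0 (T0 ` {3..<i}))"
  have T: "t0 \<le> T" "\<And>j. j \<in> {3..<i} \<Longrightarrow> T0 j \<le> T"
    unfolding T_def by (rule Max_ge; auto)+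
  define C where "C = 1 + 2 * inverse (norm (nbr_cross G i))"
  have C: "0 < C" by (auto simp: C_def intro: add_pos_nonneg)
  define D where "D = C\<^sup>2 * real (card {3..<i})"
  show ?thesis
  proof (rule F.solution_reaches_equilibrium[where \<kappa> = "damping G" and \<Omega> = "spin i" and B = B
        and g = "\<lambda>t. sight G i (\<lambda>j. Q j t)" and G = "1 + inverse (norm (nbr_cross G i))" and T = T
        and \<Psi> = "\<lambda>t. D * (\<Sum>j\<in>{3..<i}. \<Phi> j t)" and \<Psi>' = "\<lambda>t. D * (\<Sum>j\<in>{3..<i}. \<Phi>' j t)"])
    show "F.solution (damping G) (spin i) (\<lambda>t. sight G i (\<lambda>j. Q j t)) t0 (Q i) (w i)"
      using cas i by (simp add: error_cascade_def)
    show "0 < damping G" by (rule damping_pos)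
    show "norm (spin i t) \<le> B" if "t0 \<le> t" for t using B(2) i that t0 by auto
    show "norm (sight G i (\<lambda>j. Q j t) a) \<le> 1 + inverse (norm (nbr_cross G i))"
      if "t0 \<le> t" "a \<in> indices G i" for t a
      by (rule norm_sight_le[OF f rot that(2)]) (use that in auto)
    show "t0 \<le> T" by (rule T)
    show "((\<lambda>t. D * (\<Sum>j\<in>{3..<i}. \<Phi> j t)) has_real_derivative D * (\<Sum>j\<in>{3..<i}. \<Phi>' j t)) (at t within {T..})"
      if "T \<le> t" for t
      by (intro DERIV_cmult DERIV_sum) (use \<Phi> T that in blast)
    show "0 \<le> D * (\<Sum>j\<in>{3..<i}. \<Phi> j t)" if "T \<le> t" for t
    proof -
      have "0 \<le> \<Phi> j t" if j: "j \<in> {3..<i}" for j using \<Phi> T \<open>T \<le> t\<close> j by blast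
      then show ?thesis by (intro mult_nonneg_nonneg sum_nonneg) (auto simp: D_def)
    qed
    show "\<exists>\<eta>\<ge>0. (\<forall>a\<in>indices G i. norm (sight G i (\<lambda>j. Q j t) a - direction G i a) \<le> \<eta>) \<and>
        \<eta>\<^sup>2 \<le> - (D * (\<Sum>j\<in>{3..<i}. \<Phi>' j t))" if t: "T \<le> t" for t
    proof (intro exI conjI ballI)
      let ?\<eta> = "C * (\<Sum>m\<in>{3..<i}. norm (Q m t - mat 1))"
      show "0 \<le> ?\<eta>" using C by (simp add: sum_nonneg)
      show "norm (sight G i (\<lambda>j. Q j t) a - direction G i a) \<le> ?\<eta>" if "a \<in> indices G i" for a
        unfolding C_def by (rule sight_error[OF f rot that]) (use t T in auto)
      have "(\<Sum>m\<in>{3..<i}. norm (Q m t - mat 1))\<^sup>2 \<le> real (card {3..<i}) * (\<Sum>m\<in>{3..<i}. (norm (Q m t - mat 1))\<^sup>2)"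
        using sum_squared_le_sum_of_squares[of "\<lambda>m. norm (Q m t - mat 1)" "{3..<i}"] by (simp add: mult.commute)
      also have "\<dots> \<le> real (card {3..<i}) * (\<Sum>m\<in>{3..<i}. - \<Phi>' m t)"
      proof (intro mult_left_mono sum_mono)
        fix m assume m: "m \<in> {3..<i}"
        have "\<Phi>' m t \<le> - ((norm (Q m t - mat 1))\<^sup>2 + (norm (w m t))\<^sup>2)" using \<Phi> T t m by blast
        then show "(norm (Q m t - mat 1))\<^sup>2 \<le> - \<Phi>' m t" using zero_le_power2[of "norm (w m t)"] by linarith
      qed simp
      finally have "C\<^sup>2 * (\<Sum>m\<in>{3..<i}. norm (Q m t - mat 1))\<^sup>2 \<le> C\<^sup>2 * (real (card {3..<i}) * (\<Sum>m\<in>{3..<i}. - \<Phi>' m t))"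
        by (rule mult_left_mono) simp
      then show "?\<eta>\<^sup>2 \<le> - (D * (\<Sum>j\<in>{3..<i}. \<Phi>' j t))"
        by (simp add: D_def power_mult_distrib sum_negf mult.assoc)
    qed
  qed
qed

end


section \<open>Dependence of the cascade on its initial state\<close>

text \<open>Uniform convergence of the derivatives on bounded intervals suffices, since differentiability at
  \<open>t\<close> is local.\<close>

lemma has_vector_derivative_limit:
  fixes f f' :: "nat \<Rightarrow> real \<Rightarrow> 'a::banach"
  assumes d: "\<And>n t. a \<le> t \<Longrightarrow> (f n has_vector_derivative f' n t) (at t within {a..})"
    and unif: "\<And>e b. 0 < e \<Longrightarrow> \<forall>\<^sub>F n in sequentially. \<forall>t\<in>{a..b}. norm (f' n t - g' t) \<le> e"
    and lim: "\<And>t. a \<le> t \<Longrightarrow> (\<lambda>n. f n t) \<longlonglongrightarrow> g t"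
    and t: "a \<le> t"
  shows "(g has_vector_derivative g' t) (at t within {a..})"
proof -
  let ?S = "{a..t+1}"
  have "\<exists>h. \<forall>x\<in>?S. (\<lambda>n. f n x) \<longlonglongrightarrow> h x \<and> (h has_derivative (\<lambda>s. s *\<^sub>R g' x)) (at x within ?S)"
  proof (rule has_derivative_sequence[where l = "g t" and f' = "\<lambda>n x s. s *\<^sub>R f' n x"])
    show "convex ?S" by (rule convex_real_interval)
    show "(f n has_derivative (\<lambda>s. s *\<^sub>R f' n x)) (at x within ?S)" if "x \<in> ?S" for n x
      using has_vector_derivative_within_subset[OF d[of x n], of ?S] that
      by (simp add: has_vector_derivative_def)
    show "\<forall>\<^sub>F n in sequentially. \<forall>x\<in>?S. \<forall>h. norm (h *\<^sub>R f' n x - h *\<^sub>R g' x) \<le> e * norm h"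
      if e: "0 < e" for e
      using unif[OF e, of "t+1"]
    proof eventually_elim
      case (elim n)
      show ?case
      proof (intro ballI allI)
        fix x h assume "x \<in> ?S"
        then have "norm (f' n x - g' x) \<le> e" using elim by blast
        then have "\<bar>h\<bar> * norm (f' n x - g' x) \<le> \<bar>h\<bar> * e" by (rule mult_left_mono) simp
        then show "norm (h *\<^sub>R f' n x - h *\<^sub>R g' x) \<le> e * norm h"
          by (simp add: scaleR_diff_right[symmetric] mult.commute)
      qed
    qed
    show "t \<in> ?S" using t by simp
    show "(\<lambda>n. f n t) \<longlonglongrightarrow> g t" by (rule lim[OF t])
  qed
  then obtain h where h: "\<And>x. x \<in> ?S \<Longrightarrow> (\<lambda>n. f n x) \<longlonglongrightarrow> h x"
    "\<And>x. x \<in> ?S \<Longrightarrow> (h has_derivative (\<lambda>s. s *\<^sub>R g' x)) (at x within ?S)" by blast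
  have hg: "h x = g x" if "x \<in> ?S" for x
    using LIMSEQ_unique[OF h(1)[OF that] lim] that by simp
  have "(h has_vector_derivative g' t) (at t within ?S)"
    using h(2)[of t] t by (simp add: has_vector_derivative_def)
  then have "(g has_vector_derivative g' t) (at t within ?S)"
    by (rule has_vector_derivative_transform[rotated 2]) (use t hg in auto)
  moreover have "at t within ?S = at t within {a..}"
    by (rule at_within_nhd[of _ "{..<t+1}"]) auto
  ultimately show ?thesis by simp
qed

definition gap :: "nat \<Rightarrow> (nat \<Rightarrow> real^3^3) \<Rightarrow> (nat \<Rightarrow> real^3) \<Rightarrow> (nat \<Rightarrow> real^3^3) \<Rightarrow> (nat \<Rightarrow> real^3) \<Rightarrow> real" where
  "gap k Q w Q' w' = (\<Sum>j\<in>{3..k}. norm (Q j - Q' j) + norm (w j - w' j))"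

text \<open>The square of an equivalent distance; its derivative along two solutions exists everywhere.\<close>

definition sqdist :: "nat \<Rightarrow> (nat \<Rightarrow> real^3^3) \<Rightarrow> (nat \<Rightarrow> real^3) \<Rightarrow> (nat \<Rightarrow> real^3^3) \<Rightarrow> (nat \<Rightarrow> real^3) \<Rightarrow> real" where
  "sqdist k Q w Q' w' = (\<Sum>j\<in>{3..k}. (Q j - Q' j) \<bullet> (Q j - Q' j) + (w j - w' j) \<bullet> (w j - w' j))"

abbreviation sqdist_at :: "nat \<Rightarrow> real \<Rightarrow> (nat \<Rightarrow> real \<Rightarrow> real^3^3) \<Rightarrow> (nat \<Rightarrow> real \<Rightarrow> real^3) \<Rightarrow>
    (nat \<Rightarrow> real \<Rightarrow> real^3^3) \<Rightarrow> (nat \<Rightarrow> real \<Rightarrow> real^3) \<Rightarrow> real" where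
  "sqdist_at k t Q w Q' w' \<equiv> sqdist k (\<lambda>j. Q j t) (\<lambda>j. w j t) (\<lambda>j. Q' j t) (\<lambda>j. w' j t)"

lemma sqdist_nonneg: "0 \<le> sqdist k Q w Q' w'"
  by (simp add: sqdist_def sum_nonneg)

lemma gap_nonneg: "0 \<le> gap k Q w Q' w'"
  by (simp add: gap_def sum_nonneg)

lemma norm_le_gap:
  assumes "j \<in> {3..k}"
  shows "norm (Q j - Q' j) \<le> gap k Q w Q' w'" "norm (w j - w' j) \<le> gap k Q w Q' w'"
proof -
  have "norm (Q j - Q' j) + norm (w j - w' j) \<le> gap k Q w Q' w'"
    unfolding gap_def by (rule member_le_sum[OF assms, of "\<lambda>j. norm (Q j - Q' j) + norm (w j - w' j)"]) auto
  then show "norm (Q j - Q' j) \<le> gap k Q w Q' w'" "norm (w j - w' j) \<le> gap k Q w Q' w'"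
    using norm_ge_zero[of "w j - w' j"] norm_ge_zero[of "Q j - Q' j"] by linarith+
qed

lemma norm_le_sqdist:
  assumes "j \<in> {3..k}"
  shows "(norm (Q j - Q' j))\<^sup>2 \<le> sqdist k Q w Q' w'" "(norm (w j - w' j))\<^sup>2 \<le> sqdist k Q w Q' w'"
proof -
  have "(Q j - Q' j) \<bullet> (Q j - Q' j) + (w j - w' j) \<bullet> (w j - w' j) \<le> sqdist k Q w Q' w'"
    unfolding sqdist_def
    by (rule member_le_sum[OF assms, of "\<lambda>j. (Q j - Q' j) \<bullet> (Q j - Q' j) + (w j - w' j) \<bullet> (w j - w' j)"]) auto
  then show "(norm (Q j - Q' j))\<^sup>2 \<le> sqdist k Q w Q' w'" "(norm (w j - w' j))\<^sup>2 \<le> sqdist k Q w Q' w'"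
    unfolding power2_norm_eq_inner
    using inner_ge_zero[of "w j - w' j"] inner_ge_zero[of "Q j - Q' j"] by linarith+
qed

lemma gap_sq_le: "(gap k Q w Q' w')\<^sup>2 \<le> 2 * real k * sqdist k Q w Q' w'"
proof -
  have "(gap k Q w Q' w')\<^sup>2 \<le> (\<Sum>j\<in>{3..k}. (norm (Q j - Q' j) + norm (w j - w' j))\<^sup>2) * real (card {3..k})"
    unfolding gap_def by (rule sum_squared_le_sum_of_squares)
  also have "\<dots> \<le> (2 * sqdist k Q w Q' w') * real k"
  proof (rule mult_mono)
    show "(\<Sum>j\<in>{3..k}. (norm (Q j - Q' j) + norm (w j - w' j))\<^sup>2) \<le> 2 * sqdist k Q w Q' w'"
      unfolding sqdist_def sum_distrib_left
    proof (rule sum_mono)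
      fix j
      have "0 \<le> (norm (Q j - Q' j) - norm (w j - w' j))\<^sup>2" by simp
      then show "(norm (Q j - Q' j) + norm (w j - w' j))\<^sup>2
          \<le> 2 * ((Q j - Q' j) \<bullet> (Q j - Q' j) + (w j - w' j) \<bullet> (w j - w' j))"
        unfolding power2_norm_eq_inner[symmetric] power2_sum power2_diff by simp
    qed
  qed (auto simp: sqdist_nonneg)
  finally show ?thesis by (simp add: mult_ac)
qed

context twin_leader_follower
begin

abbreviation acceleration :: "nat \<Rightarrow> real \<Rightarrow> (nat \<Rightarrow> real^3^3) \<Rightarrow> (nat \<Rightarrow> real^3) \<Rightarrow> real^3" where
  "acceleration i t Q w \<equiv> weighted_directions.accel (indices G i) (gain G i) (direction G i) (damping G)
     (spin i t) (sight G i Q) (Q i) (w i)"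

abbreviation acceleration_at ::
    "nat \<Rightarrow> real \<Rightarrow> (nat \<Rightarrow> real \<Rightarrow> real^3^3) \<Rightarrow> (nat \<Rightarrow> real \<Rightarrow> real^3) \<Rightarrow> real^3" where
  "acceleration_at i t Q w \<equiv> acceleration i t (\<lambda>j. Q j t) (\<lambda>j. w j t)"

lemma error_cascadeD:
  assumes "error_cascade k t0 Q w" "k \<le> last_index G" "i \<in> {3..k}" "t0 \<le> t"
  shows "(Q i has_vector_derivative - (Q i t ** hat (w i t))) (at t within {t0..})"
    "(w i has_vector_derivative acceleration_at i t Q w) (at t within {t0..})"
proof -
  have f: "i \<in> followers G" using assms by (simp add: followers_def)
  interpret F: weighted_directions "indices G i" "gain G i" "direction G i"
    by (rule weighted_directions_follower[OF f])
  note s = F.solutionD[OF error_cascade_solution[OF assms(1,3)] assms(4)]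
  show "(Q i has_vector_derivative - (Q i t ** hat (w i t))) (at t within {t0..})" by (rule s)
  show "(w i has_vector_derivative acceleration_at i t Q w) (at t within {t0..})" by (rule s)
qed

lemma error_cascadeI:
  assumes "k \<le> last_index G"
    and "\<And>i t. i \<in> {3..k} \<Longrightarrow> t0 \<le> t \<Longrightarrow> rotation_matrix (Q i t)"
    and "\<And>i t. i \<in> {3..k} \<Longrightarrow> t0 \<le> t \<Longrightarrow>
      (Q i has_vector_derivative - (Q i t ** hat (w i t))) (at t within {t0..})"
    and "\<And>i t. i \<in> {3..k} \<Longrightarrow> t0 \<le> t \<Longrightarrow>
      (w i has_vector_derivative acceleration_at i t Q w) (at t within {t0..})"
  shows "error_cascade k t0 Q w"
  unfolding error_cascade_def
proof
  fix i assume i: "i \<in> {3..k}"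
  have f: "i \<in> followers G" using assms(1) i by (simp add: followers_def)
  interpret F: weighted_directions "indices G i" "gain G i" "direction G i"
    by (rule weighted_directions_follower[OF f])
  show "F.solution (damping G) (spin i) (\<lambda>t. sight G i (\<lambda>j. Q j t)) t0 (Q i) (w i)"
    unfolding F.solution_def using assms(2-4)[OF i] by blast
qed

text \<open>The same bound for all solutions, so that the Lipschitz constants below depend on the initial
  velocities only through their size.\<close>

lemma velocity_uniformly_bounded:
  assumes k: "k \<le> last_index G"
  shows "\<exists>M. \<forall>t0 Q w. error_cascade k t0 Q w \<longrightarrow>
    (\<forall>i\<in>{3..k}. \<forall>t\<ge>t0. (norm (w i t))\<^sup>2 \<le> (norm (w i t0))\<^sup>2 + M)"
proof -
  have "\<exists>M\<ge>0. \<forall>t0 Q w. error_cascade k t0 Q w \<longrightarrow> (\<forall>t\<ge>t0. (norm (w i t))\<^sup>2 \<le> (norm (w i t0))\<^sup>2 + M)"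
    if i: "i \<in> {3..k}" for i
  proof -
    have f: "i \<in> followers G" using i k by (simp add: followers_def)
    interpret F: weighted_directions "indices G i" "gain G i" "direction G i"
      by (rule weighted_directions_follower[OF f])
    let ?G = "1 + inverse (norm (nbr_cross G i))"
    have "(norm (w i t))\<^sup>2 \<le> (norm (w i t0))\<^sup>2 + ((2 * ?G * F.torque_bound / damping G)\<^sup>2 + 1)"
      if cas: "error_cascade k t0 Q w" and t: "t0 \<le> t" for t0 Q w t
    proof -
      have "norm (sight G i (\<lambda>j. Q j s) a) \<le> ?G" if "t0 \<le> s" "a \<in> indices G i" for s a
        by (rule norm_sight_le[OF f _ that(2)]) (use error_cascade_rotation[OF cas k _ that(1)] i in auto)
      from F.velocity_bounded[OF error_cascade_solution[OF cas i] damping_pos _ this t]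
      show ?thesis by simp
    qed
    then show ?thesis by (intro exI[of _ "(2 * ?G * F.torque_bound / damping G)\<^sup>2 + 1"]) auto
  qed
  then obtain M where M: "\<And>i. i \<in> {3..k} \<Longrightarrow> 0 \<le> M i" and M2: "\<And>i t0 Q w t. i \<in> {3..k} \<Longrightarrow> error_cascade k t0 Q w \<Longrightarrow>
    t0 \<le> t \<Longrightarrow> (norm (w i t))\<^sup>2 \<le> (norm (w i t0))\<^sup>2 + M i" by metis
  have "(norm (w i t))\<^sup>2 \<le> (norm (w i t0))\<^sup>2 + (\<Sum>i\<in>{3..k}. M i)"
    if "error_cascade k t0 Q w" "i \<in> {3..k}" "t0 \<le> t" for t0 Q w i t
    using M2[OF that(2,1,3)] member_le_sum[OF that(2), of M] M by fastforce
  then show ?thesis by blast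
qed

text \<open>The right-hand side is polynomial in attitudes and velocities, and attitudes are bounded. Only
  the velocity of one of the two states enters through a product with an attitude difference.\<close>

lemma rates_lipschitz_single:
  assumes k: "k \<le> last_index G" and i: "i \<in> {3..k}" and V: "0 \<le> V"
  shows "\<exists>C\<ge>0. \<forall>t Q w Q' w'. 0 \<le> t \<longrightarrow>
    (\<forall>j\<in>{3..k}. rotation_matrix (Q j) \<and> rotation_matrix (Q' j) \<and> norm (w j) \<le> V) \<longrightarrow>
    norm (Q i ** hat (w i) - Q' i ** hat (w' i)) \<le> C * gap k Q w Q' w' \<and>
    norm (acceleration i t Q w - acceleration i t Q' w') \<le> C * gap k Q w Q' w'"
proof -
  have f: "i \<in> followers G" using i k by (simp add: followers_def)
  interpret F: weighted_directions "indices G i" "gain G i" "direction G i"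
    by (rule weighted_directions_follower[OF f])
  obtain B where B: "0 \<le> B" "\<forall>i\<in>{3..k}. \<forall>t\<ge>0. norm (spin i t) \<le> B"
    using spin_bounded[OF k] by blast
  define g where "g = 1 + inverse (norm (nbr_cross G i))"
  define s where "s = 1 + 2 * inverse (norm (nbr_cross G i))"
  have gs: "0 \<le> g" "0 \<le> s" by (simp_all add: g_def s_def)
  define C1 where "C1 = 2 * V + 2"
  define C2 where "C2 = B + damping G + g * F.torque_bound + 2 * s * F.torque_bound"
  have C: "0 \<le> C1" "0 \<le> C2"
    using V B gs F.torque_bound_nonneg damping_pos by (auto simp: C1_def C2_def)
  have "norm (Q i ** hat (w i) - Q' i ** hat (w' i)) \<le> (C1 + C2) * gap k Q w Q' w' \<and>
    norm (acceleration i t Q w - acceleration i t Q' w') \<le> (C1 + C2) * gap k Q w Q' w'"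
    if t: "0 \<le> t" and ok: "\<forall>j\<in>{3..k}. rotation_matrix (Q j) \<and> rotation_matrix (Q' j) \<and> norm (w j) \<le> V"
    for t Q w Q' w'
  proof
    let ?g = "gap k Q w Q' w'"
    let ?D = "Q i - Q' i"
    let ?d = "w i - w' i"
    note g0 = gap_nonneg[of k Q w Q' w']
    have Dg: "norm ?D \<le> ?g" and dg: "norm ?d \<le> ?g" using norm_le_gap[OF i] by blast+
    have roti: "rotation_matrix (Q i)" "rotation_matrix (Q' i)" and wV: "norm (w i) \<le> V" using ok i by auto
    have mono: "C1 * ?g \<le> (C1 + C2) * ?g" "C2 * ?g \<le> (C1 + C2) * ?g"
      using C g0 by (auto intro!: mult_right_mono)
    have eq: "Q i ** hat (w i) - Q' i ** hat (w' i) = ?D ** hat (w i) + Q' i ** hat ?d"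
      by (simp add: linear_diff[OF linear_hat] matrix_mult_diff)
    have "norm (?D ** hat (w i)) \<le> ?g * (2 * V)"
      by (rule order_trans[OF norm_matrix_mult_le], rule mult_mono)
        (use Dg g0 norm_hat_le[of "w i"] wV in auto)
    moreover have "norm (Q' i ** hat ?d) \<le> 2 * ?g"
      using norm_hat_le[of ?d] dg by (simp add: norm_mult_rotation_left[OF roti(2)])
    ultimately have "norm (Q i ** hat (w i) - Q' i ** hat (w' i)) \<le> C1 * ?g"
      unfolding eq using norm_triangle_ineq[of "?D ** hat (w i)" "Q' i ** hat ?d"]
      by (simp add: C1_def algebra_simps)
    then show "norm (Q i ** hat (w i) - Q' i ** hat (w' i)) \<le> (C1 + C2) * ?g" using mono by linarith
    have rotm: "rotation_matrix (Q m)" "rotation_matrix (Q' m)" if "m \<in> {3..<i}" for m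
      using ok that i by auto
    have S: "(\<Sum>m\<in>{3..<i}. norm (Q m - Q' m)) \<le> ?g"
    proof -
      have "(\<Sum>m\<in>{3..<i}. norm (Q m - Q' m)) \<le> (\<Sum>m\<in>{3..k}. norm (Q m - Q' m))"
        by (rule sum_mono2) (use i in auto)
      also have "\<dots> \<le> ?g" unfolding gap_def by (rule sum_mono) simp
      finally show ?thesis .
    qed
    have eq2: "acceleration i t Q w - acceleration i t Q' w' = spin i t \<times> ?d - damping G *\<^sub>R ?d
        + F.torque (sight G i Q) ?D + F.torque (\<lambda>a. sight G i Q a - sight G i Q' a) (Q' i)"
      by (simp add: F.accel_def F.torque_diff_directions linear_diff[OF F.linear_torque]
          Cross3.right_diff_distrib scaleR_diff_right)
    have n1: "norm (spin i t \<times> ?d) \<le> B * ?g"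
      by (rule order_trans[OF norm_cross_le], rule mult_mono) (use B i t dg in auto)
    have n2: "norm (damping G *\<^sub>R ?d) \<le> damping G * ?g"
      using dg damping_pos by (simp add: abs_of_pos)
    have n3: "norm (F.torque (sight G i Q) ?D) \<le> g * F.torque_bound * ?g"
    proof -
      have "norm (F.torque (sight G i Q) ?D) \<le> g * F.torque_bound * norm ?D"
        unfolding g_def by (rule F.norm_torque_le) (rule norm_sight_le[OF f rotm(1)])
      also have "\<dots> \<le> g * F.torque_bound * ?g"
        using Dg gs F.torque_bound_nonneg by (intro mult_left_mono) auto
      finally show ?thesis .
    qed
    have n4: "norm (F.torque (\<lambda>a. sight G i Q a - sight G i Q' a) (Q' i)) \<le> 2 * (s * ?g) * F.torque_bound"
    proof (rule F.norm_torque_rotation_le[OF roti(2)])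
      show "0 \<le> s * ?g" using gs g0 by simp
      fix a assume a: "a \<in> indices G i"
      have "norm (sight G i Q a - sight G i Q' a) \<le> s * (\<Sum>m\<in>{3..<i}. norm (Q m - Q' m))"
        unfolding s_def by (rule sight_lipschitz[OF f rotm a])
      also have "\<dots> \<le> s * ?g" using S gs by (intro mult_left_mono) auto
      finally show "norm (sight G i Q a - sight G i Q' a) \<le> s * ?g" .
    qed
    have tri: "norm (a - b + c + d) \<le> norm a + norm b + norm c + norm d" for a b c d :: "real^3"
      using norm_triangle_ineq[of "a - b + c" d] norm_triangle_ineq[of "a - b" c] norm_triangle_ineq4[of a b]
      by linarith
    have "norm (acceleration i t Q w - acceleration i t Q' w')
        \<le> B * ?g + damping G * ?g + g * F.torque_bound * ?g + 2 * (s * ?g) * F.torque_bound"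
      unfolding eq2 using tri[of "spin i t \<times> ?d" "damping G *\<^sub>R ?d" "F.torque (sight G i Q) ?D"
          "F.torque (\<lambda>a. sight G i Q a - sight G i Q' a) (Q' i)"] n1 n2 n3 n4 by linarith
    also have "\<dots> = C2 * ?g" by (simp add: C2_def algebra_simps)
    finally show "norm (acceleration i t Q w - acceleration i t Q' w') \<le> (C1 + C2) * ?g" using mono by linarith
  qed
  then show ?thesis using C by (intro exI[of _ "C1 + C2"] conjI allI impI) auto
qed

lemma rates_lipschitz:
  assumes k: "k \<le> last_index G" and V: "0 \<le> V"
  shows "\<exists>C\<ge>0. \<forall>i t Q w Q' w'. i \<in> {3..k} \<longrightarrow> 0 \<le> t \<longrightarrow>
    (\<forall>j\<in>{3..k}. rotation_matrix (Q j) \<and> rotation_matrix (Q' j) \<and> norm (w j) \<le> V) \<longrightarrow>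
    norm (Q i ** hat (w i) - Q' i ** hat (w' i)) \<le> C * gap k Q w Q' w' \<and>
    norm (acceleration i t Q w - acceleration i t Q' w') \<le> C * gap k Q w Q' w'"
proof -
  define ok where "ok i C \<longleftrightarrow> (\<forall>t Q w Q' w'. 0 \<le> t \<longrightarrow>
    (\<forall>j\<in>{3..k}. rotation_matrix (Q j) \<and> rotation_matrix (Q' j) \<and> norm (w j) \<le> V) \<longrightarrow>
    norm (Q i ** hat (w i) - Q' i ** hat (w' i)) \<le> C * gap k Q w Q' w' \<and>
    norm (acceleration i t Q w - acceleration i t Q' w') \<le> C * gap k Q w Q' w')" for i C
  have "\<forall>i\<in>{3..k}. \<exists>C\<ge>0. ok i C"
    unfolding ok_def using rates_lipschitz_single[OF k _ V] by blast
  from bchoice[OF this] obtain C where C: "\<forall>i\<in>{3..k}. 0 \<le> C i \<and> ok i (C i)" by blast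
  have mono: "ok i c'" if "ok i c" "c \<le> c'" for i c c'
  proof -
    have "c * gap k Q w Q' w' \<le> c' * gap k Q w Q' w'" for Q w Q' w'
      using that(2) gap_nonneg by (rule mult_right_mono)
    then show ?thesis using that(1) unfolding ok_def by (meson order_trans)
  qed
  have "ok i (\<Sum>i\<in>{3..k}. C i)" if i: "i \<in> {3..k}" for i
    by (rule mono[of i "C i"]) (use C i member_le_sum[OF i, of C] in auto)
  then show ?thesis
    unfolding ok_def using C by (intro exI[of _ "\<Sum>i\<in>{3..k}. C i"] conjI) (auto intro!: sum_nonneg)
qed

lemma cascade_gronwall:
  assumes k: "k \<le> last_index G" and t0: "0 \<le> t0" and V: "0 \<le> V"
  shows "\<exists>C\<ge>0. \<forall>Q w Q' w'. error_cascade k t0 Q w \<longrightarrow> error_cascade k t0 Q' w' \<longrightarrow>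
    (\<forall>i\<in>{3..k}. \<forall>t\<ge>t0. norm (w i t) \<le> V) \<longrightarrow>
    (\<forall>s\<ge>t0. \<forall>t\<ge>s. sqdist_at k t Q w Q' w'
        \<le> sqdist_at k s Q w Q' w' * exp (C * (t - s)) \<and>
      sqdist_at k s Q w Q' w'
        \<le> sqdist_at k t Q w Q' w' * exp (C * (t - s)))"
proof -
  obtain C where C: "0 \<le> C" and lip: "\<And>i t Q w Q' w'. i \<in> {3..k} \<Longrightarrow> 0 \<le> t \<Longrightarrow>
    \<forall>j\<in>{3..k}. rotation_matrix (Q j) \<and> rotation_matrix (Q' j) \<and> norm (w j) \<le> V \<Longrightarrow>
    norm (Q i ** hat (w i) - Q' i ** hat (w' i)) \<le> C * gap k Q w Q' w' \<and>
    norm (acceleration i t Q w - acceleration i t Q' w') \<le> C * gap k Q w Q' w'"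
    using rates_lipschitz[OF k V] by blast
  (* C comes from the rates, 2 * k from comparing the squared sum of the distances with sqdist. *)
  let ?C = "2 * C * (2 * real k)"
  have main: "sqdist_at k t Q w Q' w'
        \<le> sqdist_at k s Q w Q' w' * exp (?C * (t - s)) \<and>
      sqdist_at k s Q w Q' w'
        \<le> sqdist_at k t Q w Q' w' * exp (?C * (t - s))"
    if cas: "error_cascade k t0 Q w" and cas': "error_cascade k t0 Q' w'"
      and wV: "\<forall>i\<in>{3..k}. \<forall>t\<ge>t0. norm (w i t) \<le> V" and st: "t0 \<le> s" "s \<le> t"
    for Q w Q' w' s t
  proof -
    define N where "N t = sqdist_at k t Q w Q' w'" for t
    define p where "p i t = - (Q i t ** hat (w i t)) - - (Q' i t ** hat (w' i t))" for i t
    define q where "q i t = acceleration_at i t Q w - acceleration_at i t Q' w'" for i t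
    define N' where "N' t = (\<Sum>i\<in>{3..k}. 2 * ((Q i t - Q' i t) \<bullet> p i t) + 2 * ((w i t - w' i t) \<bullet> q i t))" for t
    have dN: "(N has_real_derivative N' t) (at t within {t0..})" if t: "t0 \<le> t" for t
      unfolding N_def sqdist_def N'_def
    proof (intro DERIV_sum)
      fix i assume i: "i \<in> {3..k}"
      note d1 = has_vector_derivative_diff[OF error_cascadeD(1)[OF cas k i t] error_cascadeD(1)[OF cas' k i t], folded p_def]
      note d2 = has_vector_derivative_diff[OF error_cascadeD(2)[OF cas k i t] error_cascadeD(2)[OF cas' k i t], folded q_def]
      show "((\<lambda>t. (Q i t - Q' i t) \<bullet> (Q i t - Q' i t) + (w i t - w' i t) \<bullet> (w i t - w' i t)) has_real_derivative
          2 * ((Q i t - Q' i t) \<bullet> p i t) + 2 * ((w i t - w' i t) \<bullet> q i t)) (at t within {t0..})"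
        unfolding has_real_derivative_iff_has_vector_derivative
        by (rule has_vector_derivative_eq_rhs[OF has_vector_derivative_add[OF
                has_vector_derivative_inner[OF d1 d1]
                has_vector_derivative_inner[OF d2 d2]]])
          (simp add: inner_commute)
    qed
    have bN: "\<bar>N' t\<bar> \<le> ?C * N t" if t: "t0 \<le> t" for t
    proof -
      let ?g = "gap k (\<lambda>j. Q j t) (\<lambda>j. w j t) (\<lambda>j. Q' j t) (\<lambda>j. w' j t)"
      have pq: "norm (p i t) \<le> C * ?g" "norm (q i t) \<le> C * ?g" if i: "i \<in> {3..k}" for i
      proof -
        have *: "\<forall>j\<in>{3..k}. rotation_matrix (Q j t) \<and> rotation_matrix (Q' j t) \<and> norm (w j t) \<le> V"
          using error_cascade_rotation[OF cas k _ t] error_cascade_rotation[OF cas' k _ t] wV t by auto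
        have L: "norm (Q i t ** hat (w i t) - Q' i t ** hat (w' i t)) \<le> C * ?g \<and> norm (q i t) \<le> C * ?g"
          unfolding q_def by (rule lip[OF i _ *]) (use t t0 in simp)
        then show "norm (q i t) \<le> C * ?g" by simp
        have "p i t = - (Q i t ** hat (w i t) - Q' i t ** hat (w' i t))" by (simp add: p_def)
        then have "norm (p i t) = norm (Q i t ** hat (w i t) - Q' i t ** hat (w' i t))" by (simp only: norm_minus_cancel)
        then show "norm (p i t) \<le> C * ?g" using L by simp
      qed
      have "\<bar>N' t\<bar> \<le> (\<Sum>i\<in>{3..k}. \<bar>2 * ((Q i t - Q' i t) \<bullet> p i t) + 2 * ((w i t - w' i t) \<bullet> q i t)\<bar>)"
        unfolding N'_def by (rule sum_abs)
      also have "\<dots> \<le> (\<Sum>i\<in>{3..k}. 2 * (C * ?g) * (norm (Q i t - Q' i t) + norm (w i t - w' i t)))"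
      proof (rule sum_mono)
        fix i assume i: "i \<in> {3..k}"
        have 1: "\<bar>(Q i t - Q' i t) \<bullet> p i t\<bar> \<le> norm (Q i t - Q' i t) * (C * ?g)"
          by (rule order_trans[OF Cauchy_Schwarz_ineq2 mult_left_mono[OF pq(1)[OF i]]]) simp
        have 2: "\<bar>(w i t - w' i t) \<bullet> q i t\<bar> \<le> norm (w i t - w' i t) * (C * ?g)"
          by (rule order_trans[OF Cauchy_Schwarz_ineq2 mult_left_mono[OF pq(2)[OF i]]]) simp
        have 3: "\<bar>2 * x + 2 * y\<bar> \<le> 2 * c * (a + b)" if "\<bar>x\<bar> \<le> a * c" "\<bar>y\<bar> \<le> b * c"
          for x y a b c :: real
          using that by (auto simp: abs_le_iff algebra_simps)
        show "\<bar>2 * ((Q i t - Q' i t) \<bullet> p i t) + 2 * ((w i t - w' i t) \<bullet> q i t)\<bar>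
            \<le> 2 * (C * ?g) * (norm (Q i t - Q' i t) + norm (w i t - w' i t))"
          by (rule 3[OF 1 2])
      qed
      also have "\<dots> = 2 * C * ?g\<^sup>2" by (simp add: gap_def sum_distrib_left[symmetric] power2_eq_square)
      also have "\<dots> \<le> 2 * C * (2 * real k * N t)"
        unfolding N_def using C by (intro mult_left_mono gap_sq_le) auto
      finally show ?thesis by simp
    qed
    show ?thesis
      using gronwall_two_sided[OF dN bN st] unfolding N_def by blast
  qed
  then show ?thesis using C by (intro exI[of _ ?C] conjI allI impI) auto
qed

end


lemma sqdist_triangle:
  "sqdist k Q w Q'' w'' \<le> 2 * sqdist k Q w Q' w' + 2 * sqdist k Q'' w'' Q' w'"
proof -
  have *: "(x - z) \<bullet> (x - z) \<le> 2 * ((x - y) \<bullet> (x - y)) + 2 * ((z - y) \<bullet> (z - y))" for x y z :: "'a::real_inner"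
  proof -
    have "0 \<le> ((x - y) + (z - y)) \<bullet> ((x - y) + (z - y))" by (rule inner_ge_zero)
    moreover have "(x - z) = (x - y) - (z - y)" by simp
    ultimately show ?thesis by (simp add: inner_add_left inner_add_right inner_diff_left inner_diff_right inner_commute)
  qed
  have "sqdist k Q w Q'' w'' \<le> (\<Sum>j\<in>{3..k}. (2 * ((Q j - Q' j) \<bullet> (Q j - Q' j)) + 2 * ((Q'' j - Q' j) \<bullet> (Q'' j - Q' j)))
      + (2 * ((w j - w' j) \<bullet> (w j - w' j)) + 2 * ((w'' j - w' j) \<bullet> (w'' j - w' j))))"
    unfolding sqdist_def by (intro sum_mono add_mono *)
  also have "\<dots> = 2 * sqdist k Q w Q' w' + 2 * sqdist k Q'' w'' Q' w'"
    by (simp add: sqdist_def sum.distrib sum_distrib_left)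
  finally show ?thesis .
qed

context twin_leader_follower
begin

text \<open>By Gronwall's inequality the solutions form a Cauchy sequence, uniformly on bounded time
  intervals, and by the Lipschitz estimate so do their derivatives.\<close>

lemma error_cascade_limit:
  assumes k: "k \<le> last_index G" and t0: "0 \<le> t0"
    and cas: "\<And>n. error_cascade k t0 (Qs n) (ws n)"
    and q: "\<And>i. i \<in> {3..k} \<Longrightarrow> (\<lambda>n. Qs n i t0) \<longlonglongrightarrow> q i"
    and v: "\<And>i. i \<in> {3..k} \<Longrightarrow> (\<lambda>n. ws n i t0) \<longlonglongrightarrow> v i"
  shows "\<exists>Q w. error_cascade k t0 Q w \<and>
    (\<forall>i\<in>{3..k}. \<forall>t\<ge>t0. (\<lambda>n. Qs n i t) \<longlonglongrightarrow> Q i t \<and> (\<lambda>n. ws n i t) \<longlonglongrightarrow> w i t)"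
proof -
  obtain M where M: "\<And>Q w i t. error_cascade k t0 Q w \<Longrightarrow> i \<in> {3..k} \<Longrightarrow> t0 \<le> t \<Longrightarrow>
      (norm (w i t))\<^sup>2 \<le> (norm (w i t0))\<^sup>2 + M"
    using velocity_uniformly_bounded[OF k] by blast
  have "\<forall>i\<in>{3..k}. \<exists>r. \<forall>n. norm (ws n i t0) \<le> r"
    using convergent_imp_Bseq[OF convergentI[OF v]] unfolding Bseq_def by blast
  from bchoice[OF this] obtain r where r: "\<forall>i\<in>{3..k}. \<forall>n. norm (ws n i t0) \<le> r i" by blast
  define V where "V = sqrt ((\<Sum>i\<in>{3..k}. (r i)\<^sup>2) + \<bar>M\<bar>)"
  have V0: "0 \<le> V" by (simp add: V_def sum_nonneg)
  have wV: "norm (ws n i t) \<le> V" if i: "i \<in> {3..k}" and t: "t0 \<le> t" for n i t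
  proof -
    have "(norm (ws n i t))\<^sup>2 \<le> (norm (ws n i t0))\<^sup>2 + M" by (rule M[OF cas i t])
    also have "\<dots> \<le> (r i)\<^sup>2 + \<bar>M\<bar>" using r i by (intro add_mono power_mono) auto
    also have "\<dots> \<le> (\<Sum>i\<in>{3..k}. (r i)\<^sup>2) + \<bar>M\<bar>"
      using member_le_sum[OF i, of "\<lambda>i. (r i)\<^sup>2"] by simp
    finally show ?thesis unfolding V_def by (rule real_le_rsqrt)
  qed
  obtain C where C: "0 \<le> C" and gron: "\<And>Q w Q' w' t. error_cascade k t0 Q w \<Longrightarrow> error_cascade k t0 Q' w' \<Longrightarrow>
    \<forall>i\<in>{3..k}. \<forall>t\<ge>t0. norm (w i t) \<le> V \<Longrightarrow> t0 \<le> t \<Longrightarrow>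
    sqdist_at k t Q w Q' w'
        \<le> sqdist_at k t0 Q w Q' w' * exp (C * (t - t0))"
    using cascade_gronwall[OF k t0 V0] by blast
  define a where "a n = sqdist k (\<lambda>j. Qs n j t0) (\<lambda>j. ws n j t0) q v" for n
  have a0: "0 \<le> a n" for n by (simp add: a_def sqdist_nonneg)
  have alim: "a \<longlonglongrightarrow> 0"
  proof -
    have "a \<longlonglongrightarrow> (\<Sum>j\<in>{3..k}. (q j - q j) \<bullet> (q j - q j) + (v j - v j) \<bullet> (v j - v j))"
      unfolding a_def sqdist_def by (intro tendsto_intros q v)
    then show ?thesis by simp
  qed
  define E where "E t = exp (C * (t - t0))" for t
  have E0: "0 < E t" for t by (simp add: E_def)
  have dist: "sqdist_at k t (Qs n) (ws n) (Qs m) (ws m) \<le> (2 * a n + 2 * a m) * E t"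
    if t: "t0 \<le> t" for n m t
  proof -
    have "sqdist_at k t (Qs n) (ws n) (Qs m) (ws m)
        \<le> sqdist_at k t0 (Qs n) (ws n) (Qs m) (ws m) * E t"
      unfolding E_def by (rule gron[OF cas cas _ t]) (use wV in blast)
    also have "\<dots> \<le> (2 * a n + 2 * a m) * E t"
      unfolding a_def by (rule mult_right_mono[OF sqdist_triangle]) (use E0[of t] in simp)
    finally show ?thesis .
  qed
  have cauchy: "\<exists>x. X \<longlonglongrightarrow> x \<and> (\<forall>n. (norm (X n - x))\<^sup>2 \<le> 2 * a n * E t)"
    if X: "\<And>n m. (norm (X n - X m))\<^sup>2 \<le> (2 * a n + 2 * a m) * E t" for X :: "nat \<Rightarrow> 'b::banach" and t
  proof -
    have "Cauchy X"
    proof (rule CauchyI)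
      fix e :: real assume e: "0 < e"
      then have "0 < e\<^sup>2 / (4 * E t)" using E0[of t] by simp
      from LIMSEQ_D[OF alim this] obtain N where N: "\<And>n. N \<le> n \<Longrightarrow> a n < e\<^sup>2 / (4 * E t)"
        using a0 by auto
      have "norm (X m - X n) < e" if "N \<le> m" "N \<le> n" for m n
      proof (rule power_less_imp_less_base)
        have "(2 * a m + 2 * a n) * E t < (4 * (e\<^sup>2 / (4 * E t))) * E t"
          using N[OF that(1)] N[OF that(2)] E0[of t] by (intro mult_strict_right_mono) auto
        also have "\<dots> = e\<^sup>2" using E0[of t] by simp
        finally show "(norm (X m - X n))\<^sup>2 < e\<^sup>2" using X[of m n] by simp
      qed (use e in simp)
      then show "\<exists>M. \<forall>m\<ge>M. \<forall>n\<ge>M. norm (X m - X n) < e" by blast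
    qed
    then obtain x where x: "X \<longlonglongrightarrow> x" using Cauchy_convergent_iff convergent_def by blast
    have "(norm (X n - x))\<^sup>2 \<le> 2 * a n * E t" for n
    proof (rule LIMSEQ_le)
      show "(\<lambda>m. (norm (X n - X m))\<^sup>2) \<longlonglongrightarrow> (norm (X n - x))\<^sup>2" by (intro tendsto_intros x)
      have "(\<lambda>m. (2 * a n + 2 * a m) * E t) \<longlonglongrightarrow> (2 * a n + 2 * 0) * E t" by (intro tendsto_intros alim)
      then show "(\<lambda>m. (2 * a n + 2 * a m) * E t) \<longlonglongrightarrow> 2 * a n * E t" by simp
    qed (use X in blast)
    with x show ?thesis by blast
  qed
  have "\<exists>x. (\<lambda>n. Qs n i t) \<longlonglongrightarrow> x \<and> (\<forall>n. (norm (Qs n i t - x))\<^sup>2 \<le> 2 * a n * E t)"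
    if "i \<in> {3..k}" "t0 \<le> t" for i t
    by (rule cauchy) (rule order_trans[OF norm_le_sqdist(1)[OF that(1), of "\<lambda>i. Qs _ i t"] dist[OF that(2)]])
  then have "\<forall>i t. \<exists>x. i \<in> {3..k} \<and> t0 \<le> t \<longrightarrow> (\<lambda>n. Qs n i t) \<longlonglongrightarrow> x \<and> (\<forall>n. (norm (Qs n i t - x))\<^sup>2 \<le> 2 * a n * E t)" by blast
  then obtain Q where Q: "\<And>i t. i \<in> {3..k} \<Longrightarrow> t0 \<le> t \<Longrightarrow> (\<lambda>n. Qs n i t) \<longlonglongrightarrow> Q i t"
    and Qr: "\<And>i t n. i \<in> {3..k} \<Longrightarrow> t0 \<le> t \<Longrightarrow> (norm (Qs n i t - Q i t))\<^sup>2 \<le> 2 * a n * E t"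
    by metis
  have "\<exists>x. (\<lambda>n. ws n i t) \<longlonglongrightarrow> x \<and> (\<forall>n. (norm (ws n i t - x))\<^sup>2 \<le> 2 * a n * E t)"
    if "i \<in> {3..k}" "t0 \<le> t" for i t
    by (rule cauchy) (rule order_trans[OF norm_le_sqdist(2)[OF that(1), of "\<lambda>i. ws _ i t"] dist[OF that(2)]])
  then have "\<forall>i t. \<exists>x. i \<in> {3..k} \<and> t0 \<le> t \<longrightarrow> (\<lambda>n. ws n i t) \<longlonglongrightarrow> x \<and> (\<forall>n. (norm (ws n i t - x))\<^sup>2 \<le> 2 * a n * E t)" by blast
  then obtain w where w: "\<And>i t. i \<in> {3..k} \<Longrightarrow> t0 \<le> t \<Longrightarrow> (\<lambda>n. ws n i t) \<longlonglongrightarrow> w i t"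
    and wr: "\<And>i t n. i \<in> {3..k} \<Longrightarrow> t0 \<le> t \<Longrightarrow> (norm (ws n i t - w i t))\<^sup>2 \<le> 2 * a n * E t"
    by metis
  have rot: "rotation_matrix (Q i t)" if i: "i \<in> {3..k}" and t: "t0 \<le> t" for i t
    using closed_sequentially[OF closed_rotations _ Q[OF i t]] error_cascade_rotation[OF cas k i t] by simp
  define g where "g n t = gap k (\<lambda>j. Qs n j t) (\<lambda>j. ws n j t) (\<lambda>j. Q j t) (\<lambda>j. w j t)" for n t
  (* The estimate is uniform in t, which the convergence of the derivatives needs. *)
  have gle: "g n t \<le> real (card {3..k}) * (2 * sqrt (2 * a n * E b))" if t: "t \<in> {t0..b}" for n t b
  proof -
    have EE: "2 * a n * E t \<le> 2 * a n * E b"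
      using t a0[of n] C by (intro mult_left_mono) (auto simp: E_def mult_left_mono)
    have "norm (Qs n j t - Q j t) + norm (ws n j t - w j t) \<le> 2 * sqrt (2 * a n * E b)" if j: "j \<in> {3..k}" for j
    proof -
      have "norm (Qs n j t - Q j t) \<le> sqrt (2 * a n * E b)"
        by (rule real_le_rsqrt, rule order_trans[OF Qr[OF j] EE]) (use t in simp)
      moreover have "norm (ws n j t - w j t) \<le> sqrt (2 * a n * E b)"
        by (rule real_le_rsqrt, rule order_trans[OF wr[OF j] EE]) (use t in simp)
      ultimately show ?thesis by simp
    qed
    then show ?thesis unfolding g_def gap_def by (rule sum_bounded_above)
  qed
  have gsmall: "\<forall>\<^sub>F n in sequentially. \<forall>t\<in>{t0..b}. g n t \<le> e" if e: "0 < e" for e b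
  proof -
    have "(\<lambda>n. real (card {3..k}) * (2 * sqrt (2 * a n * E b))) \<longlonglongrightarrow> real (card {3..k}) * (2 * sqrt (2 * 0 * E b))"
      by (intro tendsto_intros alim)
    then have "(\<lambda>n. real (card {3..k}) * (2 * sqrt (2 * a n * E b))) \<longlonglongrightarrow> 0" by simp
    from order_tendstoD(2)[OF this e] show ?thesis
    proof eventually_elim
      case (elim n)
      show ?case using order_trans[OF gle less_imp_le[OF elim]] by blast
    qed
  qed
  obtain L where L: "0 \<le> L" and lip: "\<And>i t Q w Q' w'. i \<in> {3..k} \<Longrightarrow> 0 \<le> t \<Longrightarrow>
    \<forall>j\<in>{3..k}. rotation_matrix (Q j) \<and> rotation_matrix (Q' j) \<and> norm (w j) \<le> V \<Longrightarrow>
    norm (Q i ** hat (w i) - Q' i ** hat (w' i)) \<le> L * gap k Q w Q' w' \<and>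
    norm (acceleration i t Q w - acceleration i t Q' w') \<le> L * gap k Q w Q' w'"
    using rates_lipschitz[OF k V0] by blast
  have rate: "norm (Qs n i t ** hat (ws n i t) - Q i t ** hat (w i t)) \<le> L * g n t \<and>
      norm (acceleration_at i t (Qs n) (ws n) - acceleration_at i t Q w) \<le> L * g n t"
    if i: "i \<in> {3..k}" and t: "t0 \<le> t" for n i t
    unfolding g_def
    by (rule lip[OF i]) (use t t0 error_cascade_rotation[OF cas k _ t] rot wV in auto)
  have Lg: "\<forall>\<^sub>F n in sequentially. \<forall>t\<in>{t0..b}. L * g n t \<le> e" if e: "0 < e" for e b
  proof -
    have "0 < e / (L + 1)" using e L by simp
    from gsmall[OF this, of b] show ?thesis
    proof eventually_elim
      case (elim n)
      show ?case
      proof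
        fix t assume "t \<in> {t0..b}"
        then have "L * g n t \<le> (L + 1) * (e / (L + 1))"
          using elim L by (intro mult_mono) (auto simp: g_def gap_nonneg)
        also have "\<dots> = e" using L by simp
        finally show "L * g n t \<le> e" .
      qed
    qed
  qed
  have "error_cascade k t0 Q w"
  proof (rule error_cascadeI[OF k rot])
    fix i t assume i: "i \<in> {3..k}" and t: "t0 \<le> t"
    show "(Q i has_vector_derivative - (Q i t ** hat (w i t))) (at t within {t0..})"
    proof (rule has_vector_derivative_limit[where f = "\<lambda>n. Qs n i" and f' = "\<lambda>n t. - (Qs n i t ** hat (ws n i t))"
          and g' = "\<lambda>t. - (Q i t ** hat (w i t))"])
      show "(Qs n i has_vector_derivative - (Qs n i t ** hat (ws n i t))) (at t within {t0..})" if "t0 \<le> t" for n t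
        by (rule error_cascadeD(1)[OF cas k i that])
      show "\<forall>\<^sub>F n in sequentially. \<forall>t\<in>{t0..b}. norm (- (Qs n i t ** hat (ws n i t)) - - (Q i t ** hat (w i t))) \<le> e"
        if "0 < e" for e b
        using Lg[OF that, of b]
      proof eventually_elim
        case (elim n)
        show ?case
        proof
          fix t assume t: "t \<in> {t0..b}"
          have "norm (- (Qs n i t ** hat (ws n i t)) - - (Q i t ** hat (w i t)))
              = norm (Qs n i t ** hat (ws n i t) - Q i t ** hat (w i t))"
            by (simp add: norm_minus_commute)
          also have "\<dots> \<le> L * g n t" using rate[OF i] t by auto
          also have "\<dots> \<le> e" using elim t by blast
          finally show "norm (- (Qs n i t ** hat (ws n i t)) - - (Q i t ** hat (w i t))) \<le> e" .
        qed
      qed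
    qed (use Q[OF i] t in auto)
    show "(w i has_vector_derivative acceleration_at i t Q w) (at t within {t0..})"
    proof (rule has_vector_derivative_limit[where f = "\<lambda>n. ws n i"
          and f' = "\<lambda>n t. acceleration_at i t (Qs n) (ws n)"
          and g' = "\<lambda>t. acceleration_at i t Q w"])
      show "(ws n i has_vector_derivative acceleration_at i t (Qs n) (ws n)) (at t within {t0..})"
        if "t0 \<le> t" for n t
        by (rule error_cascadeD(2)[OF cas k i that])
      show "\<forall>\<^sub>F n in sequentially. \<forall>t\<in>{t0..b}.
          norm (acceleration_at i t (Qs n) (ws n) - acceleration_at i t Q w) \<le> e"
        if "0 < e" for e b
        using Lg[OF that, of b]
      proof eventually_elim
        case (elim n)
        show ?case
        proof
          fix t assume t: "t \<in> {t0..b}"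
          have "norm (acceleration_at i t (Qs n) (ws n) - acceleration_at i t Q w) \<le> L * g n t"
            using rate[OF i] t by auto
          also have "\<dots> \<le> e" using elim t by blast
          finally show "norm (acceleration_at i t (Qs n) (ws n) - acceleration_at i t Q w) \<le> e" .
        qed
      qed
    qed (use w[OF i] t in auto)
  qed
  then show ?thesis using Q w by blast
qed

end


section \<open>Null sets and charts\<close>

interpretation lborel_product: product_sigma_finite "\<lambda>_. lborel"
  by standard

text \<open>Fubini's theorem; a closed set in the product topology is measurable for the product of finitely
  many Lebesgue measures.\<close>

lemma AE_PiM_insert:
  fixes B :: "(nat \<Rightarrow> 'a::euclidean_space) set"
  assumes fin: "finite I" and i: "i \<notin> I" and closed: "closed B"
    and fibre: "\<And>x. negligible {z. x(i := z) \<in> B}"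
  shows "AE y in PiM (insert i I) (\<lambda>_. lborel). y \<notin> B"
proof -
  let ?M = "PiM (insert i I) (\<lambda>_. lborel :: 'a measure)"
  have id: "(\<lambda>y. y) \<in> borel_measurable ?M"
  proof (rule measurable_coordinatewise_then_product)
    fix j
    show "(\<lambda>y. y j) \<in> borel_measurable ?M"
    proof (cases "j \<in> insert i I")
      case True
      then have "(\<lambda>y. y j) \<in> measurable ?M lborel" by (rule measurable_component_singleton)
      then show ?thesis by simp
    next
      case False
      have "(\<lambda>y :: nat \<Rightarrow> 'a. y j) \<in> borel_measurable ?M \<longleftrightarrow> (\<lambda>_ :: nat \<Rightarrow> 'a. undefined :: 'a) \<in> borel_measurable ?M"
        by (rule measurable_cong) (use False in \<open>auto simp: space_PiM PiE_def extensional_def\<close>)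
      then show ?thesis by simp
    qed
  qed
  have ind: "(\<lambda>y. indicator B y :: ennreal) \<in> borel_measurable ?M"
    using measurable_compose[OF id, of "indicator B :: _ \<Rightarrow> ennreal" borel] closed by simp
  have zero: "(\<integral>\<^sup>+z. indicator B (x(i := z)) \<partial>(lborel :: 'a measure)) = 0" for x :: "nat \<Rightarrow> 'a"
  proof -
    let ?F = "{z. x(i := z) \<in> B}"
    have "continuous_on UNIV (\<lambda>z. x(i := z))"
    proof (rule continuous_on_coordinatewise_then_product)
      show "continuous_on UNIV (\<lambda>z. (x(i := z)) j)" for j by (cases "j = i") simp_all
    qed
    then have "closed ?F" using closed_vimage[OF closed] by (simp add: vimage_def)
    then have sF: "?F \<in> sets lborel" by simp
    have "?F \<in> null_sets lborel"
      using fibre[of x] null_sets_completion_iff[OF sF] by (simp add: negligible_iff_null_sets)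
    then have "emeasure lborel ?F = 0" by auto
    moreover have "(\<lambda>z. indicator B (x(i := z)) :: ennreal) = indicator ?F"
      by (auto simp: indicator_def)
    ultimately show ?thesis using sF by (simp add: nn_integral_indicator)
  qed
  have "(\<integral>\<^sup>+y. indicator B y \<partial>?M) = 0"
    using lborel_product.product_nn_integral_insert[OF fin i ind] by (simp add: zero)
  then have "AE y in ?M. (indicator B y :: ennreal) = 0"
    using nn_integral_0_iff_AE[OF ind] by simp
  then show ?thesis by eventually_elim (auto simp: indicator_def)
qed

text \<open>A cylinder over a null set is null.\<close>

lemma AE_PiM_restrict:
  assumes fin: "finite I" and i: "i \<notin> I"
    and ae: "AE y in PiM I (\<lambda>_. lborel :: ('a::euclidean_space) measure). p y"
  shows "AE y in PiM (insert i I) (\<lambda>_. lborel :: 'a measure). p (restrict y I)"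
proof -
  let ?L = "\<lambda>_ :: 'b. lborel :: 'a measure"
  let ?M = "PiM (insert i I) ?L"
  from ae obtain N where N: "N \<in> null_sets (PiM I ?L)" "{y \<in> space (PiM I ?L). \<not> p y} \<subseteq> N"
    by (auto elim!: AE_E)
  have r: "(\<lambda>y. restrict y I) \<in> measurable ?M (PiM I ?L)"
    by (rule measurable_restrict_subset) auto
  have ind: "(\<lambda>y. indicator N (restrict y I) :: ennreal) \<in> borel_measurable ?M"
    by (rule measurable_compose[OF r]) (use N in auto)
  have "(\<integral>\<^sup>+y. indicator N (restrict y I) \<partial>?M) = (\<integral>\<^sup>+x. (\<integral>\<^sup>+z. indicator N (restrict (x(i := z)) I) \<partial>lborel) \<partial>PiM I ?L)"
    by (rule lborel_product.product_nn_integral_insert[OF fin i ind])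
  also have "\<dots> = (\<integral>\<^sup>+x. indicator N x * top \<partial>PiM I ?L)"
  proof (rule nn_integral_cong)
    fix x assume "x \<in> space (PiM I ?L)"
    then have "restrict (x(i := z)) I = x" for z
      using i by (auto simp: space_PiM restrict_def PiE_def extensional_def)
    then show "(\<integral>\<^sup>+z. indicator N (restrict (x(i := z)) I) \<partial>(lborel :: 'a measure)) = indicator N x * top"
      by simp
  qed
  also have "\<dots> = 0"
    using null_setsD1[OF N(1)] null_setsD2[OF N(1)] by (subst nn_integral_multc) simp_all
  finally have "AE y in ?M. (indicator N (restrict y I) :: ennreal) = 0"
    using nn_integral_0_iff_AE[OF ind] by simp
  moreover have "AE y in ?M. (indicator N (restrict y I) :: ennreal) = 0 \<longrightarrow> p (restrict y I)"
  proof (intro AE_I2 impI)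
    fix y assume y: "y \<in> space ?M" and "(indicator N (restrict y I) :: ennreal) = 0"
    then have "restrict y I \<notin> N" by (auto simp: indicator_def split: if_splits)
    moreover have "restrict y I \<in> space (PiM I ?L)" by (rule measurable_space[OF r y])
    ultimately show "p (restrict y I)" using N(2) by blast
  qed
  ultimately show ?thesis by (rule AE_mp)
qed

lemma negligible_if_image_negligible:
  fixes f :: "'a::euclidean_space \<Rightarrow> 'b::euclidean_space"
  assumes dim: "DIM('b) \<le> DIM('a)" and neg: "negligible (f ` X)"
    and lip: "\<And>x y. x \<in> X \<Longrightarrow> y \<in> X \<Longrightarrow> norm (x - y) \<le> L * norm (f x - f y)"
  shows "negligible X"
proof -
  have inj: "inj_on f X"
  proof (rule inj_onI)
    fix x y assume "x \<in> X" "y \<in> X" "f x = f y"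
    then show "x = y" using lip[of x y] by simp
  qed
  have "negligible (inv_into X f ` (f ` X))"
  proof (rule negligible_locally_Lipschitz_image[OF dim neg])
    fix x assume x: "x \<in> f ` X"
    have "norm (inv_into X f y - inv_into X f x) \<le> L * norm (y - x)" if "y \<in> f ` X" for y
      using lip[OF inv_into_into[OF that] inv_into_into[OF x]] f_inv_into_f[OF that] f_inv_into_f[OF x] by simp
    then show "\<exists>T B. open T \<and> x \<in> T \<and> (\<forall>y\<in>f ` X \<inter> T. norm (inv_into X f y - inv_into X f x) \<le> B * norm (y - x))"
      by (intro exI[of _ UNIV] exI[of _ L]) auto
  qed
  moreover have "inv_into X f ` (f ` X) = X" using inj by (simp add: inv_into_image_cancel)
  ultimately show ?thesis by simp
qed

text \<open>With \<open>s = 2 / (1 + |x|\<^sup>2)\<close>, the trace of \<open>cayley x\<close> is \<open>2 s - 1\<close> and the axis of its skew part is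
  \<open>2 s x\<close> in the normalisation chosen here. Both are linear in the matrix, and \<open>s\<close> is bounded below on
  bounded sets.\<close>

lemma cayley_inverse_lipschitz:
  assumes r: "0 \<le> r"
  shows "\<exists>L\<ge>0. \<forall>x y. norm x \<le> r \<longrightarrow> norm y \<le> r \<longrightarrow> norm (x - y) \<le> L * norm (cayley x - cayley y)"
proof -
  define s where "s x = 2 / (1 + (norm x)\<^sup>2)" for x :: "real^3"
  define tr where "tr X = X$1$1 + X$2$2 + X$3$3" for X :: "real^3^3"
  define vx where "vx X = (vector [X$3$2 - X$2$3, X$1$3 - X$3$1, X$2$1 - X$1$2] :: real^3)" for X :: "real^3^3"
  have pos: "0 < 1 + (norm x)\<^sup>2" for x :: "real^3" by (simp add: add_pos_nonneg)
  have s0: "0 < s x" for x using pos[of x] by (simp add: s_def)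
  have nx: "(norm x)\<^sup>2 = x$1 * x$1 + x$2 * x$2 + x$3 * x$3" for x :: "real^3"
    by (simp add: power2_norm_eq_inner inner_vec_def sum_3)
  have trc: "tr (cayley x) = 2 * s x - 1" for x
  proof -
    have "tr (cayley x) = 3 - 2 * (s x * (norm x)\<^sup>2)"
      unfolding cayley_def s_def[symmetric] tr_def
      by (simp add: nx hat_components matrix_matrix_mult_def sum_3 mat_def algebra_simps)
    moreover have "s x * (norm x)\<^sup>2 = 2 - s x" using pos[of x] by (simp add: s_def field_simps)
    ultimately show ?thesis by simp
  qed
  have vxc: "vx (cayley x) = (2 * s x) *\<^sub>R x" for x
    unfolding cayley_def s_def[symmetric] vx_def
    by (simp add: hat_components matrix_matrix_mult_def sum_3 mat_def vec_eq_iff forall_3 algebra_simps)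
  have "linear tr" unfolding tr_def by (rule linearI) (simp_all add: algebra_simps)
  then obtain Kt where Kt: "0 < Kt" "\<And>X. norm (tr X) \<le> norm X * Kt"
    using bounded_linear.pos_bounded linear_conv_bounded_linear by blast
  have "linear vx" unfolding vx_def by (rule linearI) (simp_all add: vec_eq_iff forall_3 algebra_simps)
  then obtain Kv where Kv: "0 < Kv" "\<And>X. norm (vx X) \<le> norm X * Kv"
    using bounded_linear.pos_bounded linear_conv_bounded_linear by blast
  define L where "L = (Kv + r * Kt) * (1 + r\<^sup>2) / 4"
  have "norm (x - y) \<le> L * norm (cayley x - cayley y)" if x: "norm x \<le> r" and y: "norm y \<le> r" for x y
  proof -
    let ?n = "norm (cayley x - cayley y)"
    have "(2 * s x) *\<^sub>R (x - y) = vx (cayley x - cayley y) - (2 * (s x - s y)) *\<^sub>R y"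
      by (simp add: linear_diff[OF \<open>linear vx\<close>] vxc algebra_simps)
    moreover have "2 * (s x - s y) = tr (cayley x - cayley y)"
      by (simp add: linear_diff[OF \<open>linear tr\<close>] trc)
    ultimately have "(2 * s x) *\<^sub>R (x - y) = vx (cayley x - cayley y) - tr (cayley x - cayley y) *\<^sub>R y" by simp
    then have "norm ((2 * s x) *\<^sub>R (x - y)) \<le> norm (vx (cayley x - cayley y)) + norm (tr (cayley x - cayley y) *\<^sub>R y)"
      by (simp only: norm_triangle_ineq4)
    also have "\<dots> \<le> ?n * Kv + (?n * Kt) * r"
      unfolding norm_scaleR real_norm_def[symmetric]
      by (intro add_mono Kv mult_mono Kt y) (use Kt in auto)
    finally have "\<bar>2 * s x\<bar> * norm (x - y) \<le> ?n * Kv + (?n * Kt) * r" unfolding norm_scaleR .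
    then have 1: "2 * s x * norm (x - y) \<le> (Kv + r * Kt) * ?n"
      using s0[of x] by (simp add: abs_of_pos algebra_simps)
    have "2 * (2 / (1 + r\<^sup>2)) \<le> 2 * s x"
      unfolding s_def using x pos[of x] by (intro mult_left_mono divide_left_mono add_left_mono power_mono) (auto intro!: mult_pos_pos add_pos_nonneg)
    then have "4 / (1 + r\<^sup>2) * norm (x - y) \<le> 2 * s x * norm (x - y)" by (intro mult_right_mono) auto
    with 1 have "4 / (1 + r\<^sup>2) * norm (x - y) \<le> (Kv + r * Kt) * ?n" by linarith
    then have "(1 + r\<^sup>2) / 4 * (4 / (1 + r\<^sup>2) * norm (x - y)) \<le> (1 + r\<^sup>2) / 4 * ((Kv + r * Kt) * ?n)"
      by (intro mult_left_mono) auto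
    moreover have "(1 + r\<^sup>2) / 4 * (4 / (1 + r\<^sup>2) * norm (x - y)) = norm (x - y)"
      using pos_add_strict[of 1 0 "r\<^sup>2"] by (simp add: field_simps add_nonneg_eq_0_iff)
    ultimately show ?thesis by (simp add: L_def mult_ac)
  qed
  moreover have "0 \<le> L" using Kv Kt r by (simp add: L_def)
  ultimately show ?thesis by blast
qed

lemma continuous_cayley: "continuous_on UNIV cayley"
proof -
  have "1 + (norm x)\<^sup>2 \<noteq> 0" for x :: "real^3" by (smt (verit) zero_le_power2)
  then show ?thesis
    unfolding cayley_def
    by (intro continuous_intros bounded_linear.continuous_on[OF bounded_linear_hat]
        bounded_bilinear.continuous_on[OF bounded_bilinear_matrix_mult]) auto
qed


section \<open>Solutions that are trapped at an undesired equilibrium\<close>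

lemma (in weighted_directions) solution_cong:
  assumes "solution \<kappa> \<Omega> g t0 Q w" and "\<And>t a. t0 \<le> t \<Longrightarrow> a \<in> A \<Longrightarrow> g t a = g' t a"
  shows "solution \<kappa> \<Omega> g' t0 Q w"
proof -
  have "torque (g t) X = torque (g' t) X" if "t0 \<le> t" for t X
    unfolding torque_def using assms(2)[OF that] by (intro sum.cong) auto
  then show ?thesis using assms(1) unfolding solution_def accel_def by simp
qed

context twin_leader_follower
begin

text \<open>The solutions in error coordinates whose initial state has the chart coordinates \<open>y\<close>.\<close>

definition chart_start :: "(nat \<Rightarrow> real^3^3) \<Rightarrow> nat \<Rightarrow> real \<Rightarrow> (nat \<Rightarrow> (real^3) \<times> (real^3)) \<Rightarrow>
    (nat \<Rightarrow> real \<Rightarrow> real^3^3) \<Rightarrow> (nat \<Rightarrow> real \<Rightarrow> real^3) \<Rightarrow> bool" where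
  "chart_start P k t0 y Q w \<longleftrightarrow> error_cascade k t0 Q w \<and> (\<forall>i\<in>{3..k}.
     Q i t0 = P i ** cayley (fst (y i)) ** transpose (orient G (Agent i) t0) \<and>
     w i t0 = orient G (Agent i) t0 *v snd (y i))"

text \<open>The chart coordinates of initial states from which follower \<open>k\<close> stays near \<open>S\<close> from time \<open>T\<close> on, while
  its predecessors stay near the identity. The bound \<open>r\<close> keeps the Lipschitz constants of the chart
  finite.\<close>

definition trapped :: "(nat \<Rightarrow> real^3^3) \<Rightarrow> nat \<Rightarrow> real \<Rightarrow> real^3^3 \<Rightarrow> real \<Rightarrow> real \<Rightarrow> real \<Rightarrow>
    (nat \<Rightarrow> (real^3) \<times> (real^3)) set" where
  "trapped P k t0 S \<delta> T r = {y. norm (y k) \<le> r \<and> (\<exists>Q w. chart_start P k t0 y Q w \<and>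
     (\<forall>t\<ge>T. (\<forall>j\<in>{3..<k}. norm (Q j t - mat 1) \<le> \<delta>) \<and> norm (Q k t - S) \<le> \<delta> \<and> norm (w k t) \<le> \<delta>))}"

text \<open>All conditions are closed and pass to limits of solutions.\<close>

lemma closed_trapped:
  assumes k: "k \<in> {3..last_index G}" and t0: "0 \<le> t0" and T: "t0 \<le> T"
  shows "closed (trapped P k t0 S \<delta> T r)"
  unfolding closed_sequential_limits
proof (intro allI impI)
  fix y l assume *: "(\<forall>n. y n \<in> trapped P k t0 S \<delta> T r) \<and> y \<longlonglongrightarrow> l"
  have coord: "(\<lambda>n. y n i) \<longlonglongrightarrow> l i" for i
  proof -
    have "continuous_on UNIV (\<lambda>u :: nat \<Rightarrow> (real^3) \<times> (real^3). u i)" by simp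
    from continuous_on_tendsto_compose[OF this conjunct2[OF *]] show ?thesis by simp
  qed
  from * have "\<forall>n. \<exists>Q w. chart_start P k t0 (y n) Q w \<and>
     (\<forall>t\<ge>T. (\<forall>j\<in>{3..<k}. norm (Q j t - mat 1) \<le> \<delta>) \<and> norm (Q k t - S) \<le> \<delta> \<and> norm (w k t) \<le> \<delta>)"
    by (auto simp: trapped_def)
  then obtain Qs ws where st: "\<And>n. chart_start P k t0 (y n) (Qs n) (ws n)"
    and near: "\<And>n t. T \<le> t \<Longrightarrow> (\<forall>j\<in>{3..<k}. norm (Qs n j t - mat 1) \<le> \<delta>) \<and>
      norm (Qs n k t - S) \<le> \<delta> \<and> norm (ws n k t) \<le> \<delta>" by metis
  have cas: "error_cascade k t0 (Qs n) (ws n)" for n using st by (simp add: chart_start_def)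
  have qlim: "(\<lambda>n. Qs n i t0) \<longlonglongrightarrow> P i ** cayley (fst (l i)) ** transpose (orient G (Agent i) t0)"
    if i: "i \<in> {3..k}" for i
  proof -
    have "(\<lambda>n. cayley (fst (y n i))) \<longlonglongrightarrow> cayley (fst (l i))"
      by (rule continuous_on_tendsto_compose[OF continuous_cayley tendsto_fst[OF coord]]) auto
    then have "(\<lambda>n. P i ** cayley (fst (y n i)) ** transpose (orient G (Agent i) t0)) \<longlonglongrightarrow>
        P i ** cayley (fst (l i)) ** transpose (orient G (Agent i) t0)"
      by (intro bounded_bilinear.tendsto[OF bounded_bilinear_matrix_mult] tendsto_const)
    then show ?thesis using st i by (simp add: chart_start_def)
  qed
  have vlim: "(\<lambda>n. ws n i t0) \<longlonglongrightarrow> orient G (Agent i) t0 *v snd (l i)" if i: "i \<in> {3..k}" for i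
  proof -
    have "(\<lambda>n. orient G (Agent i) t0 *v snd (y n i)) \<longlonglongrightarrow> orient G (Agent i) t0 *v snd (l i)"
      by (intro bounded_bilinear.tendsto[OF bounded_bilinear_matrix_vec] tendsto_const tendsto_snd coord)
    then show ?thesis using st i by (simp add: chart_start_def)
  qed
  have kl: "k \<le> last_index G" using k by simp
  obtain Q w where Qw: "error_cascade k t0 Q w" and
    lim: "\<And>i t. i \<in> {3..k} \<Longrightarrow> t0 \<le> t \<Longrightarrow> (\<lambda>n. Qs n i t) \<longlonglongrightarrow> Q i t \<and> (\<lambda>n. ws n i t) \<longlonglongrightarrow> w i t"
    using error_cascade_limit[OF kl t0 cas qlim vlim] by blast
  have kk: "k \<in> {3..k}" using k by simp
  have "chart_start P k t0 l Q w"
    unfolding chart_start_def using Qw LIMSEQ_unique[OF conjunct1[OF lim] qlim] LIMSEQ_unique[OF conjunct2[OF lim] vlim]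
    by simp
  moreover have "(\<forall>j\<in>{3..<k}. norm (Q j t - mat 1) \<le> \<delta>) \<and> norm (Q k t - S) \<le> \<delta> \<and> norm (w k t) \<le> \<delta>"
    if t: "T \<le> t" for t
  proof (intro conjI ballI)
    have t0t: "t0 \<le> t" using t T by simp
    show "norm (Q j t - mat 1) \<le> \<delta>" if j: "j \<in> {3..<k}" for j
    proof (rule LIMSEQ_le_const2)
      show "(\<lambda>n. norm (Qs n j t - mat 1)) \<longlonglongrightarrow> norm (Q j t - mat 1)"
        using lim[OF _ t0t, of j] j by (intro tendsto_intros) auto
    qed (use near[OF t] j in blast)
    show "norm (Q k t - S) \<le> \<delta>"
    proof (rule LIMSEQ_le_const2)
      show "(\<lambda>n. norm (Qs n k t - S)) \<longlonglongrightarrow> norm (Q k t - S)"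
        using lim[OF kk t0t] by (intro tendsto_intros) auto
    qed (use near[OF t] in blast)
    show "norm (w k t) \<le> \<delta>"
    proof (rule LIMSEQ_le_const2)
      show "(\<lambda>n. norm (ws n k t)) \<longlonglongrightarrow> norm (w k t)"
        using lim[OF kk t0t] by (intro tendsto_intros) auto
    qed (use near[OF t] in blast)
  qed
  moreover have "norm (l k) \<le> r"
  proof (rule LIMSEQ_le_const2)
    show "(\<lambda>n. norm (y n k)) \<longlonglongrightarrow> norm (l k)" by (intro tendsto_intros coord)
  qed (use * in \<open>auto simp: trapped_def\<close>)
  ultimately show "l \<in> trapped P k t0 S \<delta> T r" unfolding trapped_def by blast
qed

text \<open>With the initial states of the predecessors fixed, their trajectories are fixed too, so all
  solutions of follower \<open>k\<close> have the same inputs. The torques and velocities at time \<open>T\<close> then form a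
  null set by the cone property, and the chart coordinates at time \<open>t0\<close> depend on them in a
  Lipschitz way.\<close>

lemma trapped_fibre_negligible:
  assumes k: "k \<in> {3..last_index G}" and t0: "0 \<le> t0"
    and P: "\<And>i. i \<in> {3..k} \<Longrightarrow> rotation_matrix (P i)"
    and S: "weighted_directions.equilibrium (indices G k) (gain G k) (direction G k) S" "S \<noteq> mat 1"
  shows "\<exists>\<delta>>0. \<forall>T\<ge>t0. \<forall>r x. negligible {z. x(k := z) \<in> trapped P k t0 S \<delta> T r}"
proof -
  have f: "k \<in> followers G" and kl: "k \<le> last_index G" and kk: "k \<in> {3..k}" using k by (auto simp: followers_def)
  interpret F: weighted_directions "indices G k" "gain G k" "direction G k"
    by (rule weighted_directions_follower[OF f])
  obtain B where B: "0 \<le> B" "\<forall>i\<in>{3..k}. \<forall>t\<ge>0. norm (spin i t) \<le> B"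
    using spin_bounded[OF kl] by blast
  obtain \<delta>c C \<sigma> z0 where \<delta>c: "0 < \<delta>c" and C: "0 < C"
    and form: "F.separating_form (damping G) B S \<delta>c C \<sigma> z0"
    using F.saddle_cone[OF S damping_pos B(1)] by blast
  note cone = F.separating_formD[OF form]
  define s where "s = (1 + 2 * inverse (norm (nbr_cross G k))) * real k"
  have s0: "0 \<le> s" by (simp add: s_def)
  define \<delta> where "\<delta> = min \<delta>c (\<delta>c / (s + 1))"
  have \<delta>: "0 < \<delta>" "\<delta> \<le> \<delta>c" "s * \<delta> \<le> \<delta>c"
  proof -
    show "0 < \<delta>" "\<delta> \<le> \<delta>c" using \<delta>c s0 by (auto simp: \<delta>_def)
    have "s * \<delta> \<le> (s + 1) * (\<delta>c / (s + 1))"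
      using s0 \<open>0 < \<delta>\<close> by (intro mult_mono) (auto simp: \<delta>_def)
    then show "s * \<delta> \<le> \<delta>c" using s0 by simp
  qed
  have "negligible {z. x(k := z) \<in> trapped P k t0 S \<delta> T r}" if T: "t0 \<le> T" for T r x
  proof (cases "r < 0")
    case True
    have "{z. x(k := z) \<in> trapped P k t0 S \<delta> T r} = {}"
    proof -
      have "\<not> norm z \<le> r" for z :: "(real^3) \<times> (real^3)" using True norm_ge_zero[of z] by linarith
      then show ?thesis by (simp add: trapped_def)
    qed
    then show ?thesis by (simp only: negligible_empty)
  next
    case False
    then have r: "0 \<le> r" by simp
    define X where "X = {z. x(k := z) \<in> trapped P k t0 S \<delta> T r}"
    have Xr: "norm z \<le> r" if "z \<in> X" for z using that by (simp add: X_def trapped_def)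
    have "\<forall>z\<in>X. \<exists>p. chart_start P k t0 (x(k := z)) (fst p) (snd p) \<and>
       (\<forall>t\<ge>T. (\<forall>j\<in>{3..<k}. norm (fst p j t - mat 1) \<le> \<delta>) \<and> norm (fst p k t - S) \<le> \<delta> \<and> norm (snd p k t) \<le> \<delta>)"
      unfolding X_def trapped_def by simp
    from bchoice[OF this] obtain p where p: "\<forall>z\<in>X. chart_start P k t0 (x(k := z)) (fst (p z)) (snd (p z)) \<and>
       (\<forall>t\<ge>T. (\<forall>j\<in>{3..<k}. norm (fst (p z) j t - mat 1) \<le> \<delta>) \<and> norm (fst (p z) k t - S) \<le> \<delta> \<and> norm (snd (p z) k t) \<le> \<delta>)"
      by blast
    define Q where "Q z = fst (p z)" for z
    define w where "w z = snd (p z)" for z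
    have start: "chart_start P k t0 (x(k := z)) (Q z) (w z)" if "z \<in> X" for z using p that by (simp add: Q_def w_def)
    have near: "(\<forall>j\<in>{3..<k}. norm (Q z j t - mat 1) \<le> \<delta>) \<and> norm (Q z k t - S) \<le> \<delta> \<and> norm (w z k t) \<le> \<delta>"
      if "z \<in> X" "T \<le> t" for z t using p that by (simp add: Q_def w_def)
    have cas: "error_cascade k t0 (Q z) (w z)" if "z \<in> X" for z using start[OF that] by (simp add: chart_start_def)
    obtain M where M: "\<And>Q w i t. error_cascade k t0 Q w \<Longrightarrow> i \<in> {3..k} \<Longrightarrow> t0 \<le> t \<Longrightarrow>
        (norm (w i t))\<^sup>2 \<le> (norm (w i t0))\<^sup>2 + M"
      using velocity_uniformly_bounded[OF kl] by blast
    have rotR: "rotation_matrix (orient G (Agent i) t0)" if "i \<in> {3..k}" for i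
      using rotation[OF follower_agent t0] that k by (auto simp: followers_def)
    define V where "V = sqrt ((\<Sum>i\<in>{3..k}. (norm (x i))\<^sup>2) + r\<^sup>2 + \<bar>M\<bar>)"
    have V0: "0 \<le> V" by (simp add: V_def sum_nonneg)
    have wV: "norm (w z i t) \<le> V" if z: "z \<in> X" and i: "i \<in> {3..k}" and t: "t0 \<le> t" for z i t
    proof -
      have "norm (w z i t0) = norm (snd ((x(k := z)) i))"
        using start[OF z] i rotation_norm[OF rotR[OF i]] by (simp add: chart_start_def)
      also have "\<dots> \<le> norm ((x(k := z)) i)" by (simp only: norm_prod_def real_sqrt_sum_squares_ge2)
      finally have "(norm (w z i t0))\<^sup>2 \<le> (norm ((x(k := z)) i))\<^sup>2" by (rule power_mono) simp
      also have "\<dots> \<le> (\<Sum>i\<in>{3..k}. (norm (x i))\<^sup>2) + r\<^sup>2"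
      proof (cases "i = k")
        case True
        have "(norm z)\<^sup>2 \<le> r\<^sup>2" using Xr[OF z] by (intro power_mono) auto
        then show ?thesis using True sum_nonneg[of "{3..k}" "\<lambda>i. (norm (x i))\<^sup>2"] by simp
      next
        case False
        then show ?thesis using member_le_sum[OF i, of "\<lambda>i. (norm (x i))\<^sup>2"] by (simp add: add_increasing2)
      qed
      finally have "(norm (w z i t))\<^sup>2 \<le> (\<Sum>i\<in>{3..k}. (norm (x i))\<^sup>2) + r\<^sup>2 + \<bar>M\<bar>"
        using M[OF cas[OF z] i t] by linarith
      then show ?thesis unfolding V_def by (rule real_le_rsqrt)
    qed
    (* The predecessors of k form a cascade of their own and start equally, hence they agree for all times. *)
    define m where "m = k - 1"
    have m: "{3..m} = {3..<k}" "m \<le> last_index G" using k by (auto simp: m_def)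
    obtain Cm where gm: "\<And>Q w Q' w' t. error_cascade m t0 Q w \<Longrightarrow> error_cascade m t0 Q' w' \<Longrightarrow>
      \<forall>i\<in>{3..m}. \<forall>t\<ge>t0. norm (w i t) \<le> V \<Longrightarrow> t0 \<le> t \<Longrightarrow>
      sqdist_at m t Q w Q' w'
        \<le> sqdist_at m t0 Q w Q' w' * exp (Cm * (t - t0))"
      using cascade_gronwall[OF m(2) t0 V0] by blast
    obtain Ck where gk: "\<And>Q w Q' w' t. error_cascade k t0 Q w \<Longrightarrow> error_cascade k t0 Q' w' \<Longrightarrow>
      \<forall>i\<in>{3..k}. \<forall>t\<ge>t0. norm (w i t) \<le> V \<Longrightarrow> t0 \<le> t \<Longrightarrow>
      sqdist_at k t0 Q w Q' w'
        \<le> sqdist_at k t Q w Q' w' * exp (Ck * (t - t0))"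
      using cascade_gronwall[OF kl t0 V0] by blast
    have same: "Q z j t = Q z' j t \<and> w z j t = w z' j t" if z: "z \<in> X" "z' \<in> X" and j: "j \<in> {3..<k}" and t: "t0 \<le> t" for z z' j t
    proof -
      have c: "error_cascade m t0 (Q z) (w z)" "error_cascade m t0 (Q z') (w z')"
        using cas[OF z(1)] cas[OF z(2)] error_cascade_mono[of k] by (auto simp: m_def)
      have "sqdist_at m t0 (Q z) (w z) (Q z') (w z') = 0"
        unfolding sqdist_def m(1)
        by (rule sum.neutral) (use start[OF z(1)] start[OF z(2)] in \<open>auto simp: chart_start_def\<close>)
      moreover have "\<forall>i\<in>{3..m}. \<forall>t\<ge>t0. norm (w z i t) \<le> V" using wV[OF z(1)] m(1) by auto
      ultimately have zero: "sqdist_at m t (Q z) (w z) (Q z') (w z') \<le> 0"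
        using gm[OF c _ t] by simp
      have jm: "j \<in> {3..m}" using j m(1) by simp
      have "(norm (Q z j t - Q z' j t))\<^sup>2 \<le> 0"
        by (rule order_trans[OF norm_le_sqdist(1)[OF jm, of "\<lambda>j. Q z j t" "\<lambda>j. Q z' j t"] zero])
      moreover have "(norm (w z j t - w z' j t))\<^sup>2 \<le> 0"
        by (rule order_trans[OF norm_le_sqdist(2)[OF jm, of "\<lambda>j. w z j t" "\<lambda>j. w z' j t"] zero])
      ultimately have "(norm (Q z j t - Q z' j t))\<^sup>2 \<le> 0 \<and> (norm (w z j t - w z' j t))\<^sup>2 \<le> 0" ..
      then show ?thesis by simp
    qed
    have sol: "F.solution (damping G) (spin k) (\<lambda>t. sight G k (\<lambda>j. Q z j t)) T (Q z k) (w z k)" if z: "z \<in> X" for z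
      by (rule F.solution_later[OF error_cascade_solution[OF cas[OF z] kk] T])
    have rotQ: "rotation_matrix (Q z j t)" if "z \<in> X" "j \<in> {3..k}" "t0 \<le> t" for z j t
      by (rule error_cascade_rotation[OF cas[OF that(1)] kl that(2,3)])
    define \<psi> where "\<psi> z = (F.torque (direction G k) (Q z k T), w z k T)" for z
    have pair: "\<sigma> (\<psi> z - \<psi> z') \<le> 0 \<and> norm (Q z k T - Q z' k T) \<le> C * norm (fst (\<psi> z) - fst (\<psi> z'))"
      if z: "z \<in> X" "z' \<in> X" for z z'
    proof -
      have seq: "sight G k (\<lambda>j. Q z' j t) a = sight G k (\<lambda>j. Q z j t) a"
        if t: "T \<le> t" and a: "a \<in> indices G k" for t a
      proof -
        have "norm (sight G k (\<lambda>j. Q z' j t) a - sight G k (\<lambda>j. Q z j t) a)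
            \<le> (1 + 2 * inverse (norm (nbr_cross G k))) * (\<Sum>m\<in>{3..<k}. norm (Q z' m t - Q z m t))"
          by (rule sight_lipschitz[OF f _ _ a]) (use rotQ z t T in auto)
        also have "(\<Sum>m\<in>{3..<k}. norm (Q z' m t - Q z m t)) = 0"
          by (rule sum.neutral) (use same[OF z] t T in auto)
        finally show ?thesis by simp
      qed
      have s2: "F.solution (damping G) (spin k) (\<lambda>t. sight G k (\<lambda>j. Q z j t)) T (Q z' k) (w z' k)"
        by (rule F.solution_cong[OF sol[OF z(2)]]) (rule seq)
      have sp: "\<forall>t\<ge>T. norm (spin k t) \<le> B" using B(2) kk T t0 by auto
      have gn: "\<forall>t\<ge>T. \<forall>a\<in>indices G k. norm (sight G k (\<lambda>j. Q z j t) a - direction G k a) \<le> \<delta>c"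
      proof (intro allI impI ballI)
        fix t a assume t: "T \<le> t" and a: "a \<in> indices G k"
        have "norm (sight G k (\<lambda>j. Q z j t) a - direction G k a)
            \<le> (1 + 2 * inverse (norm (nbr_cross G k))) * (\<Sum>m\<in>{3..<k}. norm (Q z m t - mat 1))"
          by (rule sight_error[OF f _ a]) (use rotQ z t T in auto)
        also have "\<dots> \<le> (1 + 2 * inverse (norm (nbr_cross G k))) * (real k * \<delta>)"
        proof (rule mult_left_mono)
          have "(\<Sum>m\<in>{3..<k}. norm (Q z m t - mat 1)) \<le> real (card {3..<k}) * \<delta>"
            by (rule sum_bounded_above) (use near[OF z(1) t] in blast)
          also have "\<dots> \<le> real k * \<delta>" using \<delta> by (intro mult_right_mono) auto
          finally show "(\<Sum>m\<in>{3..<k}. norm (Q z m t - mat 1)) \<le> real k * \<delta>" .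
        qed simp
        also have "\<dots> = s * \<delta>" by (simp add: s_def)
        finally show "norm (sight G k (\<lambda>j. Q z j t) a - direction G k a) \<le> \<delta>c" using \<delta>(3) by linarith
      qed
      have n: "\<forall>t\<ge>T. norm (Q u k t - S) \<le> \<delta>c \<and> norm (w u k t) \<le> \<delta>c" if "u \<in> X" for u
        using near[OF that] \<delta>(2) by (meson order_trans)
      show ?thesis
        using cone(3)[OF sp sol[OF z(1)] s2 gn n[OF z(1)] n[OF z(2)]] by (simp add: \<psi>_def)
    qed
    have negl: "negligible (\<psi> ` X)"
    proof (rule negligible_if_cone_free[OF cone(1)])
      show "0 < \<sigma> (s *\<^sub>R z0)" if "s \<noteq> 0" for s using cone(2) that by blast
      obtain Ct where Ct: "0 < Ct" "\<And>Y. norm (F.torque (direction G k) Y) \<le> norm Y * Ct"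
        using bounded_linear.pos_bounded[OF F.bounded_linear_torque[of "direction G k"]] by blast
      show "bounded (\<psi> ` X)"
        unfolding bounded_iff
      proof (intro exI[of _ "2 * Ct + V"] ballI)
        fix u assume "u \<in> \<psi> ` X"
        then obtain z where z: "z \<in> X" "u = \<psi> z" by blast
        have "norm (F.torque (direction G k) (Q z k T)) \<le> 2 * Ct"
          using Ct(2)[of "Q z k T"] mult_right_mono[OF norm_rotation_le[OF rotQ[OF z(1) kk T]], of Ct] Ct(1) by linarith
        moreover have "norm (w z k T) \<le> V" by (rule wV[OF z(1) kk T])
        ultimately show "norm u \<le> 2 * Ct + V"
          unfolding z(2) \<psi>_def using norm_Pair_le[of "F.torque (direction G k) (Q z k T)" "w z k T"] by linarith
      qed
      show "\<sigma> (u - v) \<le> 0" if "u \<in> \<psi> ` X" "v \<in> \<psi> ` X" for u v using that pair by blast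
    qed
    obtain Lc where Lc: "0 \<le> Lc" "\<And>x y. norm x \<le> r \<Longrightarrow> norm y \<le> r \<Longrightarrow> norm (x - y) \<le> Lc * norm (cayley x - cayley y)"
      using cayley_inverse_lipschitz[OF r] by blast
    define E where "E = exp (Ck * (T - t0))"
    (* Chart at time t0, Gronwall from T back to t0, and torque coordinates at T contribute one factor each. *)
    define L where "L = sqrt ((Lc\<^sup>2 + 1) * ((C\<^sup>2 + 1) * E))"
    have "negligible X"
    proof (rule negligible_if_image_negligible[OF _ negl])
      fix z z' assume z: "z \<in> X" "z' \<in> X"
      let ?N0 = "sqdist_at k t0 (Q z) (w z) (Q z') (w z')"
      let ?NT = "sqdist_at k T (Q z) (w z) (Q z') (w z')"
      let ?d = "norm (\<psi> z - \<psi> z')"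
      have "?NT = (\<Sum>j\<in>{k}. (Q z j T - Q z' j T) \<bullet> (Q z j T - Q z' j T) + (w z j T - w z' j T) \<bullet> (w z j T - w z' j T))"
        unfolding sqdist_def by (rule sum.mono_neutral_right) (use kk same[OF z] T in auto)
      then have NT: "?NT = (norm (Q z k T - Q z' k T))\<^sup>2 + (norm (w z k T - w z' k T))\<^sup>2"
        by (simp add: power2_norm_eq_inner)
      have d1: "norm (fst (\<psi> z) - fst (\<psi> z')) \<le> ?d" "norm (snd (\<psi> z) - snd (\<psi> z')) \<le> ?d"
        by (simp_all add: norm_prod_def)
      have "norm (Q z k T - Q z' k T) \<le> C * ?d"
        using pair[OF z] mult_left_mono[OF d1(1), of C] C by linarith
      then have "(norm (Q z k T - Q z' k T))\<^sup>2 \<le> (C * ?d)\<^sup>2" by (rule power_mono) simp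
      moreover have "(norm (w z k T - w z' k T))\<^sup>2 \<le> ?d\<^sup>2"
        using d1(2) by (intro power_mono) (simp_all add: \<psi>_def)
      ultimately have NTd: "?NT \<le> (C\<^sup>2 + 1) * ?d\<^sup>2" 
        unfolding NT power_mult_distrib distrib_right by linarith
      have "?N0 \<le> ?NT * E"
        unfolding E_def by (rule gk[OF cas[OF z(1)] cas[OF z(2)] _ T]) (use wV[OF z(1)] in blast)
      also have "\<dots> \<le> (C\<^sup>2 + 1) * ?d\<^sup>2 * E" by (rule mult_right_mono[OF NTd]) (simp add: E_def)
      finally have N0: "?N0 \<le> ((C\<^sup>2 + 1) * E) * ?d\<^sup>2" by (simp add: mult_ac)
      have f1: "norm (fst z - fst z') \<le> Lc * norm (Q z k t0 - Q z' k t0)"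
      proof -
        have "norm (fst z) \<le> r" "norm (fst z') \<le> r"
          using order_trans[OF _ Xr[OF z(1)]] order_trans[OF _ Xr[OF z(2)]]
          by (simp_all add: norm_prod_def)
        then have "norm (fst z - fst z') \<le> Lc * norm (cayley (fst z) - cayley (fst z'))" by (rule Lc(2))
        also have "norm (cayley (fst z) - cayley (fst z'))
            = norm (P k ** (cayley (fst z) - cayley (fst z')) ** transpose (orient G (Agent k) t0))"
          by (simp add: norm_mult_rotation_right[OF rotation_transpose[OF rotR[OF kk]]] norm_mult_rotation_left[OF P[OF kk]])
        also have "P k ** (cayley (fst z) - cayley (fst z')) ** transpose (orient G (Agent k) t0) = Q z k t0 - Q z' k t0"
          using start[OF z(1)] start[OF z(2)] kk
          by (simp add: chart_start_def matrix_mult_diff)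
        finally show ?thesis .
      qed
      have f2: "norm (snd z - snd z') = norm (w z k t0 - w z' k t0)"
      proof -
        have "w z k t0 - w z' k t0 = orient G (Agent k) t0 *v (snd z - snd z')"
          using start[OF z(1)] start[OF z(2)] kk by (simp add: chart_start_def matrix_vector_mult_diff_distrib)
        then show ?thesis by (simp add: rotation_norm[OF rotR[OF kk]])
      qed
      have "(norm (z - z'))\<^sup>2 = (norm (fst z - fst z'))\<^sup>2 + (norm (snd z - snd z'))\<^sup>2"
        by (simp add: norm_prod_def)
      also have "\<dots> \<le> (Lc * norm (Q z k t0 - Q z' k t0))\<^sup>2 + (norm (w z k t0 - w z' k t0))\<^sup>2"
        unfolding f2 by (intro add_right_mono power_mono f1) simp
      also have "\<dots> \<le> Lc\<^sup>2 * ?N0 + ?N0"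
        unfolding power_mult_distrib
        by (intro add_mono mult_left_mono norm_le_sqdist(1)[OF kk, of "\<lambda>j. Q z j t0" "\<lambda>j. Q z' j t0"]
            norm_le_sqdist(2)[OF kk, of "\<lambda>j. w z j t0" "\<lambda>j. w z' j t0"]) simp
      also have "\<dots> = (Lc\<^sup>2 + 1) * ?N0" by (simp add: distrib_right)
      also have "\<dots> \<le> (Lc\<^sup>2 + 1) * (((C\<^sup>2 + 1) * E) * ?d\<^sup>2)" by (rule mult_left_mono[OF N0]) simp
      finally have "norm (z - z') \<le> sqrt (((Lc\<^sup>2 + 1) * ((C\<^sup>2 + 1) * E)) * ?d\<^sup>2)"
        by (intro real_le_rsqrt) (simp add: mult_ac)
      also have "\<dots> = L * ?d" by (simp add: L_def real_sqrt_mult)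
      finally show "norm (z - z') \<le> L * ?d" .
    qed simp
    then show ?thesis by (simp add: X_def)
  qed
  then show ?thesis using \<delta>(1) by blast
qed

end


context twin_leader_follower
begin

section \<open>Almost global asymptotic stability\<close>

text \<open>The auxiliary vector in the inertial frame.\<close>

definition spatial_rate :: "(nat \<Rightarrow> real \<Rightarrow> real^3) \<Rightarrow> nat \<Rightarrow> real \<Rightarrow> real^3" where
  "spatial_rate W i t = orient G (Agent i) t *v W i t"

definition converges :: "(nat \<Rightarrow> real \<Rightarrow> real^3^3) \<Rightarrow> (nat \<Rightarrow> real \<Rightarrow> real^3) \<Rightarrow> nat \<Rightarrow> bool" where
  "converges Q w i \<longleftrightarrow> settles (Q i) (w i) \<and> (Q i \<longlongrightarrow> mat 1) at_top \<and> (w i \<longlongrightarrow> 0) at_top"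

definition exceptional_states :: "nat \<Rightarrow> real \<Rightarrow> (nat \<Rightarrow> (real^3^3) \<times> (real^3)) set" where
  "exceptional_states k t0 = {x. \<exists>E W. cascade_solution G k t0 E W \<and> x = (\<lambda>i\<in>{3..k}. (E i t0, W i t0)) \<and>
     \<not> (\<forall>i\<in>{3..k}. converges (att_error G E) (spatial_rate W) i)}"

lemma norm_spatial_rate:
  assumes "i \<in> {3..last_index G}" "0 \<le> t"
  shows "norm (spatial_rate W i t) = norm (W i t)"
proof -
  have "i \<in> followers G" using assms by (simp add: followers_def)
  from rotation_norm[OF rotation[OF follower_agent[OF this] assms(2)]] show ?thesis
    by (simp add: spatial_rate_def)
qed

lemma cascade_solution_mono: "cascade_solution G k t0 E W \<Longrightarrow> j \<le> k \<Longrightarrow> cascade_solution G j t0 E W"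
  unfolding cascade_solution_def by auto

lemma error_cascade_spatial_rate:
  assumes "cascade_solution G k t0 E W" "0 \<le> t0" "k \<le> last_index G"
  shows "error_cascade k t0 (att_error G E) (spatial_rate W)"
proof -
  have "spatial_rate W = (\<lambda>i t. orient G (Agent i) t *v W i t)" by (intro ext) (simp add: spatial_rate_def)
  then show ?thesis using error_cascade_of_solution[OF assms] by simp
qed

text \<open>A state is exceptional for \<open>3, \<dots>, n\<close> if it is exceptional for \<open>3, \<dots>, n - 1\<close>, which is a null
  cylinder, or if the predecessors of \<open>n\<close> converge and \<open>n\<close> tends to an undesired equilibrium. In the
  second case the state is trapped at this equilibrium from some time on.\<close>

lemma null_exceptional_states:
  assumes "k \<le> last_index G" "0 \<le> t0"
  shows "null_states {3..k} (exceptional_states k t0)"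
  using assms
proof (induction k)
  case 0
  then show ?case by (simp add: null_states_def exceptional_states_def)
next
  case (Suc k)
  show ?case
  proof (cases "Suc k < 3")
    case True
    then show ?thesis by (simp add: null_states_def exceptional_states_def)
  next
    case False
    define n where "n = Suc k"
    have n: "n \<in> {3..last_index G}" "{3..n} = insert n {3..k}" "n \<notin> {3..k}" "{3..<n} = {3..k}" "k \<le> n"
      using False Suc.prems by (auto simp: n_def)
    have f: "n \<in> followers G" using n by (simp add: followers_def)
    interpret F: weighted_directions "indices G n" "gain G n" "direction G n"
      by (rule weighted_directions_follower[OF f])
    have IH: "null_states {3..k} (exceptional_states k t0)" using Suc by simp
    have "null_states {3..n} (exceptional_states n t0)"
      unfolding null_states_def
    proof (intro allI impI)
      fix P :: "nat \<Rightarrow> real^3^3" assume P: "\<forall>i\<in>{3..n}. rotation_matrix (P i)"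
      define st where "st y i = (P i ** cayley (fst (y i)), snd (y i))" for y :: "nat \<Rightarrow> (real^3) \<times> (real^3)" and i
      let ?M = "PiM {3..n} (\<lambda>_. lborel :: ((real^3) \<times> (real^3)) measure)"
      have "AE y in PiM {3..k} (\<lambda>_. lborel). (\<lambda>i\<in>{3..k}. st y i) \<notin> exceptional_states k t0"
        using IH P n(2) unfolding null_states_def st_def by auto
      from AE_PiM_restrict[OF _ n(3) this]
      have "AE y in ?M. (\<lambda>i\<in>{3..k}. st (restrict y {3..k}) i) \<notin> exceptional_states k t0"
        unfolding n(2) by simp
      moreover have "(\<lambda>i\<in>{3..k}. st (restrict y {3..k}) i) = (\<lambda>i\<in>{3..k}. st y i)" for y
        by (intro restrict_ext) (simp add: st_def)
      ultimately have ae1: "AE y in ?M. (\<lambda>i\<in>{3..k}. st y i) \<notin> exceptional_states k t0" by simp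
      define Sd where "Sd = {S. F.equilibrium S \<and> S \<noteq> mat 1}"
      have cSd: "countable Sd"
        unfolding Sd_def by (rule countable_finite, rule finite_subset[OF _ F.finite_equilibria]) auto
      have "\<forall>S\<in>Sd. \<exists>\<delta>>0. \<forall>T\<ge>t0. \<forall>r x. negligible {z. x(n := z) \<in> trapped P n t0 S \<delta> T r}"
        using trapped_fibre_negligible[OF n(1) Suc.prems(2)] P unfolding Sd_def by blast
      from bchoice[OF this] obtain \<delta> where \<delta>: "\<And>S. S \<in> Sd \<Longrightarrow> 0 < \<delta> S"
        and neg: "\<And>S T r x. S \<in> Sd \<Longrightarrow> t0 \<le> T \<Longrightarrow> negligible {z. x(n := z) \<in> trapped P n t0 S (\<delta> S) T r}" by blast
      have "AE y in ?M. y \<notin> trapped P n t0 S (\<delta> S) (t0 + real a) (real r)" if "S \<in> Sd" for S a r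
        unfolding n(2)
        by (rule AE_PiM_insert[OF _ n(3) closed_trapped[OF n(1) Suc.prems(2)] neg[OF that]]) auto
      then have ae2: "AE y in ?M. \<forall>S\<in>Sd. \<forall>a r. y \<notin> trapped P n t0 S (\<delta> S) (t0 + real a) (real r)"
        unfolding AE_ball_countable[OF cSd] AE_all_countable by blast
      from ae1 ae2 show "AE y in ?M. (\<lambda>i\<in>{3..n}. (P i ** cayley (fst (y i)), snd (y i))) \<notin> exceptional_states n t0"
      proof eventually_elim
        case (elim y)
        show ?case
        proof
          assume "(\<lambda>i\<in>{3..n}. (P i ** cayley (fst (y i)), snd (y i))) \<in> exceptional_states n t0"
          then obtain E W where sol: "cascade_solution G n t0 E W"
            and eq: "(\<lambda>i\<in>{3..n}. st y i) = (\<lambda>i\<in>{3..n}. (E i t0, W i t0))"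
            and bad: "\<not> (\<forall>i\<in>{3..n}. converges (att_error G E) (spatial_rate W) i)"
            unfolding exceptional_states_def st_def by blast
          have init: "E i t0 = P i ** cayley (fst (y i)) \<and> W i t0 = snd (y i)" if "i \<in> {3..n}" for i
            using fun_cong[OF eq, of i] that by (simp add: st_def)
          define Q where "Q = att_error G E"
          define w where "w = spatial_rate W"
          have nl: "n \<le> last_index G" using n by simp
          have cas: "error_cascade n t0 Q w"
            unfolding Q_def w_def by (rule error_cascade_spatial_rate[OF sol Suc.prems(2) nl])
          have start: "chart_start P n t0 y Q w"
            unfolding chart_start_def using cas init by (simp add: Q_def w_def att_error_def spatial_rate_def)
          have prev: "converges Q w j" if j: "j \<in> {3..k}" for j
          proof (rule ccontr)
            assume "\<not> converges Q w j"
            then have "(\<lambda>i\<in>{3..k}. (E i t0, W i t0)) \<in> exceptional_states k t0"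
              unfolding exceptional_states_def mem_Collect_eq
              by (intro exI[of _ E] exI[of _ W] conjI refl cascade_solution_mono[OF sol n(5)])
                (use j in \<open>auto simp: Q_def w_def\<close>)
            moreover have "(\<lambda>i\<in>{3..k}. (E i t0, W i t0)) = (\<lambda>i\<in>{3..k}. st y i)"
              by (intro restrict_ext) (use init n(2) in \<open>auto simp: st_def\<close>)
            ultimately show False using elim(1) by simp
          qed
          have "\<And>j. j \<in> {3..<n} \<Longrightarrow> settles (Q j) (w j)" using prev n(4) by (auto simp: converges_def)
          from error_cascade_reaches_equilibrium[OF cas nl Suc.prems(2) _ this]
          obtain S where S: "F.equilibrium S" "(Q n \<longlongrightarrow> S) at_top" "(w n \<longlongrightarrow> 0) at_top"
            "S = mat 1 \<longrightarrow> settles (Q n) (w n)" using n(1) by auto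
          have "S \<noteq> mat 1"
          proof
            assume "S = mat 1"
            then have "converges Q w n" using S by (simp add: converges_def)
            then show False using bad prev n(2) by (auto simp: Q_def w_def)
          qed
          then have Sd: "S \<in> Sd" using S by (simp add: Sd_def)
          have "\<forall>\<^sub>F t in at_top. \<forall>j\<in>{3..k}. dist (Q j t) (mat 1) < \<delta> S"
          proof (rule eventually_ball_finite)
            show "\<forall>j\<in>{3..k}. \<forall>\<^sub>F t in at_top. dist (Q j t) (mat 1) < \<delta> S"
            proof
              fix j assume "j \<in> {3..k}"
              then have "(Q j \<longlongrightarrow> mat 1) at_top" using prev by (simp add: converges_def)
              then show "\<forall>\<^sub>F t in at_top. dist (Q j t) (mat 1) < \<delta> S" by (rule tendstoD[OF _ \<delta>[OF Sd]])
            qed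
          qed simp
          moreover note tendstoD[OF S(2) \<delta>[OF Sd]] tendstoD[OF S(3) \<delta>[OF Sd]]
          ultimately have "\<forall>\<^sub>F t in at_top. (\<forall>j\<in>{3..k}. dist (Q j t) (mat 1) < \<delta> S) \<and>
              dist (Q n t) S < \<delta> S \<and> dist (w n t) 0 < \<delta> S"
            by eventually_elim simp
          then obtain T where T: "\<And>t. T \<le> t \<Longrightarrow> (\<forall>j\<in>{3..k}. dist (Q j t) (mat 1) < \<delta> S) \<and>
              dist (Q n t) S < \<delta> S \<and> dist (w n t) 0 < \<delta> S"
            unfolding eventually_at_top_linorder by blast
          (* Integer entry times and radii make the union countable. *)
          obtain a :: nat where a: "T - t0 \<le> real a" using real_arch_simple by blast
          obtain r :: nat where r: "norm (y n) \<le> real r" using real_arch_simple by blast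
          have "\<forall>t\<ge>t0 + real a. (\<forall>j\<in>{3..<n}. norm (Q j t - mat 1) \<le> \<delta> S) \<and> norm (Q n t - S) \<le> \<delta> S \<and> norm (w n t) \<le> \<delta> S"
          proof (intro allI impI)
            fix t assume "t0 + real a \<le> t"
            then have "T \<le> t" using a by simp
            from T[OF this] show "(\<forall>j\<in>{3..<n}. norm (Q j t - mat 1) \<le> \<delta> S) \<and> norm (Q n t - S) \<le> \<delta> S \<and> norm (w n t) \<le> \<delta> S"
              unfolding n(4) by (auto simp: dist_norm less_imp_le)
          qed
          then have "y \<in> trapped P n t0 S (\<delta> S) (t0 + real a) (real r)"
            unfolding trapped_def using start r by blast
          then show False using elim(2) Sd by blast
        qed
      qed
    qed
    then show ?thesis by (simp add: n_def)
  qed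
qed

lemma stable_cascade:
  assumes k: "k \<le> last_index G" and t0: "0 \<le> t0"
  shows "cascade_stable G k t0"
  unfolding cascade_stable_def
proof (intro allI impI)
  fix e :: real assume e: "0 < e"
  obtain \<delta> where \<delta>: "0 < \<delta>" and st: "\<And>Q w t i. error_cascade k t0 Q w \<Longrightarrow>
    \<forall>i\<in>{3..k}. norm (Q i t0 - mat 1) < \<delta> \<and> norm (w i t0) < \<delta> \<Longrightarrow> t0 \<le> t \<Longrightarrow> i \<in> {3..k} \<Longrightarrow>
    norm (Q i t - mat 1) < e \<and> norm (w i t) < e"
    using error_cascade_stable[OF k t0 e] by blast
  have nw: "norm (spatial_rate W i t) = norm (W i t)" if "i \<in> {3..k}" "t0 \<le> t" for W i t
    using norm_spatial_rate[of i t W] that k t0 by simp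
  show "\<exists>\<delta>>0. \<forall>E W. cascade_solution G k t0 E W \<longrightarrow>
      (\<forall>i\<in>{3..k}. norm (att_error G E i t0 - mat 1) < \<delta> \<and> norm (W i t0) < \<delta>) \<longrightarrow>
      (\<forall>t\<ge>t0. \<forall>i\<in>{3..k}. norm (att_error G E i t - mat 1) < e \<and> norm (W i t) < e)"
  proof (intro exI[of _ \<delta>] conjI \<delta> allI impI ballI)
    fix E W t i assume "cascade_solution G k t0 E W" and init: "\<forall>i\<in>{3..k}. norm (att_error G E i t0 - mat 1) < \<delta> \<and> norm (W i t0) < \<delta>"
      and t: "t0 \<le> t" and i: "i \<in> {3..k}"
    then have cas: "error_cascade k t0 (att_error G E) (spatial_rate W)"
      by (intro error_cascade_spatial_rate t0 k)
    have "norm (att_error G E i t - mat 1) < e \<and> norm (spatial_rate W i t) < e"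
      by (rule st[OF cas _ t i]) (use init nw in simp)
    then show "norm (att_error G E i t - mat 1) < e" "norm (W i t) < e" using nw[OF i t] by auto
  qed
qed

lemma attractive_cascade:
  assumes k: "k \<in> {3..last_index G}" and t0: "0 \<le> t0"
  shows "almost_globally_attractive G k t0"
  unfolding almost_globally_attractive_def
proof (intro exI[of _ "exceptional_states k t0"] conjI allI impI)
  show "null_states {3..k} (exceptional_states k t0)" by (rule null_exceptional_states) (use k t0 in auto)
  fix E W assume sol: "cascade_solution G k t0 E W" and good: "(\<lambda>i\<in>{3..k}. (E i t0, W i t0)) \<notin> exceptional_states k t0"
  then have "\<forall>i\<in>{3..k}. converges (att_error G E) (spatial_rate W) i" unfolding exceptional_states_def by blast
  then have c: "converges (att_error G E) (spatial_rate W) k" using k by simp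
  then show "(att_error G E k \<longlongrightarrow> mat 1) at_top" by (simp add: converges_def)
  have "((\<lambda>t. norm (spatial_rate W k t)) \<longlongrightarrow> 0) at_top"
    using c by (intro tendsto_norm_zero) (simp add: converges_def)
  moreover have "\<forall>\<^sub>F t in at_top. norm (spatial_rate W k t) = norm (W k t)"
    using eventually_ge_at_top[of 0] by eventually_elim (rule norm_spatial_rate[OF k])
  ultimately have "((\<lambda>t. norm (W k t)) \<longlongrightarrow> 0) at_top" by (rule Lim_transform_eventually)
  then show "(W k \<longlongrightarrow> 0) at_top" by (rule tendsto_norm_zero_cancel)
qed

end

theorem theorem2:
  fixes G :: network and k :: nat
  assumes "twin_leader_follower G"
    and "k \<in> {3..last_index G}"
  shows "almost_globally_asymptotically_stable G k"
proof -
  interpret twin_leader_follower G by (rule assms(1))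
  show ?thesis
    unfolding almost_globally_asymptotically_stable_def
    using stable_cascade attractive_cascade[OF assms(2)] assms(2) by simp
qed

end
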